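(* Let $w$ be a graphon and $\alpha\in(0,1)$ a constant such that: there is a decreasing (i.e. non-increasing) function $f:[0,1]\to[0,1]$ with $w(x,y)=f(|x-y|)$ for all $x,y\in[0,1]$; there are constants $0<d<0.5$ and $0\le c<f(0)$ with $f(z)=c$ for all $z\ge d$; and, with $d'=\min\{0.5,2d\}$, $$\inf_{s\in[0,d]}\int_0^1 f(z)f(|s-z|)\,dz\;>\;\alpha\;>\;\int_0^1 f\left(\left|z-\tfrac{1-d'}{2}\right|\right)f\left(\left|z-\tfrac{1+d'}{2}\right|\right)dz .$$ For $n\in\mathbb N$ let $G_n\sim w$ be a random graph of size $n$. Run the Main Estimation Algorithm (described in the context) on input $G_n$ with truncation level $\alpha$ and parameters $m=\log(n)^5$, $t=(n\log n)^2$, $\zeta=4\log(n)^4$. Then the output is a permutation $\sigma$ of $\{1,\dots,n\}$ with error $\mathfrak D$ satisfying $$\mathfrak D\le \sqrt n\,\log(n)^5$$ with extreme probability.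
   Context: **Graphons and samples.** A graphon is a symmetric measurable function $w:[0,1]^2\to[0,1]$. A random graph $G_n\sim w$ on $V=\{1,\dots,n\}$ is obtained from independent $\mathrm{Unif}[0,1]$ variables $(U_i)_{1\le i\le n}$, $(U_{i,j})_{1\le i<j\le n}$ by declaring $\{i,j\}$ an edge iff $U_{i,j}<w(U_i,U_j)$. **With extreme probability (w.e.p.).** Events $\mathcal A^{(n)}$ hold w.e.p. if there are $c_1,c_2>0$ and $N_0$ with $\mathbb P[\mathcal A^{(n)}]\ge 1-n^{-c_1\log(n)^{c_2}}$ for all $n>N_0$. Probability is over $G_n$ and the internal randomness of the algorithm. **Error.** Let $\sigma_{\mathrm{true}}(i)=|\{j:U_j\le U_i\}|$ and let $\sigma_{\mathrm{eurt}}=n+1-\sigma_{\mathrm{true}}$ be its reverse; these two are the correct permutations. A permutation $\sigma$ has error less than $\mathfrak D$ if there is a correct permutation $\sigma_{\mathrm{correct}}\in\{\sigma_{\mathrm{true}},\sigma_{\mathrm{eurt}}\}$ such that $\sigma(i)>\sigma(j)$ for all $i,j$ with $\sigma_{\mathrm{correct}}(i)>\sigma_{\mathrm{correct}}(j)+\mathfrak D$. The conclusion says that $\sigma$ has error less than $\sqrt n\log(n)^5$ in this sense. **Comparisons.** Let $\tilde V=\{(u,v)\in V^2:u<v\}$. A function $F:\tilde V\to\{-1,0,1\}$ is extended to the antisymmetric function on $V^2$ ($F(v,u)=-F(u,v)$, $F(u,u)=0$); $F(u,v)=1$ is read "$u$ before $v$". For a comparison $F$ put $\gamma_F(i)=\sum_{j\in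 V}F(j,i)$ and $\sigma_F(i)=|\{j\in V:\gamma_F(j)\le\gamma_F(i)\}|$, with ties in $\gamma_F$ broken arbitrarily so that $\sigma_F$ is a permutation. **Unit interval graphs.** An interval order of a graph $H$ on a vertex set $S$ is a bijection $\sigma:S\to\{1,\dots,|S|\}$ such that whenever $\sigma(u)<\sigma(v)<\sigma(x)$ and $u,x$ are adjacent, $u,v$ are adjacent and $v,x$ are adjacent. A (proper, equivalently unit) interval graph is a graph having an interval order. **Main Estimation Algorithm** (sample size $m$, running time $t$, threshold $\zeta$, truncation level $\alpha$; real parameters are rounded to integers where needed). Input: graph $G=(V,E)$, $|V|=n$. 1. *Square-threshold.* Let $H=G^{(2)}_\alpha$ be the graph on $V$ in which $u\ne v$ are adjacent iff the number of common neighbours of $u,v$ in $G$ is greater than $\alpha(n-2)$. 2. *SparseSketch.* (a) Repeatedly draw independent uniformly random subsets $S\subset V$ with $|S|=m$; a draw succeeds if the induced subgraph $H(S)$ is a connected unit interval graph, in which case an interval order $\sigma$ of $H(S)$ is recorded (computed by the 3-sweep LexBFS algorithm); continue until $t$ successes $(\sigma^{(1)},S^{(1)}),\dots,(\sigma^{(t)},S^{(t)})$ have been recorded. (b) *GlobalOrder:* let $\mathcal L^{(j)}=\{u\in S^{(j)}:\sigma^{(j)}(u)<\zeta\}$, $\mathcal R^{(j)}=\{u\in S^{(j)}:\sigma^{(j)}(u)>m-\zeta\}$. For $j,k\in\{1,\dots,t\}$ set $h(j,k)=1$ if $(\mathcal L^{(j)}\cap\mathcal L^{(k)})\cup(\mathcal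 R^{(j)}\cap\mathcal R^{(k)})\neq\emptyset$; otherwise $h(j,k)=-1$ if $(\mathcal L^{(j)}\cap\mathcal R^{(k)})\cup(\mathcal R^{(j)}\cap\mathcal L^{(k)})\ne\emptyset$; otherwise $h(j,k)=0$. Find $a:\{1,\dots,t\}\to\{-1,1\}$ with $h(j,k)=a(j)a(k)$ whenever $h(j,k)\neq0$ (if none exists the output is arbitrary). For each $j$ with $a(j)=-1$ replace $\sigma^{(j)}$ by $m+1-\sigma^{(j)}$. (c) For $(u,v)\in\tilde V$ let $\mathcal C(u,v)$ be the number of $j$ with $u,v\in S^{(j)}$ and $\sigma^{(j)}(u)<\sigma^{(j)}(v)$ minus the number of $j$ with $u,v\in S^{(j)}$ and $\sigma^{(j)}(u)>\sigma^{(j)}(v)$. Let $F(u,v)=\operatorname{sign}\mathcal C(u,v)\in\{-1,0,1\}$. 3. *LocalRefinement.* Let $N(u)$ be the neighbourhood of $u$ in $H$. For each $(u,v)\in\tilde V$ let $D_{u,v}=|\{x\in N(u)\setminus N(v):F(x,v)=1\}|-|\{x\in N(u)\setminus N(v):F(x,v)=-1\}|$ and $D_{v,u}=|\{x\in N(v)\setminus N(u):F(x,u)=1\}|-|\{x\in N(v)\setminus N(u):F(x,u)=-1\}|$. If $|D_{u,v}|>|D_{v,u}|$ set $F'(u,v)=1$ if $D_{u,v}>0$ and $-1$ if $D_{u,v}\le0$. Otherwise set $F'(u,v)=1$ if $D_{v,u}<0$ and $-1$ if $D_{v,u}\ge0$. 4. Return $\sigma_{F'}$. *)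

theory Defs
  imports "HOL-Probability.Probability"
begin

text \<open>Functions on the unit interval are total functions on the reals whose values outside
  the unit interval are irrelevant. A graph on a vertex set is given by its adjacency predicate.\<close>

definition graphon :: "(real \<Rightarrow> real \<Rightarrow> real) \<Rightarrow> bool" where
  "graphon w \<longleftrightarrow>
     (\<forall>x\<in>{0..1}. \<forall>y\<in>{0..1}. w x y \<in> {0..1} \<and> w x y = w y x) \<and>
     (\<lambda>(x, y). w x y) \<in> borel_measurable (restrict_space borel ({0..1} \<times> {0..1}))"

definition random_graph ::
    "nat \<Rightarrow> (real \<Rightarrow> real \<Rightarrow> real) \<Rightarrow> (nat \<Rightarrow> real) \<Rightarrow> (nat \<times> nat \<Rightarrow> real) \<Rightarrow> nat \<Rightarrow> nat \<Rightarrow> bool" where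
  "random_graph n w U W i j \<longleftrightarrow>
     i \<in> {1..n} \<and> j \<in> {1..n} \<and> i \<noteq> j \<and> W (min i j, max i j) < w (U i) (U j)"

text \<open>The uniform distribution is taken with underlying space \<open>{0..1}\<close> (not the whole line), because
  a graphon is unconstrained, possibly not even measurable, outside the unit square.\<close>

definition unif01 :: "real measure" where
  "unif01 = restrict_space lborel {0..1}"

text \<open>All randomness of one run: the vertex variables, the edge variables, and the infinite
  i.i.d. sequence of uniformly random \<open>m\<close>-subsets of \<open>{1..n}\<close> from which the algorithm draws.\<close>

definition run_space ::
    "nat \<Rightarrow> nat \<Rightarrow> ((nat \<Rightarrow> real) \<times> (nat \<times> nat \<Rightarrow> real) \<times> (nat \<Rightarrow> nat set)) measure" where
  "run_space n m =
     (\<Pi>\<^sub>M i\<in>{1..n}. unif01) \<Otimes>\<^sub>M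
     ((\<Pi>\<^sub>M e\<in>{(i, j). 1 \<le> i \<and> i < j \<and> j \<le> n}. unif01) \<Otimes>\<^sub>M
      (\<Pi>\<^sub>M k\<in>UNIV. uniform_count_measure {S. S \<subseteq> {1..n} \<and> card S = m}))"

definition with_extreme_probability :: "(nat \<Rightarrow> 'a measure) \<Rightarrow> (nat \<Rightarrow> 'a \<Rightarrow> bool) \<Rightarrow> bool" where
  "with_extreme_probability M A \<longleftrightarrow>
     (\<exists>c\<^sub>1>0. \<exists>c\<^sub>2>0. \<exists>N\<^sub>0. \<forall>n>N\<^sub>0.
        measure (M n) {\<omega> \<in> space (M n). A n \<omega>} \<ge> 1 - real n powr (- c\<^sub>1 * ln (real n) powr c\<^sub>2))"

definition sigma_true :: "nat \<Rightarrow> (nat \<Rightarrow> real) \<Rightarrow> nat \<Rightarrow> nat" where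
  "sigma_true n U i = card {j \<in> {1..n}. U j \<le> U i}"

definition sigma_eurt :: "nat \<Rightarrow> (nat \<Rightarrow> real) \<Rightarrow> nat \<Rightarrow> nat" where
  "sigma_eurt n U i = n + 1 - sigma_true n U i"

definition error_less :: "nat \<Rightarrow> (nat \<Rightarrow> real) \<Rightarrow> (nat \<Rightarrow> nat) \<Rightarrow> real \<Rightarrow> bool" where
  "error_less n U \<sigma> D \<longleftrightarrow>
     (\<exists>\<tau>\<in>{sigma_true n U, sigma_eurt n U}. \<forall>i\<in>{1..n}. \<forall>j\<in>{1..n}.
        real (\<tau> i) > real (\<tau> j) + D \<longrightarrow> \<sigma> i > \<sigma> j)"

definition interval_order :: "('a \<Rightarrow> 'a \<Rightarrow> bool) \<Rightarrow> 'a set \<Rightarrow> ('a \<Rightarrow> nat) \<Rightarrow> bool" where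
  "interval_order H S \<sigma> \<longleftrightarrow>
     bij_betw \<sigma> S {1..card S} \<and>
     (\<forall>u\<in>S. \<forall>v\<in>S. \<forall>x\<in>S. \<sigma> u < \<sigma> v \<and> \<sigma> v < \<sigma> x \<and> H u x \<longrightarrow> H u v \<and> H v x)"

definition unit_interval_graph :: "('a \<Rightarrow> 'a \<Rightarrow> bool) \<Rightarrow> 'a set \<Rightarrow> bool" where
  "unit_interval_graph H S \<longleftrightarrow> (\<exists>\<sigma>. interval_order H S \<sigma>)"

definition connected_graph :: "('a \<Rightarrow> 'a \<Rightarrow> bool) \<Rightarrow> 'a set \<Rightarrow> bool" where
  "connected_graph H S \<longleftrightarrow>
     S \<noteq> {} \<and> (\<forall>u\<in>S. \<forall>v\<in>S. (\<lambda>x y. x \<in> S \<and> y \<in> S \<and> H x y)\<^sup>*\<^sup>* u v)"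

text \<open>Only the values of a comparison at pairs \<open>u < v\<close> matter.\<close>

definition antisym_ext :: "(nat \<Rightarrow> nat \<Rightarrow> int) \<Rightarrow> nat \<Rightarrow> nat \<Rightarrow> int" where
  "antisym_ext F u v = (if u < v then F u v else if v < u then - F v u else 0)"

definition gamma_cmp :: "nat \<Rightarrow> (nat \<Rightarrow> nat \<Rightarrow> int) \<Rightarrow> nat \<Rightarrow> int" where
  "gamma_cmp n F i = (\<Sum>j\<in>{1..n}. antisym_ext F j i)"

text \<open>The relation \<open>r\<close>, a linear order on \<open>{1..n}\<close>, breaks the ties.\<close>

definition sigma_cmp :: "nat \<Rightarrow> (nat \<times> nat) set \<Rightarrow> (nat \<Rightarrow> nat \<Rightarrow> int) \<Rightarrow> nat \<Rightarrow> nat" where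
  "sigma_cmp n r F i =
     card {j \<in> {1..n}. gamma_cmp n F j < gamma_cmp n F i \<or>
                        gamma_cmp n F j = gamma_cmp n F i \<and> (j, i) \<in> r}"

definition square_threshold ::
    "nat \<Rightarrow> real \<Rightarrow> (nat \<Rightarrow> nat \<Rightarrow> bool) \<Rightarrow> nat \<Rightarrow> nat \<Rightarrow> bool" where
  "square_threshold n \<alpha> G u v \<longleftrightarrow>
     u \<in> {1..n} \<and> v \<in> {1..n} \<and> u \<noteq> v \<and>
     real (card {x \<in> {1..n}. G u x \<and> G v x}) > \<alpha> * (real n - 2)"

definition successes :: "(nat \<Rightarrow> nat \<Rightarrow> bool) \<Rightarrow> (nat \<Rightarrow> nat set) \<Rightarrow> nat set" where
  "successes H draws = {k. connected_graph H (draws k) \<and> unit_interval_graph H (draws k)}"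

definition sampling_terminates ::
    "nat \<Rightarrow> (nat \<Rightarrow> nat \<Rightarrow> bool) \<Rightarrow> (nat \<Rightarrow> nat set) \<Rightarrow> bool" where
  "sampling_terminates t H draws \<longleftrightarrow> infinite (successes H draws) \<or> t \<le> card (successes H draws)"

text \<open>The recorded sets, indexed by \<open>{..<t}\<close>.\<close>

definition recorded_set :: "(nat \<Rightarrow> nat \<Rightarrow> bool) \<Rightarrow> (nat \<Rightarrow> nat set) \<Rightarrow> nat \<Rightarrow> nat set" where
  "recorded_set H draws j = draws (enumerate (successes H draws) j)"

definition left_end :: "real \<Rightarrow> nat set \<Rightarrow> (nat \<Rightarrow> nat) \<Rightarrow> nat set" where
  "left_end \<zeta> S \<sigma> = {u \<in> S. real (\<sigma> u) < \<zeta>}"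

definition right_end :: "nat \<Rightarrow> real \<Rightarrow> nat set \<Rightarrow> (nat \<Rightarrow> nat) \<Rightarrow> nat set" where
  "right_end m \<zeta> S \<sigma> = {u \<in> S. real (\<sigma> u) > real m - \<zeta>}"

definition overlap_sign ::
    "nat \<Rightarrow> real \<Rightarrow> (nat \<Rightarrow> nat set) \<Rightarrow> (nat \<Rightarrow> nat \<Rightarrow> nat) \<Rightarrow> nat \<Rightarrow> nat \<Rightarrow> int" where
  "overlap_sign m \<zeta> S \<sigma> j k =
     (let L = (\<lambda>i. left_end \<zeta> (S i) (\<sigma> i)); R = (\<lambda>i. right_end m \<zeta> (S i) (\<sigma> i)) in
      if (L j \<inter> L k) \<union> (R j \<inter> R k) \<noteq> {} then 1
      else if (L j \<inter> R k) \<union> (R j \<inter> L k) \<noteq> {} then -1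
      else 0)"

definition valid_signs ::
    "nat \<Rightarrow> nat \<Rightarrow> real \<Rightarrow> (nat \<Rightarrow> nat set) \<Rightarrow> (nat \<Rightarrow> nat \<Rightarrow> nat) \<Rightarrow> (nat \<Rightarrow> int) \<Rightarrow> bool" where
  "valid_signs m t \<zeta> S \<sigma> a \<longleftrightarrow>
     (\<forall>j<t. a j \<in> {-1, 1}) \<and>
     (\<forall>j<t. \<forall>k<t. overlap_sign m \<zeta> S \<sigma> j k \<noteq> 0 \<longrightarrow> overlap_sign m \<zeta> S \<sigma> j k = a j * a k)"

definition reorient :: "nat \<Rightarrow> (nat \<Rightarrow> int) \<Rightarrow> (nat \<Rightarrow> nat \<Rightarrow> nat) \<Rightarrow> nat \<Rightarrow> nat \<Rightarrow> nat" where
  "reorient m a \<sigma> j u = (if a j = -1 then m + 1 - \<sigma> j u else \<sigma> j u)"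

definition vote :: "nat \<Rightarrow> (nat \<Rightarrow> nat set) \<Rightarrow> (nat \<Rightarrow> nat \<Rightarrow> nat) \<Rightarrow> nat \<Rightarrow> nat \<Rightarrow> int" where
  "vote t S \<sigma> u v =
     int (card {j. j < t \<and> u \<in> S j \<and> v \<in> S j \<and> \<sigma> j u < \<sigma> j v}) -
     int (card {j. j < t \<and> u \<in> S j \<and> v \<in> S j \<and> \<sigma> j u > \<sigma> j v})"

definition sketch_comparison ::
    "nat \<Rightarrow> nat \<Rightarrow> (nat \<Rightarrow> nat set) \<Rightarrow> (nat \<Rightarrow> nat \<Rightarrow> nat) \<Rightarrow> (nat \<Rightarrow> int) \<Rightarrow> nat \<Rightarrow> nat \<Rightarrow> int" where
  "sketch_comparison m t S \<sigma> a u v = sgn (vote t S (reorient m a \<sigma>) u v)"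

definition neighbourhood :: "nat \<Rightarrow> (nat \<Rightarrow> nat \<Rightarrow> bool) \<Rightarrow> nat \<Rightarrow> nat set" where
  "neighbourhood n H u = {x \<in> {1..n}. H u x}"

definition refine_score ::
    "nat \<Rightarrow> (nat \<Rightarrow> nat \<Rightarrow> bool) \<Rightarrow> (nat \<Rightarrow> nat \<Rightarrow> int) \<Rightarrow> nat \<Rightarrow> nat \<Rightarrow> int" where
  "refine_score n H F u v =
     int (card {x \<in> neighbourhood n H u - neighbourhood n H v. antisym_ext F x v = 1}) -
     int (card {x \<in> neighbourhood n H u - neighbourhood n H v. antisym_ext F x v = -1})"

definition local_refinement ::
    "nat \<Rightarrow> (nat \<Rightarrow> nat \<Rightarrow> bool) \<Rightarrow> (nat \<Rightarrow> nat \<Rightarrow> int) \<Rightarrow> nat \<Rightarrow> nat \<Rightarrow> int" where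
  "local_refinement n H F u v =
     (if \<bar>refine_score n H F u v\<bar> > \<bar>refine_score n H F v u\<bar>
      then (if refine_score n H F u v > 0 then 1 else -1)
      else (if refine_score n H F v u < 0 then 1 else -1))"

text \<open>\<open>main_output n \<alpha> m t \<zeta> G draws \<rho>\<close>: on the input \<open>G\<close>, with the subset draws \<open>draws\<close>,
  \<open>\<rho>\<close> is a possible output. What the algorithm leaves open is nondeterministic: which interval
  orders are recorded (any implementation, such as 3-sweep LexBFS, picks some of them), which valid
  \<open>a\<close> is found, and how ties are broken. If there is no valid \<open>a\<close>, every \<open>\<rho>\<close> is possible.
  Meaningful only if \<open>sampling_terminates\<close> holds.\<close>

definition main_output ::
    "nat \<Rightarrow> real \<Rightarrow> nat \<Rightarrow> nat \<Rightarrow> real \<Rightarrow> (nat \<Rightarrow> nat \<Rightarrow> bool) \<Rightarrow> (nat \<Rightarrow> nat set) \<Rightarrow> (nat \<Rightarrow> nat) \<Rightarrow> bool" where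
  "main_output n \<alpha> m t \<zeta> G draws \<rho> \<longleftrightarrow>
     (let H = square_threshold n \<alpha> G; S = recorded_set H draws in
      \<exists>\<sigma>. (\<forall>j<t. interval_order H (S j) (\<sigma> j)) \<and>
          ((\<exists>a. valid_signs m t \<zeta> S \<sigma> a) \<longrightarrow>
           (\<exists>a r. valid_signs m t \<zeta> S \<sigma> a \<and> linear_order_on {1..n} r \<and>
              (\<forall>i\<in>{1..n}.
                 \<rho> i = sigma_cmp n r (local_refinement n H (sketch_comparison m t S \<sigma> a)) i))))"

text \<open>The run terminates and, however the open choices are resolved, its output is a permutation
  with error less than \<open>D\<close>.\<close>

definition main_succeeds ::
    "nat \<Rightarrow> real \<Rightarrow> nat \<Rightarrow> nat \<Rightarrow> real \<Rightarrow> (real \<Rightarrow> real \<Rightarrow> real) \<Rightarrow> real \<Rightarrow>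
     (nat \<Rightarrow> real) \<times> (nat \<times> nat \<Rightarrow> real) \<times> (nat \<Rightarrow> nat set) \<Rightarrow> bool" where
  "main_succeeds n \<alpha> m t \<zeta> w D = (\<lambda>(U, W, draws).
     let G = random_graph n w U W in
     sampling_terminates t (square_threshold n \<alpha> G) draws \<and>
     (\<forall>\<rho>. main_output n \<alpha> m t \<zeta> G draws \<rho> \<longrightarrow>
          bij_betw \<rho> {1..n} {1..n} \<and> error_less n U \<rho> D))"

text \<open>Sample size and number of successes are rounded to integers; the threshold is only compared
  with positions, so it stays real.\<close>

definition m_param :: "nat \<Rightarrow> nat" where
  "m_param n = nat (round (ln (real n) ^ 5))"

definition t_param :: "nat \<Rightarrow> nat" where
  "t_param n = nat (round ((real n * ln (real n))\<^sup>2))"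

definition zeta_param :: "nat \<Rightarrow> real" where
  "zeta_param n = 4 * ln (real n) ^ 4"

end

(*
  Let q x y be the expected codegree density of vertices placed at x and y. The two integral conditions
  say that q exceeds \<alpha> at distance at most d and stays below \<alpha> at distance at least 1/2; moreover q
  crosses the level \<alpha> at a linear rate whenever the interval between the two points shrinks. By
  Hoeffding's inequality the thresholded graph H therefore agrees with the interval structure of the
  hidden positions, except for pairs with |q - \<alpha>| of order log n / sqrt n.

  In a random sample S, with high probability every subinterval of length of order log(n)^-3 is hit. For such
  S every interval order of H(S) is monotone, up to reversal, in the positions at distance log(n)^-2: the
  non-neighbours of a vertex on one side of it span a connected graph, hence lie on one side of it in the
  order, and close vertices are told apart by a vertex adjacent to only one of them. So no vote is ever
  wrong for vertices at constant distance, the two ends of the samples determine the orientation up to a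
  global sign, and local refinement compares correctly all vertices at distance log(n)^2 / sqrt n.
*)
theory Submission
  imports Defs "HOL-Real_Asymp.Real_Asymp"
begin

section \<open>The square of an interval graphon\<close>

text \<open>The function f may jump and may be flat, so the linear rate of q cannot come from its
  slope. It comes from the excess of f over its tail value c: if f(r) > c, then moving the outer
  point y costs q at least (f(r) - c) per unit length on a zone where the factor of the other point
  also exceeds c by f(r) - c. The argument fails only when the two zones hardly overlap, and there
  the second integral condition already puts q below \<alpha>.

  A recorded sample is only known to span a connected unit interval graph, and its pairs with q
  close to \<alpha> are arbitrary. Hence rigidity is proved for every interval order of every well
  spread sample, not only for those in which H is the exact interval graph.

  Scales, with L = ln n: q is known up to e = 4 L / sqrt n; samples have spacing about 2 / L^3 and
  resolve distances 1 / L^2; the refinement uses all vertices, with spacing 4 L / sqrt n, and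
  resolves L^2 / sqrt n. About 2 sqrt n L^2 vertices lie within that distance of a given one, well
  below sqrt n L^5.\<close>

lemma set_integrable_bounded_borel:
  fixes h :: "real \<Rightarrow> real"
  assumes "h \<in> borel_measurable borel" "\<And>z. \<bar>h z\<bar> \<le> B"
  shows "set_integrable lborel {a..b} h"
  unfolding set_integrable_def
proof (rule integrable_bounded_linear[OF bounded_linear_ident], rule Bochner_Integration.integrable_bound)
  show "integrable lborel (\<lambda>z. B * indicator {a..b} z :: real)"
    by (intro integrable_mult_right) (auto simp: integrable_indicator_iff emeasure_lborel_Icc_eq)
  show "AE z in lborel. norm (indicator {a..b} z *\<^sub>R h z) \<le> norm (B * indicator {a..b} z)"
    using assms(2) by (auto simp: indicator_def intro: order_trans abs_ge_self)
  show "(\<lambda>z. indicator {a..b} z *\<^sub>R h z) \<in> borel_measurable lborel"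
    using assms(1) by measurable
qed

lemma integrable_on_bounded_borel:
  fixes h :: "real \<Rightarrow> real"
  assumes "h \<in> borel_measurable borel" "\<And>z. \<bar>h z\<bar> \<le> B"
  shows "h integrable_on {a..b}"
  by (rule set_borel_integral_eq_integral[OF set_integrable_bounded_borel[OF assms]])

lemma integral_diff_shift:
  fixes h :: "real \<Rightarrow> real"
  shows "integral {a..b} (\<lambda>z. h (z - x)) = integral {a - x..b - x} h"
  using integral_shift_real_ivl[of a "x" b "\<lambda>z. h (z - x)"] by simp

lemma integral_reflect_shift:
  fixes h :: "real \<Rightarrow> real"
  shows "integral {a..b} (\<lambda>z. h (x - z)) = integral {x - b..x - a} h"
proof -
  have "integral {a..b} (\<lambda>z. h (x - z)) = integral {-b..-a} (\<lambda>z. h (x + z))"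
    using Henstock_Kurzweil_Integration.integral_reflect_real[of b a "\<lambda>z. h (x - z)"] by simp
  also have "\<dots> = integral {x - b..x - a} h"
    using integral_diff_shift[of "-b" "-a" h "-x"] by (simp add: add.commute)
  finally show ?thesis .
qed

text \<open>An even function on the whole line replaces \<open>f\<close> on the unit interval, so
  that translating and reflecting integrals needs no side conditions on the domain. The theorem
  instantiates it with \<open>f (min 1 \<bar>z\<bar>)\<close>.\<close>

locale link_profile =
  fixes \<phi> :: "real \<Rightarrow> real" and c d :: real
  assumes even: "\<phi> (- z) = \<phi> z"
    and nonneg: "0 \<le> \<phi> z" and le1: "\<phi> z \<le> 1"
    and decreasing: "0 \<le> z \<Longrightarrow> z \<le> z' \<Longrightarrow> \<phi> z' \<le> \<phi> z"
    and const: "d \<le> z \<Longrightarrow> \<phi> z = c"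
    and d_pos: "0 < d" and d_half: "d < 1/2"
begin

lemma phi_abs: "\<phi> \<bar>z\<bar> = \<phi> z"
  using even[of z] by (auto simp: abs_if)

lemma decreasing_abs: "\<bar>z\<bar> \<le> \<bar>z'\<bar> \<Longrightarrow> \<phi> z' \<le> \<phi> z"
  using decreasing[of "\<bar>z\<bar>" "\<bar>z'\<bar>"] by (simp add: phi_abs)

lemma const_abs: "d \<le> \<bar>z\<bar> \<Longrightarrow> \<phi> z = c"
  using const[of "\<bar>z\<bar>"] by (simp add: phi_abs)

lemma c_le: "c \<le> \<phi> z"
proof (cases "\<bar>z\<bar> \<le> d")
  case True
  then show ?thesis using decreasing_abs[of z d] const[of d] d_pos by simp
next
  case False
  then show ?thesis using const_abs[of z] by simp
qed

lemma c_nonneg: "0 \<le> c"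
  using const[of d] nonneg[of d] by simp

lemma phi_commute: "\<phi> (x - y) = \<phi> (y - x)"
  using even[of "x - y"] by simp

lemma phi_measurable [measurable]: "\<phi> \<in> borel_measurable borel"
proof -
  have "mono (\<lambda>z. - \<phi> (max 0 z))"
    by (auto simp: mono_def intro!: decreasing)
  then have [measurable]: "(\<lambda>z. - \<phi> (max 0 z)) \<in> borel_measurable borel"
    by (rule borel_measurable_mono)
  have "(\<lambda>z. - (- \<phi> (max 0 \<bar>z\<bar>))) \<in> borel_measurable borel"
    by measurable
  then show ?thesis by (simp add: phi_abs)
qed

lemma phi_abs_le: "\<bar>\<phi> z\<bar> \<le> 1"
  using nonneg[of z] le1[of z] by simp

lemma phi_mult_abs_le: "\<bar>\<phi> z * \<phi> z'\<bar> \<le> 1"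
  using nonneg le1 by (auto simp: abs_mult intro!: mult_le_one)

lemma integrable_phi: "\<phi> integrable_on {a..b}"
  by (rule integrable_on_bounded_borel[where B=1]) (auto simp: phi_abs_le)

lemma integrable_phi_shift: "(\<lambda>z. \<phi> (z - x)) integrable_on {a..b}"
  by (rule integrable_on_bounded_borel[where B=1]) (auto simp: phi_abs_le)

lemma integrable_phi_mult: "(\<lambda>z. \<phi> (z - x) * \<phi> (z - y)) integrable_on {a..b}"
  by (rule integrable_on_bounded_borel[where B=1]) (auto simp: phi_mult_abs_le)

text \<open>The q of the overview: the probability that a third vertex at a uniform position is
  adjacent to vertices at \<open>x\<close> and \<open>y\<close>.\<close>

definition sq :: "real \<Rightarrow> real \<Rightarrow> real" where
  "sq x y = integral {0..1} (\<lambda>z. \<phi> (z - x) * \<phi> (z - y))"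

lemma sq_sym: "sq x y = sq y x"
  unfolding sq_def by (simp add: mult.commute)

lemma sq_refl: "sq (1 - x) (1 - y) = sq x y"
proof -
  have "sq (1 - x) (1 - y) = integral {0..1} (\<lambda>z. (\<lambda>z. \<phi> (z - x) * \<phi> (z - y)) (1 - z))"
    unfolding sq_def
  proof (intro integral_cong)
    fix z
    show "\<phi> (z - (1 - x)) * \<phi> (z - (1 - y)) = \<phi> (1 - z - x) * \<phi> (1 - z - y)"
      using even[of "1 - z - x"] even[of "1 - z - y"] by (simp add: algebra_simps)
  qed
  also have "\<dots> = sq x y"
    by (subst integral_reflect_shift) (simp add: sq_def)
  finally show ?thesis .
qed

lemma sq_nonneg: "0 \<le> sq x y"
  unfolding sq_def by (intro integral_nonneg integrable_phi_mult) (simp add: nonneg)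

text \<open>Splitting \<open>{a..e}\<close> at \<open>c'\<close> and at \<open>b\<close>: moving a
  window changes its integral only by the pieces gained and lost at its ends.\<close>

lemma integral_phi_diff_swap:
  assumes "a \<le> b" "a \<le> c'" "b \<le> e" "c' \<le> e"
  shows "integral {a..c'} \<phi> - integral {b..e} \<phi> = integral {a..b} \<phi> - integral {c'..e} \<phi>"
  using Henstock_Kurzweil_Integration.integral_combine[OF assms(2,4) integrable_phi]
        Henstock_Kurzweil_Integration.integral_combine[OF assms(1,3) integrable_phi]
  by simp

lemma integral_phi_le: "a \<le> b \<Longrightarrow> integral {a..b} \<phi> \<le> b - a"
  using integral_le[OF integrable_phi integrable_const_ivl[of 1 a b]] le1 by simp

text \<open>Since \<open>\<phi>\<close> may jump, there is no pointwise bound on the integrand.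
  Instead the negative part of the difference is dropped, the other factor is bounded by 1, and what
  remains is a difference of two shifted windows, which telescopes to a piece of length
  \<open>x' - x\<close>.\<close>

lemma sq_lipschitz_up:
  assumes "0 \<le> x" "x \<le> x'" "x' \<le> 1"
  shows "sq x' y - sq x y \<le> x' - x"
proof -
  \<comment> \<open>Left of the midpoint \<open>x\<close> is the closer of the two points, right of
    it \<open>x'\<close> is; so \<open>D\<close> below changes sign exactly there.\<close>
  define m where "m = (x + x') / 2"
  have m: "0 \<le> m" "m \<le> 1" "x \<le> m" "m \<le> x'" using assms by (auto simp: m_def)
  define D where "D = (\<lambda>z. \<phi> (z - x') - \<phi> (z - x))"
  have D_meas [measurable]: "D \<in> borel_measurable borel" unfolding D_def by measurable
  have D_abs: "\<bar>D z\<bar> \<le> 1" for z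
    using nonneg[of "z - x"] nonneg[of "z - x'"] le1[of "z - x"] le1[of "z - x'"]
    by (auto simp: D_def abs_if)
  have DI: "(\<lambda>z. D z * \<phi> (z - y)) integrable_on {a..b}" for a b
    by (rule integrable_on_bounded_borel[where B=1])
       (auto simp: abs_mult intro!: mult_le_one phi_abs_le D_abs)
  have DI': "D integrable_on {a..b}" for a b
    by (rule integrable_on_bounded_borel[where B=1]) (auto simp: D_abs)
  have "sq x' y - sq x y = integral {0..1} (\<lambda>z. D z * \<phi> (z - y))"
    unfolding sq_def
    by (subst Henstock_Kurzweil_Integration.integral_diff[symmetric]) (auto simp: integrable_phi_mult D_def algebra_simps)
  also have "\<dots> = integral {0..m} (\<lambda>z. D z * \<phi> (z - y)) + integral {m..1} (\<lambda>z. D z * \<phi> (z - y))"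
    using Henstock_Kurzweil_Integration.integral_combine[OF m(1,2) DI] by simp
  also have "integral {0..m} (\<lambda>z. D z * \<phi> (z - y)) \<le> integral {0..m} (\<lambda>z. 0)"
  proof (rule integral_le[OF DI])
    fix z assume "z \<in> {0..m}"
    then have "D z \<le> 0"
      unfolding D_def using assms by (auto simp: m_def intro!: decreasing_abs)
    then show "D z * \<phi> (z - y) \<le> 0" using nonneg by (simp add: mult_nonpos_nonneg)
  qed auto
  also have "integral {m..1} (\<lambda>z. D z * \<phi> (z - y)) \<le> integral {m..1} D"
  proof (rule integral_le[OF DI DI'])
    fix z assume "z \<in> {m..1}"
    then have "D z \<ge> 0"
      unfolding D_def using assms by (auto simp: m_def intro!: decreasing_abs)
    then show "D z * \<phi> (z - y) \<le> D z"
      using le1[of "z - y"] by (simp add: mult_left_le)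
  qed
  also have "integral {m..1} D = integral {m - x'..1 - x'} \<phi> - integral {m - x..1 - x} \<phi>"
    unfolding D_def
    by (subst Henstock_Kurzweil_Integration.integral_diff) (auto simp: integrable_phi_shift integral_diff_shift)
  also have "\<dots> = integral {m - x'..m - x} \<phi> - integral {1 - x'..1 - x} \<phi>"
    using assms m by (intro integral_phi_diff_swap) auto
  also have "\<dots> \<le> (x' - x) - 0"
    using assms integral_phi_le[of "m - x'" "m - x"]
    by (intro diff_mono integral_nonneg integrable_phi) (auto simp: nonneg)
  finally show ?thesis by simp
qed

lemma sq_lipschitz1:
  assumes "x \<in> {0..1}" "x' \<in> {0..1}"
  shows "\<bar>sq x y - sq x' y\<bar> \<le> \<bar>x - x'\<bar>"
proof -
  have *: "\<bar>sq x y - sq x' y\<bar> \<le> x' - x" if "0 \<le> x" "x \<le> x'" "x' \<le> 1" for x x'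
    using sq_lipschitz_up[of x x' y] sq_lipschitz_up[of "1 - x'" "1 - x" "1 - y"] that
    by (simp add: sq_refl abs_le_iff)
  show ?thesis
    using *[of x x'] *[of x' x] assms by (cases "x \<le> x'") (auto simp: abs_minus_commute)
qed

lemma sq_lipschitz:
  assumes "x \<in> {0..1}" "x' \<in> {0..1}" "y \<in> {0..1}" "y' \<in> {0..1}"
  shows "\<bar>sq x y - sq x' y'\<bar> \<le> \<bar>x - x'\<bar> + \<bar>y - y'\<bar>"
  using sq_lipschitz1[OF assms(1,2), of y] sq_lipschitz1[OF assms(3,4), of x']
  by (simp add: sq_sym[of x'])

text \<open>A pair at fixed distance is slid towards the middle: the third hypothesis says that the
  new centre is no farther from 1/2 than the old one. In coordinates relative to the left point the
  window \<open>{-t..1-t}\<close> moves, and the piece gained on one side dominates the piece lost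
  on the other pointwise.\<close>

lemma sq_shift:
  assumes "0 \<le> x" "x \<le> x'" "x + x' + \<delta> \<le> 1" "0 \<le> \<delta>"
  shows "sq x (x + \<delta>) \<le> sq x' (x' + \<delta>)"
proof -
  define k where "k = (\<lambda>v. \<phi> v * \<phi> (v - \<delta>))"
  have kI: "k integrable_on {a..b}" for a b
    unfolding k_def using integrable_phi_mult[of 0 \<delta>] by simp
  have q: "sq t (t + \<delta>) = integral {-t..1 - t} k" for t
    unfolding sq_def using integral_diff_shift[of 0 1 k t] by (simp add: k_def algebra_simps)
  have "integral {- x'..- x} k + integral {- x..1 - x} k = integral {-x'..1-x'} k + integral {1-x'..1-x} k"
    using Henstock_Kurzweil_Integration.integral_combine[OF _ _ kI, of "-x'" "-x" "1-x"]
      Henstock_Kurzweil_Integration.integral_combine[OF _ _ kI, of "-x'" "1-x'" "1-x"] assms by simp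
  moreover have "integral {1 - x'..1 - x} k \<le> integral {- x'..- x} k"
  proof -
    have "integral {1 - x'..1 - x} k = integral {x..x'} (\<lambda>v. k (v - (x + x' - 1)))"
      by (simp add: integral_diff_shift)
    also have "\<dots> \<le> integral {x..x'} (\<lambda>v. k (0 - v))"
    proof (rule integral_le)
      show "(\<lambda>v. k (v - (x + x' - 1))) integrable_on {x..x'}"
        by (rule integrable_on_bounded_borel[where B=1]) (auto simp: k_def phi_mult_abs_le)
      show "(\<lambda>v. k (0 - v)) integrable_on {x..x'}"
        by (rule integrable_on_bounded_borel[where B=1]) (auto simp: k_def phi_mult_abs_le)
      fix v assume v: "v \<in> {x..x'}"
      \<comment> \<open>The two factors are exchanged, so that each is compared with a factor whose
        argument is closer to 0.\<close>
      have "k (v - (x + x' - 1)) = \<phi> (v - (x + x' - 1) - \<delta>) * \<phi> (v - (x + x' - 1))"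
        by (simp add: k_def)
      also have "\<dots> \<le> \<phi> (0 - v) * \<phi> (0 - v - \<delta>)"
        using v assms by (intro mult_mono nonneg decreasing_abs) auto
      finally show "k (v - (x + x' - 1)) \<le> k (0 - v)" by (simp add: k_def)
    qed
    also have "\<dots> = integral {-x'..-x} k"
      by (subst integral_reflect_shift) simp
    finally show ?thesis .
  qed
  ultimately show ?thesis by (simp add: q)
qed

lemma phi_diff_abs_le: "\<bar>\<phi> a - c\<bar> \<le> 1" "\<bar>\<phi> a - \<phi> b\<bar> \<le> 1"
  using nonneg[of a] le1[of a] nonneg[of b] le1[of b] c_le[of a] c_nonneg by (auto simp: abs_if)

lemma integrable_phi_gap: "(\<lambda>z. (\<phi> (z - x) - c) * (\<phi> (z - y) - \<phi> (z - y'))) integrable_on {a..b}"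
  by (rule integrable_on_bounded_borel[where B=1])
     (auto simp: abs_mult intro!: mult_le_one phi_diff_abs_le)

lemma sq_decreasing_gap:
  assumes "0 \<le> x" "d \<le> y - x" "y \<le> y'" "y' \<le> 1"
  shows "integral {0..1} (\<lambda>z. (\<phi> (z - x) - c) * (\<phi> (z - y) - \<phi> (z - y'))) \<le> sq x y - sq x y'"
proof -
  note I1 = integrable_phi_gap[of x y y' 0 1]
  have I2: "(\<lambda>z. \<phi> (z - y) - \<phi> (z - y')) integrable_on {0..1}"
    by (intro Henstock_Kurzweil_Integration.integrable_diff integrable_phi_shift)
  have "sq x y - sq x y' = integral {0..1} (\<lambda>z. \<phi> (z - x) * (\<phi> (z - y) - \<phi> (z - y')))"
    unfolding sq_def
    by (subst Henstock_Kurzweil_Integration.integral_diff[symmetric]) (auto simp: integrable_phi_mult algebra_simps)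
  also have "\<dots> = integral {0..1} (\<lambda>z. (\<phi> (z - x) - c) * (\<phi> (z - y) - \<phi> (z - y')) + c * (\<phi> (z - y) - \<phi> (z - y')))"
    by (intro integral_cong) (simp add: algebra_simps)
  also have "\<dots> = integral {0..1} (\<lambda>z. (\<phi> (z - x) - c) * (\<phi> (z - y) - \<phi> (z - y'))) +
                  c * integral {0..1} (\<lambda>z. \<phi> (z - y) - \<phi> (z - y'))"
    using I1 integrable_on_mult_right[OF I2, of c] by (subst Henstock_Kurzweil_Integration.integral_add) auto
  also have "integral {0..1} (\<lambda>z. \<phi> (z - y) - \<phi> (z - y')) = integral {1-y'..1-y} \<phi> - integral {-y'..-y} \<phi>"
  proof -
    have "integral {0..1} (\<lambda>z. \<phi> (z - y) - \<phi> (z - y')) = integral {-y..1-y} \<phi> - integral {-y'..1-y'} \<phi>"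
      by (subst Henstock_Kurzweil_Integration.integral_diff) (auto simp: integrable_phi_shift integral_diff_shift)
    then show ?thesis using integral_phi_diff_swap[of "-y'" "1-y'" "-y" "1-y"] assms by simp
  qed
  finally have eq: "sq x y - sq x y' = integral {0..1} (\<lambda>z. (\<phi> (z - x) - c) * (\<phi> (z - y) - \<phi> (z - y'))) +
                  c * (integral {1-y'..1-y} \<phi> - integral {-y'..-y} \<phi>)" .
  have "integral {-y'..-y} \<phi> = integral {-y'..-y} (\<lambda>z. c)"
    using assms by (intro integral_cong const_abs) auto
  moreover have "integral {1-y'..1-y} (\<lambda>z. c) \<le> integral {1-y'..1-y} \<phi>"
    by (intro integral_le integrable_phi c_le) auto
  ultimately have "0 \<le> integral {1-y'..1-y} \<phi> - integral {-y'..-y} \<phi>"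
    using assms by simp
  then show ?thesis using eq c_nonneg by simp
qed

text \<open>Up to \<open>x + d\<close>, hence left of \<open>y\<close>, the point \<open>y\<close>
  is closer to \<open>z\<close> than \<open>y'\<close>; beyond \<open>x + d\<close> the first factor
  vanishes.\<close>

lemma sq_gap_pointwise:
  assumes "0 \<le> x" "d \<le> y - x" "y \<le> y'" 
  shows "0 \<le> (\<phi> (z - x) - c) * (\<phi> (z - y) - \<phi> (z - y'))"
proof (cases "z \<le> x + d")
  case True
  then have "\<phi> (z - y') \<le> \<phi> (z - y)" using assms by (intro decreasing_abs) auto
  then show ?thesis using c_le[of "z - x"] by simp
next
  case False
  then show ?thesis using const[of "z - x"] by simp
qed

lemma sq_decreasing:
  assumes "0 \<le> x" "d \<le> y - x" "y \<le> y'" "y' \<le> 1"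
  shows "sq x y' \<le> sq x y"
proof -
  have "0 \<le> integral {0..1} (\<lambda>z. (\<phi> (z - x) - c) * (\<phi> (z - y) - \<phi> (z - y')))"
    by (intro Henstock_Kurzweil_Integration.integral_nonneg integrable_phi_gap sq_gap_pointwise) (use assms in auto)
  then show ?thesis using sq_decreasing_gap[OF assms] by simp
qed

text \<open>Only \<open>z\<close> in \<open>{x..x + \<rho>}\<close> is used. There the first excess
  is at least \<open>\<phi> \<rho> - c\<close>, and the difference of the other factors telescopes
  to two pieces of length \<open>y' - y\<close>: one within \<open>\<rho>\<close> of 0, by
  \<open>y' - x \<le> 2 * \<rho>\<close>, and one beyond \<open>d\<close>, where
  \<open>\<phi>\<close> is c. Hence the square.\<close>

lemma sq_rate:
  assumes "0 \<le> x" "d \<le> y - x" "y \<le> y'" "y' \<le> 1" "y' - x \<le> 2 * \<rho>" "0 \<le> \<rho>" "\<rho> \<le> d"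
  shows "(\<phi> \<rho> - c)\<^sup>2 * (y' - y) \<le> sq x y - sq x y'"
proof -
  define g where "g = (\<lambda>z. (\<phi> (z - x) - c) * (\<phi> (z - y) - \<phi> (z - y')))"
  have gI: "g integrable_on {a..b}" for a b
    unfolding g_def by (rule integrable_phi_gap)
  have g0: "0 \<le> g z" for z unfolding g_def by (rule sq_gap_pointwise) (use assms in auto)
  have "(\<phi> \<rho> - c)\<^sup>2 * (y' - y) = (\<phi> \<rho> - c) * ((\<phi> \<rho> - c) * (y' - y))"
    by (simp add: power2_eq_square)
  also have "(\<phi> \<rho> - c) * (y' - y) \<le> integral {x..x + \<rho>} (\<lambda>z. \<phi> (z - y) - \<phi> (z - y'))"
  proof -
    have "integral {x..x + \<rho>} (\<lambda>z. \<phi> (z - y) - \<phi> (z - y')) =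
          integral {x-y..x+\<rho>-y} \<phi> - integral {x-y'..x+\<rho>-y'} \<phi>"
      by (subst Henstock_Kurzweil_Integration.integral_diff) (auto simp: integrable_phi_shift integral_diff_shift)
    also have "\<dots> = integral {x+\<rho>-y'..x+\<rho>-y} \<phi> - integral {x-y'..x-y} \<phi>"
      using integral_phi_diff_swap[of "x-y'" "x+\<rho>-y'" "x-y" "x+\<rho>-y"] assms by simp
    also have "integral {x-y'..x-y} \<phi> = integral {x-y'..x-y} (\<lambda>z. c)"
      using assms by (intro integral_cong const_abs) auto
    also have "\<dots> = c * (y' - y)" using assms by simp
    finally have *: "integral {x..x + \<rho>} (\<lambda>z. \<phi> (z - y) - \<phi> (z - y')) =
        integral {x+\<rho>-y'..x+\<rho>-y} \<phi> - c * (y' - y)" .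
    have "integral {x+\<rho>-y'..x+\<rho>-y} (\<lambda>z. \<phi> \<rho>) \<le> integral {x+\<rho>-y'..x+\<rho>-y} \<phi>"
      using assms by (intro integral_le integrable_phi decreasing_abs) auto
    then have "\<phi> \<rho> * (y' - y) \<le> integral {x+\<rho>-y'..x+\<rho>-y} \<phi>" using assms by (simp add: mult.commute)
    then show ?thesis unfolding * by (simp add: left_diff_distrib)
  qed
  then have "(\<phi> \<rho> - c) * ((\<phi> \<rho> - c) * (y' - y)) \<le> (\<phi> \<rho> - c) * integral {x..x + \<rho>} (\<lambda>z. \<phi> (z - y) - \<phi> (z - y'))"
    using c_le[of \<rho>] by (intro mult_left_mono) auto
  also have "\<dots> = integral {x..x + \<rho>} (\<lambda>z. (\<phi> \<rho> - c) * (\<phi> (z - y) - \<phi> (z - y')))"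
    by simp
  also have "\<dots> \<le> integral {x..x + \<rho>} g"
  proof (rule integral_le[OF _ gI])
    show "(\<lambda>z. (\<phi> \<rho> - c) * (\<phi> (z - y) - \<phi> (z - y'))) integrable_on {x..x + \<rho>}"
      by (rule integrable_on_bounded_borel[where B=1])
         (auto simp: abs_mult intro!: mult_le_one phi_diff_abs_le)
    fix z assume z: "z \<in> {x..x + \<rho>}"
    have "\<phi> (z - y') \<le> \<phi> (z - y)" using assms z by (intro decreasing_abs) auto
    moreover have "\<phi> \<rho> \<le> \<phi> (z - x)" using assms z by (intro decreasing_abs) auto
    ultimately show "(\<phi> \<rho> - c) * (\<phi> (z - y) - \<phi> (z - y')) \<le> g z"
      unfolding g_def by (intro mult_right_mono) auto
  qed
  also have "\<dots> \<le> integral {0..1} g"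
    using assms g0 by (intro integral_subset_le gI) auto
  also have "\<dots> \<le> sq x y - sq x y'"
    unfolding g_def by (rule sq_decreasing_gap) (use assms in auto)
  finally show ?thesis .
qed

lemma sq_decreasing_left:
  assumes "0 \<le> x" "x \<le> x'" "d \<le> y - x'" "y \<le> 1"
  shows "sq x y \<le> sq x' y"
proof -
  have "sq (1 - y) (1 - x) \<le> sq (1 - y) (1 - x')" using assms by (intro sq_decreasing) auto
  then show ?thesis by (simp add: sq_refl sq_sym[of y])
qed

text \<open>Among pairs at a given distance the one at the border of the interval has the smallest
  value; this is how the infimum in the theorem, which involves only pairs starting at 0, controls
  all close pairs.\<close>

lemma sq_near:
  assumes "x \<in> {0..1}" "y \<in> {0..1}"
  shows "sq 0 \<bar>x - y\<bar> \<le> sq x y"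
proof -
  have *: "sq 0 (y - x) \<le> sq x y" if "0 \<le> x" "x \<le> y" "y \<le> 1" for x y
    using sq_shift[of 0 x "y - x"] that by simp
  show ?thesis
    using *[of x y] *[of y x] assms by (cases "x \<le> y") (auto simp: sq_sym)
qed

text \<open>The pair is first centred at its own distance, then its right and left ends are moved
  inwards to the centred pair at distance \<open>d'\<close>. The pair \<open>x0\<close>,
  \<open>y0\<close> is the centred one before shrinking.\<close>

lemma sq_far:
  assumes "0 \<le> x" "y \<le> 1" "d' \<le> y - x" "d \<le> d'"
  shows "sq x y \<le> sq ((1 - d') / 2) ((1 + d') / 2)"
proof -
  define x0 where "x0 = (1 - (y - x)) / 2"
  define y0 where "y0 = x0 + (y - x)"
  have "sq x y \<le> sq x0 y0"
  proof (cases "x \<le> x0")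
    case True
    then show ?thesis
      using sq_shift[of x x0 "y - x"] assms d_pos by (simp add: x0_def y0_def field_simps)
  next
    case False
    then have "sq (1 - y) (1 - y + (y - x)) \<le> sq x0 (x0 + (y - x))"
      using assms d_pos by (intro sq_shift) (auto simp: x0_def field_simps)
    then show ?thesis by (simp add: y0_def sq_refl sq_sym[of y])
  qed
  also have "\<dots> \<le> sq x0 ((1 + d') / 2)"
    using assms d_pos by (intro sq_decreasing) (auto simp: x0_def y0_def field_simps)
  also have "\<dots> \<le> sq ((1 - d') / 2) ((1 + d') / 2)"
    using assms d_pos by (intro sq_decreasing_left) (auto simp: x0_def y0_def field_simps)
  finally show ?thesis .
qed

text \<open>The true radius of the zone where \<open>\<phi>\<close> exceeds c, which can be smaller
  than \<open>d\<close>. Beyond distance \<open>2 * d0\<close> the zones of two points are disjoint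
  and \<open>sq_rate\<close> gives nothing.\<close>

definition d0 :: real where
  "d0 = Sup {z. 0 \<le> z \<and> c < \<phi> z}"

text \<open>Both factors are written as c plus excess. The last term is the only one that sees the
  distance of the two points; the linear terms depend on how much of each zone is cut off at the
  border.\<close>

lemma sq_expand:
  "sq x y = c\<^sup>2 + c * integral {-x..1-x} (\<lambda>v. \<phi> v - c) + c * integral {-y..1-y} (\<lambda>v. \<phi> v - c)
     + integral {0..1} (\<lambda>z. (\<phi> (z - x) - c) * (\<phi> (z - y) - c))"
proof -
  have I: "(\<lambda>z. (\<phi> (z - x) - c) * (\<phi> (z - y) - c)) integrable_on {0..1}"
    by (rule integrable_on_bounded_borel[where B=1])
       (auto simp: abs_mult intro!: mult_le_one phi_diff_abs_le)
  have I1: "(\<lambda>z. \<phi> (z - t) - c) integrable_on {0..1}" for t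
    by (intro Henstock_Kurzweil_Integration.integrable_diff integrable_phi_shift integrable_const_ivl)
  have "((\<lambda>z. c\<^sup>2 + c * (\<phi> (z - x) - c) + c * (\<phi> (z - y) - c) + (\<phi> (z - x) - c) * (\<phi> (z - y) - c))
      has_integral (c\<^sup>2 * (1 - 0) + c * integral {0..1} (\<lambda>z. \<phi> (z - x) - c) + c * integral {0..1} (\<lambda>z. \<phi> (z - y) - c)
     + integral {0..1} (\<lambda>z. (\<phi> (z - x) - c) * (\<phi> (z - y) - c)))) {0..1}"
    using has_integral_const_real[of "c\<^sup>2" 0 1]
    by (intro has_integral_add has_integral_mult_right integrable_integral I I1) auto
  then have "((\<lambda>z. \<phi> (z - x) * \<phi> (z - y))
      has_integral (c\<^sup>2 * (1 - 0) + c * integral {0..1} (\<lambda>z. \<phi> (z - x) - c) + c * integral {0..1} (\<lambda>z. \<phi> (z - y) - c)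
     + integral {0..1} (\<lambda>z. (\<phi> (z - x) - c) * (\<phi> (z - y) - c)))) {0..1}"
    by (rule has_integral_eq[rotated]) (simp add: algebra_simps power2_eq_square)
  then show ?thesis
    unfolding sq_def integral_diff_shift[of 0 1 "\<lambda>v. \<phi> v - c", simplified, symmetric]
    by (subst integral_unique) (simp_all add: integral_diff_shift[of 0 1 "\<lambda>v. \<phi> v - c", simplified])
qed

lemma integrable_phi_minus: "(\<lambda>v. \<phi> v - c) integrable_on {a..b}"
  by (intro Henstock_Kurzweil_Integration.integrable_diff integrable_phi integrable_const_ivl)

section \<open>Effective support of the profile, and the values of the square beyond it\<close>

context
  assumes c_less: "c < \<phi> 0"
begin

lemma bdd_support: "bdd_above {z. 0 \<le> z \<and> c < \<phi> z}" and support_le: "z \<ge> 0 \<Longrightarrow> c < \<phi> z \<Longrightarrow> z \<le> d"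
proof -
  show "z \<le> d" if "z \<ge> 0" "c < \<phi> z" for z
    using const[of z] that by (cases "d \<le> z") auto
  then show "bdd_above {z. 0 \<le> z \<and> c < \<phi> z}" by (auto simp: bdd_above_def)
qed

lemma d0_bounds: "0 \<le> d0" "d0 \<le> d"
  unfolding d0_def
  using c_less by (auto intro!: cSup_upper bdd_support cSup_least simp: support_le)

lemma phi_beyond_d0: "d0 < \<bar>z\<bar> \<Longrightarrow> \<phi> z = c"
  using cSup_upper[OF _ bdd_support, of "\<bar>z\<bar>"] c_le[of z] unfolding d0_def[symmetric]
  by (force simp: phi_abs)

text \<open>At \<open>d0\<close> itself the profile may already equal c, so a radius slightly below
  it has to be used.\<close>

lemma ex_near_d0: "0 < \<epsilon> \<Longrightarrow> \<exists>\<rho>. 0 \<le> \<rho> \<and> \<rho> \<le> d0 \<and> d0 - \<epsilon> < \<rho> \<and> c < \<phi> \<rho>"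
proof -
  assume "0 < \<epsilon>"
  then have "d0 - \<epsilon> < Sup {z. 0 \<le> z \<and> c < \<phi> z}" by (simp add: d0_def)
  then obtain \<rho> where "0 \<le> \<rho>" "c < \<phi> \<rho>" "d0 - \<epsilon> < \<rho>"
    using c_less by (subst (asm) less_cSup_iff[OF _ bdd_support]) auto
  then show ?thesis using cSup_upper[OF _ bdd_support, of \<rho>] unfolding d0_def[symmetric] by auto
qed

text \<open>The product vanishes outside \<open>{y - d0..x + d0}\<close>, an interval of length less
  than \<open>2 * (d0 - \<rho>)\<close>.\<close>

lemma sq_overlap_le:
  assumes "2 * \<rho> < y - x" "\<rho> \<le> d0"
  shows "integral {0..1} (\<lambda>z. (\<phi> (z - x) - c) * (\<phi> (z - y) - c)) \<le> 2 * (d0 - \<rho>)"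
proof -
  have "integral {0..1} (\<lambda>z. (\<phi> (z - x) - c) * (\<phi> (z - y) - c)) \<le>
        integral {0..1} (\<lambda>z. if z \<in> {y - d0..x + d0} then 1 else 0)"
  proof (rule integral_le)
    show "(\<lambda>z. (\<phi> (z - x) - c) * (\<phi> (z - y) - c)) integrable_on {0..1}"
      by (rule integrable_on_bounded_borel[where B=1])
         (auto simp: abs_mult intro!: mult_le_one phi_diff_abs_le)
    show "(\<lambda>z. if z \<in> {y - d0..x + d0} then 1 else 0 :: real) integrable_on {0..1}"
      by (rule integrable_on_bounded_borel[where B=1]) auto
    fix z :: real
    show "(\<phi> (z - x) - c) * (\<phi> (z - y) - c) \<le> (if z \<in> {y - d0..x + d0} then 1 else 0)"
    proof (cases "z \<in> {y - d0..x + d0}")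
      case True
      have "\<bar>(\<phi> (z - x) - c) * (\<phi> (z - y) - c)\<bar> \<le> 1"
        by (auto simp: abs_mult intro!: mult_le_one phi_diff_abs_le)
      then show ?thesis using True by simp
    next
      case False
      then have "d0 < \<bar>z - x\<bar> \<or> d0 < \<bar>z - y\<bar>" by auto
      then have "\<phi> (z - x) = c \<or> \<phi> (z - y) = c" using phi_beyond_d0 by blast
      then show ?thesis using False by auto
    qed
  qed
  also have "\<dots> = integral ({0..1} \<inter> {y - d0..x + d0}) (\<lambda>_. 1)"
    by (simp only: Henstock_Kurzweil_Integration.integral_restrict_Int Int_commute)
  also have "\<dots> = integral {max 0 (y - d0)..min 1 (x + d0)} (\<lambda>_. 1)" by simp
  also have "\<dots> \<le> 2 * (d0 - \<rho>)"
    using assms by (cases "max 0 (y - d0) \<le> min 1 (x + d0)") auto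
  finally show ?thesis .
qed

text \<open>The symmetric pair \<open>x0\<close>, \<open>1 - x0\<close> keeps both zones inside the
  unit interval, so its linear terms in \<open>sq_expand\<close> are maximal and its overlap term is
  nonnegative; for the pair \<open>x\<close>, \<open>y\<close> the overlap term is small.\<close>

lemma sq_far_support:
  assumes "0 \<le> x" "x \<le> 1" "0 \<le> y" "y \<le> 1" "2 * \<rho> < y - x" "\<rho> \<le> d0" "d0 \<le> x0" "x0 \<le> 1/2"
  shows "sq x y \<le> sq x0 (1 - x0) + 2 * (d0 - \<rho>)"
proof -
  let ?A = "integral {-1..1} (\<lambda>v. \<phi> v - c)"
  have le: "integral {-t..1-t} (\<lambda>v. \<phi> v - c) \<le> ?A" if "0 \<le> t" "t \<le> 1" for t
    using that by (intro integral_subset_le integrable_phi_minus) (auto simp: c_le)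
  have eq: "integral {-t..1-t} (\<lambda>v. \<phi> v - c) = ?A" if t: "d0 \<le> t" "t \<le> 1 - d0" for t
  proof -
    have "integral {-t..1-t} (\<lambda>v. \<phi> v - c) = integral ({-1..1} \<inter> {-t..1-t}) (\<lambda>v. \<phi> v - c)"
      using t d0_bounds d_half by (intro arg_cong2[where f=integral]) auto
    also have "\<dots> = integral {-1..1} (\<lambda>v. if v \<in> {-t..1-t} then \<phi> v - c else 0)"
      by (simp only: Henstock_Kurzweil_Integration.integral_restrict_Int Int_commute)
    also have "\<dots> = ?A"
      using t by (intro integral_cong) (auto simp: phi_beyond_d0)
    finally show ?thesis .
  qed
  have "sq x y \<le> c\<^sup>2 + c * ?A + c * ?A + 2 * (d0 - \<rho>)"
    unfolding sq_expand using assms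
    by (intro add_mono mult_left_mono le c_nonneg sq_overlap_le) auto
  moreover have "c\<^sup>2 + c * ?A + c * ?A \<le> sq x0 (1 - x0)"
  proof -
    have "0 \<le> integral {0..1} (\<lambda>z. (\<phi> (z - x0) - c) * (\<phi> (z - (1 - x0)) - c))"
    proof (intro Henstock_Kurzweil_Integration.integral_nonneg integrable_on_bounded_borel[where B=1])
      show "\<bar>(\<phi> (z - x0) - c) * (\<phi> (z - (1 - x0)) - c)\<bar> \<le> 1" for z
        unfolding abs_mult by (intro mult_le_one phi_diff_abs_le abs_ge_zero)
    qed (auto simp: c_le)
    moreover have "integral {-x0..1-x0} (\<lambda>v. \<phi> v - c) = ?A" "integral {-(1-x0)..1-(1-x0)} (\<lambda>v. \<phi> v - c) = ?A"
      using assms by (intro eq; simp)+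
    ultimately show ?thesis unfolding sq_expand[of x0 "1 - x0"] by simp
  qed
  ultimately show ?thesis by simp
qed

text \<open>Provides the dichotomy behind the linear rate: up to distance \<open>2 * \<rho>\<close>
  the lemma \<open>sq_rate\<close> applies with positive rate, beyond it the square is already below
  \<alpha> by a margin. If \<open>d' < 2 * d0\<close>, some \<open>\<rho>\<close> above
  \<open>d' / 2\<close> works by \<open>sq_far\<close>. Otherwise the zones of points at distance
  near \<open>2 * d0\<close> hardly overlap, and \<open>\<rho>\<close> is taken within
  \<open>(\<alpha> - \<beta>) / 4\<close> of \<open>d0\<close>, which loses at most half of the
  gap.\<close>

lemma ex_support_level:
  assumes d': "d' = min (1/2) (2 * d)" and gap: "sq ((1 - d') / 2) ((1 + d') / 2) < \<alpha>"
  shows "\<exists>\<rho> \<mu>. 0 \<le> \<rho> \<and> \<rho> \<le> d \<and> c < \<phi> \<rho> \<and> 0 < \<mu> \<and>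
    (\<forall>x y. 0 \<le> x \<longrightarrow> y \<le> 1 \<longrightarrow> 2 * \<rho> < y - x \<longrightarrow> sq x y \<le> \<alpha> - \<mu>)"
proof -
  define \<beta> where "\<beta> = sq ((1 - d') / 2) ((1 + d') / 2)"
  have b: "\<beta> < \<alpha>" using gap by (simp add: \<beta>_def)
  have dd': "d \<le> d'" "d' \<le> 1/2" "d' \<le> 2 * d" using d' d_pos d_half by auto
  show ?thesis
  proof (cases "d' < 2 * d0")
    case True
    obtain \<rho> where \<rho>: "0 \<le> \<rho>" "\<rho> \<le> d0" "d0 - (d0 - d' / 2) < \<rho>" "c < \<phi> \<rho>"
      using ex_near_d0[of "d0 - d' / 2"] True by auto
    have "sq x y \<le> \<alpha> - (\<alpha> - \<beta>)" if "0 \<le> x" "y \<le> 1" "2 * \<rho> < y - x" for x y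
      using sq_far[of x y d'] that \<rho> dd' by (simp add: \<beta>_def)
    then show ?thesis using \<rho> d0_bounds b by (intro exI[of _ \<rho>] exI[of _ "\<alpha> - \<beta>"]) auto
  next
    case False
    obtain \<rho> where \<rho>: "0 \<le> \<rho>" "\<rho> \<le> d0" "d0 - (\<alpha> - \<beta>) / 4 < \<rho>" "c < \<phi> \<rho>"
      using ex_near_d0[of "(\<alpha> - \<beta>) / 4"] b by auto
    have "sq x y \<le> \<alpha> - (\<alpha> - \<beta>) / 2" if "0 \<le> x" "y \<le> 1" "2 * \<rho> < y - x" for x y
    proof -
      have "sq x y \<le> sq ((1 - d') / 2) (1 - (1 - d') / 2) + 2 * (d0 - \<rho>)"
        using that \<rho> dd' False by (intro sq_far_support) auto
      also have "1 - (1 - d') / 2 = (1 + d') / 2" by (simp add: field_simps)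
      finally have "sq x y \<le> \<beta> + 2 * (d0 - \<rho>)" by (simp add: \<beta>_def)
      then show ?thesis using \<rho> by (simp add: field_simps)
    qed
    then show ?thesis using \<rho> d0_bounds b by (intro exI[of _ \<rho>] exI[of _ "(\<alpha> - \<beta>) / 2"]) auto
  qed
qed

end

end

text \<open>The only properties of the square of the graphon that the rest of the proof uses. The last one
  says that near the level \<open>\<alpha>\<close> the square increases at a linear rate whenever the interval
  spanned by the two points shrinks.\<close>

locale square_profile =
  fixes q :: "real \<Rightarrow> real \<Rightarrow> real" and \<alpha> d \<mu> \<kappa> :: real
  assumes q_sym: "q x y = q y x"
    and q_refl: "q (1 - x) (1 - y) = q x y"
    and q_lipschitz: "\<lbrakk>x \<in> {0..1}; x' \<in> {0..1}; y \<in> {0..1}; y' \<in> {0..1}\<rbrakk> \<Longrightarrow>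
          \<bar>q x y - q x' y'\<bar> \<le> \<bar>x - x'\<bar> + \<bar>y - y'\<bar>"
    and q_near: "\<lbrakk>x \<in> {0..1}; y \<in> {0..1}; \<bar>x - y\<bar> \<le> d\<rbrakk> \<Longrightarrow> \<alpha> + \<mu> \<le> q x y"
    and q_far: "\<lbrakk>x \<in> {0..1}; y \<in> {0..1}; 1/2 \<le> \<bar>x - y\<bar>\<rbrakk> \<Longrightarrow> q x y \<le> \<alpha> - \<mu>"
    and q_inner: "\<lbrakk>0 \<le> x; x \<le> x'; x' \<le> y'; y' \<le> y; y \<le> 1; \<alpha> - \<mu> < q x y\<rbrakk> \<Longrightarrow>
          min (\<alpha> + \<mu>) (q x y + \<kappa> * ((x' - x) + (y - y'))) \<le> q x' y'"
    and d_pos: "0 < d" and \<mu>_pos: "0 < \<mu>" and \<kappa>_pos: "0 < \<kappa>"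

lemma (in link_profile) ex_square_profile:
  assumes c_less: "c < \<phi> 0"
    and d': "d' = min (1/2) (2 * d)" and gap: "sq ((1 - d') / 2) ((1 + d') / 2) < \<alpha>"
    and near: "0 < \<nu>" "\<And>s. s \<in> {0..d} \<Longrightarrow> \<alpha> + \<nu> \<le> sq 0 s"
  shows "\<exists>\<mu> \<kappa>. square_profile sq \<alpha> d \<mu> \<kappa>"
proof -
  define \<beta> where "\<beta> = sq ((1 - d') / 2) ((1 + d') / 2)"
  obtain \<rho> \<mu>\<^sub>0 where \<rho>: "0 \<le> \<rho>" "\<rho> \<le> d" "c < \<phi> \<rho>" "0 < \<mu>\<^sub>0"
    and level: "\<And>x y. 0 \<le> x \<Longrightarrow> y \<le> 1 \<Longrightarrow> 2 * \<rho> < y - x \<Longrightarrow> sq x y \<le> \<alpha> - \<mu>\<^sub>0"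
    using ex_support_level[OF c_less d' gap] by blast
  define \<mu> where "\<mu> = min \<nu> (min \<mu>\<^sub>0 (\<alpha> - \<beta>))"
  have \<mu>: "0 < \<mu>" "\<mu> \<le> \<nu>" "\<mu> \<le> \<mu>\<^sub>0" "\<mu> \<le> \<alpha> - \<beta>" using \<rho> near gap by (auto simp: \<mu>_def \<beta>_def)
  define \<kappa> where "\<kappa> = (\<phi> \<rho> - c)\<^sup>2"
  have \<kappa>: "0 < \<kappa>" using \<rho> by (simp add: \<kappa>_def)
  have near': "\<alpha> + \<mu> \<le> sq x y" if "x \<in> {0..1}" "y \<in> {0..1}" "\<bar>x - y\<bar> \<le> d" for x y
    using sq_near[OF that(1,2)] near(2)[of "\<bar>x - y\<bar>"] that \<mu> by simp
  have far: "sq x y \<le> \<alpha> - \<mu>" if "x \<in> {0..1}" "y \<in> {0..1}" "1/2 \<le> \<bar>x - y\<bar>" for x y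
  proof -
    have "d' \<le> 1/2" "d \<le> d'" using d' d_pos d_half by auto
    then have "sq x y \<le> \<beta>"
      using sq_far[of x y d'] sq_far[of y x d'] that unfolding \<beta>_def sq_sym[of y x] by (cases "x \<le> y") auto
    then show ?thesis using \<mu> by simp
  qed
  \<comment> \<open>If the shrunken pair is within \<open>d\<close>, the cap
    \<open>\<alpha> + \<mu>\<close> is reached. Otherwise the value above
    \<open>\<alpha> - \<mu>\<close> forces the original distance to be at most
    \<open>2 * \<rho>\<close>, where the rate is available.\<close>
  have step: "min (\<alpha> + \<mu>) (sq x y + \<kappa> * (y - y')) \<le> sq x y'"
    if "0 \<le> x" "x \<le> y'" "y' \<le> y" "y \<le> 1" "\<alpha> - \<mu> < sq x y" for x y y'
  proof (cases "y' - x \<le> d")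
    case True
    then show ?thesis using near'[of x y'] that by auto
  next
    case False
    have "y - x \<le> 2 * \<rho>" using level[of x y] that \<mu> by force
    then show ?thesis using sq_rate[of x y' y \<rho>] that \<rho> False by (simp add: \<kappa>_def)
  qed
  have inner: "min (\<alpha> + \<mu>) (sq x y + \<kappa> * ((x' - x) + (y - y'))) \<le> sq x' y'"
    if "0 \<le> x" "x \<le> x'" "x' \<le> y'" "y' \<le> y" "y \<le> 1" "\<alpha> - \<mu> < sq x y" for x x' y y'
  proof -
    have 1: "min (\<alpha> + \<mu>) (sq x y + \<kappa> * (y - y')) \<le> sq x y'"
      using that by (intro step) auto
    have "0 \<le> \<kappa> * (y - y')" using \<kappa> that by simp
    then have "\<alpha> - \<mu> < sq x y'" using 1 that \<mu> by auto
    \<comment> \<open>The left end is moved by applying \<open>step\<close> to the reflected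
      pair.\<close>
    then have "min (\<alpha> + \<mu>) (sq (1 - y') (1 - x) + \<kappa> * ((1 - x) - (1 - x'))) \<le> sq (1 - y') (1 - x')"
      using that by (intro step) (auto simp: sq_refl sq_sym[of y'])
    then have "min (\<alpha> + \<mu>) (sq x y' + \<kappa> * (x' - x)) \<le> sq x' y'"
      by (simp add: sq_refl sq_sym[of y'])
    moreover have "0 \<le> \<kappa> * (x' - x)" using \<kappa> that by simp
    ultimately show ?thesis using 1 by (auto simp: distrib_left)
  qed
  have "square_profile sq \<alpha> d \<mu> \<kappa>"
    by unfold_locales (auto simp: sq_refl \<mu> \<kappa> d_pos inner intro: sq_sym sq_lipschitz near' far)
  then show ?thesis by blast
qed

section \<open>Rigidity of interval orders\<close>

lemma rank_bij_betw:
  fixes S :: "'a set"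
  assumes fin: "finite S"
    and refl: "\<And>i. i \<in> S \<Longrightarrow> le i i"
    and antisym: "\<And>i j. i \<in> S \<Longrightarrow> j \<in> S \<Longrightarrow> le i j \<Longrightarrow> le j i \<Longrightarrow> i = j"
    and trans: "\<And>i j k. i \<in> S \<Longrightarrow> j \<in> S \<Longrightarrow> k \<in> S \<Longrightarrow> le i j \<Longrightarrow> le j k \<Longrightarrow> le i k"
    and total: "\<And>i j. i \<in> S \<Longrightarrow> j \<in> S \<Longrightarrow> le i j \<or> le j i"
  shows "bij_betw (\<lambda>i. card {j \<in> S. le j i}) S {1..card S}"
    and "\<And>i j. i \<in> S \<Longrightarrow> j \<in> S \<Longrightarrow> card {k \<in> S. le k i} < card {k \<in> S. le k j} \<Longrightarrow> le i j"
    and "\<And>i j. i \<in> S \<Longrightarrow> j \<in> S \<Longrightarrow> le i j \<Longrightarrow> i \<noteq> j \<Longrightarrow> card {k \<in> S. le k i} < card {k \<in> S. le k j}"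
proof -
  let ?\<sigma> = "\<lambda>i. card {j \<in> S. le j i}"
  show mono: "?\<sigma> i < ?\<sigma> j" if "i \<in> S" "j \<in> S" "le i j" "i \<noteq> j" for i j
  proof (rule psubset_card_mono)
    have "j \<notin> {k \<in> S. le k i}" using antisym[of i j] that by auto
    then show "{k \<in> S. le k i} \<subset> {k \<in> S. le k j}" using that refl trans by blast
  qed (use fin in auto)
  show "le i j" if "i \<in> S" "j \<in> S" "?\<sigma> i < ?\<sigma> j" for i j
    using mono[of j i] total[of i j] that by (cases "i = j") auto
  have inj: "inj_on ?\<sigma> S"
  proof (rule inj_onI, rule ccontr)
    fix i j assume ij: "i \<in> S" "j \<in> S" "?\<sigma> i = ?\<sigma> j" "i \<noteq> j"
    then show False using total[OF ij(1,2)] mono[OF ij(1,2)] mono[OF ij(2,1)] by auto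
  qed
  have "?\<sigma> ` S \<subseteq> {1..card S}"
  proof safe
    fix i assume i: "i \<in> S"
    have "{i} \<subseteq> {j \<in> S. le j i}" using i refl by auto
    then have "1 \<le> ?\<sigma> i" using card_mono[of "{j \<in> S. le j i}" "{i}"] fin by simp
    moreover have "?\<sigma> i \<le> card S" using fin by (intro card_mono) auto
    ultimately show "?\<sigma> i \<in> {1..card S}" by simp
  qed
  then have "?\<sigma> ` S = {1..card S}"
    by (intro card_subset_eq) (auto simp: card_image[OF inj])
  then show "bij_betw ?\<sigma> S {1..card S}" using inj by (simp add: bij_betw_def)
qed

lemma ex_rank_real:
  fixes U :: "nat \<Rightarrow> real"
  assumes "finite S"
  shows "\<exists>\<sigma>. bij_betw \<sigma> S {1..card S} \<and> (\<forall>u\<in>S. \<forall>v\<in>S. \<sigma> u < \<sigma> v \<longrightarrow> U u \<le> U v)"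
proof -
  define le where "le = (\<lambda>j i. U j < U i \<or> U j = U i \<and> j \<le> i)"
  have "bij_betw (\<lambda>i. card {j \<in> S. le j i}) S {1..card S}"
    by (rule rank_bij_betw(1)[OF assms]) (auto simp: le_def)
  moreover have "le u v" if "u \<in> S" "v \<in> S" "card {j \<in> S. le j u} < card {j \<in> S. le j v}" for u v
    by (rule rank_bij_betw(2)[OF assms _ _ _ _ that]) (auto simp: le_def)
  then have "\<forall>u\<in>S. \<forall>v\<in>S. card {j \<in> S. le j u} < card {j \<in> S. le j v} \<longrightarrow> U u \<le> U v"
    by (force simp: le_def)
  ultimately show ?thesis by blast
qed

lemma interval_order_reverse:
  assumes "interval_order H S \<sigma>" "finite S" and sym: "\<And>u v. H u v \<Longrightarrow> H v u"
  shows "interval_order H S (\<lambda>u. card S + 1 - \<sigma> u)"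
  unfolding interval_order_def
proof (intro conjI ballI impI)
  have bij: "bij_betw \<sigma> S {1..card S}" using assms(1) by (simp add: interval_order_def)
  have "bij_betw (\<lambda>k. card S + 1 - k) {1..card S} {1..card S}"
    by (rule bij_betwI[where g="\<lambda>k. card S + 1 - k"]) auto
  from bij_betw_trans[OF bij this] show "bij_betw (\<lambda>u. card S + 1 - \<sigma> u) S {1..card S}"
    by (simp add: comp_def)
  fix u v x
  assume "u \<in> S" "v \<in> S" "x \<in> S"
    and *: "card S + 1 - \<sigma> u < card S + 1 - \<sigma> v \<and> card S + 1 - \<sigma> v < card S + 1 - \<sigma> x \<and> H u x"
  then have "\<sigma> x < \<sigma> v" "\<sigma> v < \<sigma> u" "H x u" using sym[of u x] by auto
  then have "H x v" "H v u"
    using assms(1) \<open>u \<in> S\<close> \<open>v \<in> S\<close> \<open>x \<in> S\<close> unfolding interval_order_def by blast+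
  then show "H u v" "H v x" using sym by simp_all
qed

section \<open>Well spread point sets and splitting them into two classes\<close>

definition dense_points :: "real \<Rightarrow> nat set \<Rightarrow> (nat \<Rightarrow> real) \<Rightarrow> bool" where
  "dense_points \<eta> X U \<longleftrightarrow> (\<forall>a. 0 \<le> a \<and> a + \<eta> \<le> 1 \<longrightarrow> (\<exists>x\<in>X. a \<le> U x \<and> U x \<le> a + \<eta>))"

lemma dense_points_reflect: "dense_points \<eta> X U \<Longrightarrow> dense_points \<eta> X (\<lambda>i. 1 - U i)"
  unfolding dense_points_def
proof (intro allI impI)
  fix a assume *: "\<forall>a. 0 \<le> a \<and> a + \<eta> \<le> 1 \<longrightarrow> (\<exists>x\<in>X. a \<le> U x \<and> U x \<le> a + \<eta>)" "0 \<le> a \<and> a + \<eta> \<le> 1"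
  then obtain x where "x \<in> X" "1 - a - \<eta> \<le> U x" "U x \<le> 1 - a - \<eta> + \<eta>"
    using spec[OF *(1), of "1 - a - \<eta>"] by auto
  then show "\<exists>x\<in>X. a \<le> 1 - U x \<and> 1 - U x \<le> a + \<eta>" by (intro bexI[of _ x]) auto
qed

text \<open>A closest pair across the partition cannot be far apart: a point of \<open>S\<close> in
  the middle of the gap belongs to one of the classes by convexity and would be closer to the
  opposite endpoint.\<close>

lemma dense_points_split:
  assumes "finite S" "dense_points \<eta> S U" "0 < \<eta>" and U: "\<And>i. i \<in> S \<Longrightarrow> U i \<in> {0..1}"
    and AB: "A \<noteq> {}" "B \<noteq> {}" "A \<union> B \<subseteq> S"
    and conv: "\<And>x y s. x \<in> A \<union> B \<Longrightarrow> y \<in> A \<union> B \<Longrightarrow> s \<in> S \<Longrightarrow> U x < U s \<Longrightarrow> U s < U y \<Longrightarrow> s \<in> A \<union> B"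
  shows "\<exists>p\<in>A. \<exists>r\<in>B. \<bar>U p - U r\<bar> \<le> 3 * \<eta>"
proof -
  have fin: "finite (A \<times> B)" "A \<times> B \<noteq> {}"
    using AB assms(1) by (auto intro: finite_subset)
  define g where "g = (\<lambda>(p, r). \<bar>U p - U r\<bar>)"
  obtain p r where pr: "p \<in> A" "r \<in> B" and "\<And>z. z \<in> A \<times> B \<Longrightarrow> g (p, r) \<le> g z"
    using ex_min_if_finite[of "g ` (A \<times> B)"] fin by (force simp: not_less)
  then have min: "\<And>p' r'. p' \<in> A \<Longrightarrow> r' \<in> B \<Longrightarrow> \<bar>U p - U r\<bar> \<le> \<bar>U p' - U r'\<bar>"
    by (force simp: g_def)
  have "\<bar>U p - U r\<bar> \<le> 3 * \<eta>"
  proof (rule ccontr)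
    assume far: "\<not> \<bar>U p - U r\<bar> \<le> 3 * \<eta>"
    \<comment> \<open>The gap exceeds \<open>3 * \<eta>\<close>, so the window from
      \<open>lo + \<eta>\<close> to \<open>lo + 2 * \<eta>\<close> stays away from both
      endpoints.\<close>
    define lo where "lo = min (U p) (U r)"
    have "U p \<in> {0..1}" "U r \<in> {0..1}" using U pr AB by auto
    then have "0 \<le> lo + \<eta>" "lo + \<eta> + \<eta> \<le> 1" using far \<open>0 < \<eta>\<close> by (auto simp: lo_def min_def abs_if split: if_splits)
    then obtain s where s: "s \<in> S" "lo + \<eta> \<le> U s" "U s \<le> lo + \<eta> + \<eta>"
      using assms(2) unfolding dense_points_def by blast
    have "s \<in> A \<union> B"
    proof (cases "U p \<le> U r")
      case True
      then show ?thesis using s far \<open>0 < \<eta>\<close> pr by (intro conv[of p r s]) (auto simp: lo_def)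
    next
      case False
      then show ?thesis using s far \<open>0 < \<eta>\<close> pr by (intro conv[of r p s]) (auto simp: lo_def)
    qed
    then show False
      using min[of s r] min[of p s] pr s far \<open>0 < \<eta>\<close> by (auto simp: lo_def min_def abs_if split: if_splits)
  qed
  then show ?thesis using pr by blast
qed

context square_profile
begin

text \<open>Here \<open>e\<close> is the uncertainty in q, \<open>\<eta>\<^sub>0\<close> the spacing
  of the points and \<open>\<eta>\<close> the distance to be resolved. The last inequality says that
  moving one point by \<open>\<eta>\<close> carries q from \<open>\<alpha> - 2 * e\<close> past
  \<open>\<alpha> + e\<close> even after a displacement of the other point by
  \<open>3 * \<eta>\<^sub>0\<close>; the bound by \<mu> keeps these levels in the range where
  \<open>q_inner\<close> is effective.\<close>

definition scale_ok :: "real \<Rightarrow> real \<Rightarrow> real \<Rightarrow> bool" where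
  "scale_ok e \<eta>\<^sub>0 \<eta> \<longleftrightarrow> 0 \<le> e \<and> 0 < \<eta>\<^sub>0 \<and> 3 * \<eta>\<^sub>0 \<le> d \<and> \<eta>\<^sub>0 < 1/2 \<and> 2 * e + 3 * \<eta>\<^sub>0 < \<mu> \<and>
     3 * e + 3 * \<eta>\<^sub>0 < \<kappa> * \<eta>"

lemma scale_okD:
  assumes "scale_ok e \<eta>\<^sub>0 \<eta>"
  shows "0 \<le> e" "0 < \<eta>\<^sub>0" "3 * \<eta>\<^sub>0 \<le> d" "\<eta>\<^sub>0 < 1/2" "2 * e + 3 * \<eta>\<^sub>0 < \<mu>" "3 * e + 3 * \<eta>\<^sub>0 < \<kappa> * \<eta>" "0 < \<eta>" "e < \<mu>"
proof -
  show *: "0 \<le> e" "0 < \<eta>\<^sub>0" "3 * \<eta>\<^sub>0 \<le> d" "\<eta>\<^sub>0 < 1/2" "2 * e + 3 * \<eta>\<^sub>0 < \<mu>" "3 * e + 3 * \<eta>\<^sub>0 < \<kappa> * \<eta>"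
    using assms by (auto simp: scale_ok_def)
  then have "0 < \<kappa> * \<eta>" by linarith
  then show "0 < \<eta>" using \<kappa>_pos by (simp add: zero_less_mult_iff)
  show "e < \<mu>" using * by linarith
qed

lemma q_inner_weak:
  assumes "0 \<le> x" "x \<le> x'" "x' \<le> y'" "y' \<le> y" "y \<le> 1" "\<alpha> - \<mu> < q x y"
  shows "min (\<alpha> + \<mu>) (q x y) \<le> q x' y'"
proof -
  have "0 \<le> \<kappa> * ((x' - x) + (y - y'))" using assms \<kappa>_pos by simp
  then show ?thesis using q_inner[OF assms] by linarith
qed

text \<open>The point found is certainly adjacent to \<open>b\<close> and certainly not to
  \<open>a\<close>. It is searched just beyond the place \<open>y\<close> where \<open>q a\<close>
  falls below the level \<alpha>; at that place q is already well above \<alpha> when seen from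
  \<open>b\<close>, by the linear rate. The condition \<open>U x \<noteq> b\<close> guarantees that
  the point is not the vertex \<open>b\<close> itself, to which \<open>adj\<close> would not
  apply.\<close>

lemma separating_point_right:
  assumes ok: "scale_ok e \<eta>\<^sub>0 \<eta>" and dense: "dense_points \<eta>\<^sub>0 X U"
    and ab: "0 \<le> a" "a \<le> 1/2" "a + \<eta> \<le> b" "b \<le> 1"
  shows "\<exists>x\<in>X. a < U x \<and> U x \<noteq> b \<and> U x \<in> {0..1} \<and> q a (U x) < \<alpha> - e \<and> \<alpha> + e < q b (U x)"
proof -
  note ok = scale_okD[OF ok]
  have cont: "continuous_on {a..1} (q a)"
    unfolding continuous_on_iff
  proof (intro ballI allI impI)
    fix x \<epsilon> :: real assume "x \<in> {a..1}" "0 < \<epsilon>"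
    moreover have "dist (q a x') (q a x) \<le> dist x' x" if "x' \<in> {a..1}" for x'
      using q_lipschitz[of a a x' x] that \<open>x \<in> {a..1}\<close> ab by (simp add: dist_real_def)
    ultimately show "\<exists>\<delta>>0. \<forall>x'\<in>{a..1}. dist x' x < \<delta> \<longrightarrow> dist (q a x') (q a x) < \<epsilon>"
      by (meson order_le_less_trans)
  qed
  have "\<alpha> + \<mu> \<le> q a a" using ab ok d_pos by (intro q_near) auto
  moreover have far: "q a 1 \<le> \<alpha> - \<mu>" using ab by (intro q_far) auto
  \<comment> \<open>The level is attained because \<open>q a\<close> is at least
    \<open>\<alpha> + \<mu>\<close> at \<open>a\<close> and, as \<open>a \<le> 1/2\<close>, at most
    \<open>\<alpha> - \<mu>\<close> at 1. All points right of \<open>y\<close> turn out to be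
    certain non-neighbours of \<open>a\<close>.\<close>
  ultimately obtain y where y: "a \<le> y" "y \<le> 1" and qy: "q a y = \<alpha> - 2 * e"
    using IVT2'[of "q a" 1 "\<alpha> - 2 * e" a] cont ab ok by auto
  have yd: "a + d < y" using q_near[of a y] y qy ab ok \<mu>_pos by (auto simp: abs_if) (smt (verit))
  \<comment> \<open>By the Lipschitz bound the fall from \<open>\<alpha> - 2 * e\<close> to
    \<open>\<alpha> - \<mu>\<close> takes more room than \<open>3 * \<eta>\<^sub>0\<close>.\<close>
  have y1: "y + 3 * \<eta>\<^sub>0 \<le> 1"
    using q_lipschitz[of a a y 1] y far qy ab ok by auto
  have strict: "q a x < \<alpha> - e" if "y < x" "x \<le> 1" for x
  proof -
    have kx: "0 < \<kappa> * (x - y)" using \<kappa>_pos that by simp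
    show ?thesis
    proof (cases "\<alpha> - \<mu> < q a x")
      case True
      then have "min (\<alpha> + \<mu>) (q a x + \<kappa> * ((a - a) + (x - y))) \<le> \<alpha> - 2 * e"
        using q_inner[of a a y x] that ab qy ok yd d_pos by auto
      then show ?thesis using kx ok by auto
    next
      case False
      then show ?thesis using ok by auto
    qed
  qed
  show ?thesis
  \<comment> \<open>If \<open>b\<close> is far right of \<open>y\<close>, the point is taken just
    left of \<open>b\<close>; if \<open>b\<close> is left of \<open>y + 2 * \<eta>\<^sub>0\<close>,
    it is taken right of both; in the remaining narrow range it is taken between \<open>y\<close>
    and \<open>b\<close>. Each choice keeps it off the position \<open>b\<close>.\<close>
  proof (cases "y + 2 * \<eta>\<^sub>0 < b - \<eta>\<^sub>0")
    case True
    then obtain x where x: "x \<in> X" "b - 2 * \<eta>\<^sub>0 \<le> U x" "U x \<le> b - 2 * \<eta>\<^sub>0 + \<eta>\<^sub>0"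
      using dense[unfolded dense_points_def, rule_format, of "b - 2 * \<eta>\<^sub>0"] ok ab y True by auto
    then have "\<alpha> + \<mu> \<le> q b (U x)" using ok ab True y by (intro q_near) auto
    then show ?thesis
      using x ok ab True y yd d_pos strict[of "U x"] by (intro bexI[of _ x]) auto
  next
    case False
    show ?thesis
    proof (cases "b < y + 2 * \<eta>\<^sub>0")
      case True
      then obtain x where x: "x \<in> X" "y + 2 * \<eta>\<^sub>0 \<le> U x" "U x \<le> y + 2 * \<eta>\<^sub>0 + \<eta>\<^sub>0"
        using dense[unfolded dense_points_def, rule_format, of "y + 2 * \<eta>\<^sub>0"] ok ab y y1 by auto
      have "\<alpha> + e < q b (U x)"
      proof (cases "b \<le> y")
        case True
        have "min (\<alpha> + \<mu>) (q a y + \<kappa> * ((b - a) + (y - y))) \<le> q b y"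
          using True ab ok qy y by (intro q_inner) auto
        moreover have "\<kappa> * \<eta> \<le> \<kappa> * (b - a)" using ab \<kappa>_pos by (intro mult_left_mono) auto
        ultimately have "\<alpha> + e + 3 * \<eta>\<^sub>0 < q b y" using qy ok by auto
        moreover have "\<bar>q b y - q b (U x)\<bar> \<le> \<bar>b - b\<bar> + \<bar>y - U x\<bar>"
          using ab ok x y y1 by (intro q_lipschitz) auto
        ultimately show ?thesis using x ok by auto
      next
        case False
        have "\<alpha> + \<mu> \<le> q b (U x)" using ok ab False True x y y1 by (intro q_near) auto
        then show ?thesis using ok by auto
      qed
      then show ?thesis
        using x ok ab True y y1 yd d_pos strict[of "U x"] by (intro bexI[of _ x]) auto
    next
      case False2: False
      have yb: "y + 2 * \<eta>\<^sub>0 \<le> b" "b \<le> y + 3 * \<eta>\<^sub>0" using False False2 by auto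
      obtain x where x: "x \<in> X" "y + \<eta>\<^sub>0 / 2 \<le> U x" "U x \<le> y + \<eta>\<^sub>0 / 2 + \<eta>\<^sub>0"
        using dense[unfolded dense_points_def, rule_format, of "y + \<eta>\<^sub>0 / 2"] ok ab y y1 by auto
      have sx: "q a (U x) < \<alpha> - e" using x ok y1 by (intro strict) auto
      have "\<alpha> + \<mu> \<le> q b (U x)" using ok ab x y yb y1 by (intro q_near) auto
      then show ?thesis
        using x ok ab yb y y1 yd d_pos sx by (intro bexI[of _ x]) auto
    qed
  qed
qed

lemma separating_point_left:
  assumes ok: "scale_ok e \<eta>\<^sub>0 \<eta>" and dense: "dense_points \<eta>\<^sub>0 X U"
    and ab: "0 \<le> a" "1/2 \<le> b" "a + \<eta> \<le> b" "b \<le> 1"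
  shows "\<exists>x\<in>X. U x < b \<and> U x \<noteq> a \<and> U x \<in> {0..1} \<and> q b (U x) < \<alpha> - e \<and> \<alpha> + e < q a (U x)"
proof -
  have "\<exists>x\<in>X. 1 - b < 1 - U x \<and> 1 - U x \<noteq> 1 - a \<and> 1 - U x \<in> {0..1} \<and>
      q (1 - b) (1 - U x) < \<alpha> - e \<and> \<alpha> + e < q (1 - a) (1 - U x)"
    by (rule separating_point_right[OF ok dense_points_reflect[OF dense], of "1 - b" "1 - a"]) (use ab in auto)
  then show ?thesis unfolding q_refl by auto
qed

end

text \<open>All that is retained of the random graph. Pairs with q within \<open>e\<close> of
  \<alpha> may be adjacent or not, in any pattern, so everything proved here is
  deterministic.\<close>

locale embedded_graph = square_profile +
  fixes e :: real and U :: "nat \<Rightarrow> real" and V :: "nat set" and H :: "nat \<Rightarrow> nat \<Rightarrow> bool"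
  assumes U01: "v \<in> V \<Longrightarrow> U v \<in> {0..1}"
    and H_sym: "H u v \<Longrightarrow> H v u"
    and H_irrefl: "\<not> H u u"
    and adj: "\<lbrakk>u \<in> V; v \<in> V; u \<noteq> v; \<alpha> + e < q (U u) (U v)\<rbrakk> \<Longrightarrow> H u v"
    and nonadj: "\<lbrakk>u \<in> V; v \<in> V; H u v\<rbrakk> \<Longrightarrow> \<alpha> - e \<le> q (U u) (U v)"
    and e_nonneg: "0 \<le> e" and e_less: "e < \<mu>"
begin

lemma adj_near: "u \<in> V \<Longrightarrow> v \<in> V \<Longrightarrow> u \<noteq> v \<Longrightarrow> \<bar>U u - U v\<bar> \<le> d \<Longrightarrow> H u v"
  using q_near[OF U01 U01, of u v] e_less by (intro adj) auto

text \<open>If the vertices reachable from \<open>u\<close> were not all of \<open>S\<close>,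
  \<open>dense_points_split\<close> would give a reachable and an unreachable vertex within distance
  \<open>d\<close>, and these are adjacent.\<close>

lemma connected_dense:
  assumes "S \<subseteq> V" "finite S" "dense_points \<eta> S U" "0 < \<eta>" "3 * \<eta> \<le> d" "\<eta> \<le> 1"
  shows "connected_graph H S"
  unfolding connected_graph_def
proof (intro conjI ballI)
  show "S \<noteq> {}" using assms(3)[unfolded dense_points_def, rule_format, of 0] assms(6) by auto
  fix u v assume uv: "u \<in> S" "v \<in> S"
  define R where "R = (\<lambda>x y. x \<in> S \<and> y \<in> S \<and> H x y)\<^sup>*\<^sup>*"
  show "R u v"
  proof (rule ccontr)
    assume nr: "\<not> R u v"
    have "\<exists>p\<in>{p\<in>S. R u p}. \<exists>r\<in>{r\<in>S. \<not> R u r}. \<bar>U p - U r\<bar> \<le> 3 * \<eta>"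
      using uv nr assms U01 by (intro dense_points_split) (auto simp: R_def)
    then obtain p r where pr: "p \<in> S" "R u p" "r \<in> S" "\<not> R u r" "\<bar>U p - U r\<bar> \<le> 3 * \<eta>" by auto
    then have "H p r" using assms by (intro adj_near) auto
    then have "R u r"
      using rtranclp.rtrancl_into_rtrancl[OF pr(2)[unfolded R_def], of r] pr(1,3) unfolding R_def by simp
    then show False using pr by simp
  qed
qed

definition uncertain :: "nat \<Rightarrow> nat \<Rightarrow> bool" where
  "uncertain u v \<longleftrightarrow> u \<noteq> v \<and> \<bar>q (U u) (U v) - \<alpha>\<bar> \<le> e"

text \<open>Ordering by position can violate the condition only at \<open>u\<close>,
  \<open>v\<close>, \<open>x\<close> in this order with \<open>u\<close>, \<open>x\<close> adjacent
  and one inner pair not. Then q of the inner pair is at least that of the outer pair, so both are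
  in the uncertain band and share a vertex. A single uncertain pair does no harm; this matters
  because every pair of vertices, also an uncertain one, must be covered by a successful
  sample.\<close>

lemma unit_interval_if_no_cherry:
  assumes "S \<subseteq> V" "finite S"
    and no: "\<And>a b b'. \<lbrakk>a \<in> S; b \<in> S; b' \<in> S; b \<noteq> b'\<rbrakk> \<Longrightarrow> \<not> (uncertain a b \<and> uncertain a b')"
  shows "unit_interval_graph H S"
proof -
  obtain \<sigma> where bij: "bij_betw \<sigma> S {1..card S}"
    and le: "\<And>u v. u \<in> S \<Longrightarrow> v \<in> S \<Longrightarrow> \<sigma> u < \<sigma> v \<Longrightarrow> U u \<le> U v"
    using ex_rank_real[OF assms(2), of U] by blast
  have "H u v \<and> H v x"
    if S: "u \<in> S" "v \<in> S" "x \<in> S" and *: "\<sigma> u < \<sigma> v" "\<sigma> v < \<sigma> x" "H u x" for u v x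
  proof -
    have V: "u \<in> V" "v \<in> V" "x \<in> V" using S assms by auto
    have ord: "U u \<le> U v" "U v \<le> U x" using le S * by auto
    have ne: "u \<noteq> v" "v \<noteq> x" "u \<noteq> x" using * by auto
    have ux: "\<alpha> - e \<le> q (U u) (U x)" using nonadj V * by auto
    have "0 \<le> U u" "U x \<le> 1" using U01 V by auto
    then have i: "min (\<alpha> + \<mu>) (q (U u) (U x)) \<le> q (U u) (U v)" "min (\<alpha> + \<mu>) (q (U u) (U x)) \<le> q (U v) (U x)"
      using ord ux e_less by (auto intro!: q_inner_weak)
    have "H u v"
    proof (rule ccontr)
      assume "\<not> H u v"
      then have "q (U u) (U v) \<le> \<alpha> + e" using adj V ne by force
      then have "uncertain u v" "uncertain u x"
        using i ux e_less ne unfolding uncertain_def by auto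
      then show False using no[of u v x] S ne by auto
    qed
    moreover have "H v x"
    proof (rule ccontr)
      assume "\<not> H v x"
      then have "q (U v) (U x) \<le> \<alpha> + e" using adj V ne by force
      then have "uncertain x v" "uncertain x u"
        using i ux e_less ne unfolding uncertain_def by (auto simp: q_sym[of "U x"])
      then show False using no[of x u v] S ne by auto
    qed
    ultimately show ?thesis by simp
  qed
  then have "interval_order H S \<sigma>" using bij by (auto simp: interval_order_def)
  then show ?thesis by (auto simp: unit_interval_graph_def)
qed

text \<open>If \<open>T\<close> had members on both sides of \<open>a\<close> in the order,
  \<open>dense_points_split\<close> would give two close, hence adjacent, members with
  \<open>a\<close> between them, and the interval order would make \<open>a\<close> adjacent to one
  of them.\<close>

lemma nonadjacent_one_side:
  assumes S: "S \<subseteq> V" "finite S" "dense_points \<eta> S U" "0 < \<eta>" "3 * \<eta> \<le> d"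
    and io: "interval_order H S \<sigma>"
    and a: "a \<in> S" and T: "T \<subseteq> S" "a \<notin> T" "\<And>t. t \<in> T \<Longrightarrow> \<not> H a t"
    and conv: "\<And>x y s. x \<in> T \<Longrightarrow> y \<in> T \<Longrightarrow> s \<in> S \<Longrightarrow> U x < U s \<Longrightarrow> U s < U y \<Longrightarrow> s \<in> T"
  shows "(\<forall>t\<in>T. \<sigma> t < \<sigma> a) \<or> (\<forall>t\<in>T. \<sigma> a < \<sigma> t)"
proof (rule ccontr)
  assume contra: "\<not> ?thesis"
  define A where "A = {t \<in> T. \<sigma> t < \<sigma> a}"
  define B where "B = {t \<in> T. \<sigma> a < \<sigma> t}"
  have inj: "inj_on \<sigma> S" using io by (auto simp: interval_order_def bij_betw_def)
  have neq: "\<sigma> t \<noteq> \<sigma> a" if "t \<in> T" for t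
    using inj_onD[OF inj, of t a] that T a by auto
  then have AB: "A \<union> B = T" "A \<noteq> {}" "B \<noteq> {}"
    using contra by (auto simp: A_def B_def) (metis linorder_neqE_nat)+
  have "\<exists>p\<in>A. \<exists>r\<in>B. \<bar>U p - U r\<bar> \<le> 3 * \<eta>"
  proof (rule dense_points_split[OF S(2,3,4) _ AB(2,3)])
    show "U i \<in> {0..1}" if "i \<in> S" for i using that S U01 by blast
    show "A \<union> B \<subseteq> S" using AB T by simp
    show "s \<in> A \<union> B" if "x \<in> A \<union> B" "y \<in> A \<union> B" "s \<in> S" "U x < U s" "U s < U y" for x y s
      using that conv[of x y s] unfolding AB(1) by blast
  qed
  then obtain p r where pr: "p \<in> A" "r \<in> B" "\<bar>U p - U r\<bar> \<le> 3 * \<eta>" by blast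
  then have "H p r" using S T by (intro adj_near) (auto simp: A_def B_def)
  then have "H p a" using io pr a T unfolding interval_order_def A_def B_def by blast
  then show False using H_sym T(3)[of p] pr by (auto simp: A_def)
qed

lemma interval_order_oriented:
  assumes ok: "scale_ok e \<eta>\<^sub>0 \<eta>" and S: "S \<subseteq> V" "finite S" "dense_points \<eta>\<^sub>0 S U"
    and io: "interval_order H S \<sigma>"
    and ends: "a \<in> S" "U a \<le> \<eta>\<^sub>0" "z \<in> S" "1 - \<eta>\<^sub>0 \<le> U z" "\<sigma> a < \<sigma> z"
    and uv: "u \<in> S" "v \<in> S" "U u + \<eta> \<le> U v"
  shows "\<sigma> u < \<sigma> v"
proof -
  note ok' = scale_okD[OF ok]
  have inS: "U x \<in> {0..1}" if "x \<in> S" for x using S U01 that by auto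
  \<comment> \<open>The certain non-neighbours to the right and to the left. Each of these sets is
    convex in position by \<open>q_inner_weak\<close>, so it lies on one side of its vertex in the
    order.\<close>
  define R where "R = (\<lambda>u. {x \<in> S. U u < U x \<and> q (U u) (U x) < \<alpha> - e})"
  define L where "L = (\<lambda>x. {u \<in> S. U u < U x \<and> q (U u) (U x) < \<alpha> - e})"
  have right: "(\<forall>t\<in>R u. \<sigma> t < \<sigma> u) \<or> (\<forall>t\<in>R u. \<sigma> u < \<sigma> t)" if u: "u \<in> S" for u
  proof (rule nonadjacent_one_side[OF S ok'(2,3) io u])
    show "\<not> H u t" if "t \<in> R u" for t using nonadj[of u t] that u S by (auto simp: R_def)
    show "s \<in> R u" if "x \<in> R u" "y \<in> R u" "s \<in> S" "U x < U s" "U s < U y" for x y s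
    proof -
      have "q (U u) (U s) < \<alpha> - e"
      proof (rule ccontr)
        assume "\<not> q (U u) (U s) < \<alpha> - e"
        then have "min (\<alpha> + \<mu>) (q (U u) (U s)) \<le> q (U u) (U x)"
          using that inS u ok' by (intro q_inner_weak) (auto simp: R_def)
        then show False using \<open>\<not> q (U u) (U s) < \<alpha> - e\<close> that ok' by (auto simp: R_def)
      qed
      then show ?thesis using that by (auto simp: R_def)
    qed
  qed (auto simp: R_def)
  have left: "(\<forall>t\<in>L x. \<sigma> t < \<sigma> x) \<or> (\<forall>t\<in>L x. \<sigma> x < \<sigma> t)" if x: "x \<in> S" for x
  proof (rule nonadjacent_one_side[OF S ok'(2,3) io x])
    show "\<not> H x t" if "t \<in> L x" for t using nonadj[of x t] that x S by (auto simp: L_def q_sym)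
    show "s \<in> L x" if "u \<in> L x" "y \<in> L x" "s \<in> S" "U u < U s" "U s < U y" for u y s
    proof -
      have "q (U s) (U x) < \<alpha> - e"
      proof (rule ccontr)
        assume "\<not> q (U s) (U x) < \<alpha> - e"
        then have "min (\<alpha> + \<mu>) (q (U s) (U x)) \<le> q (U y) (U x)"
          using that inS x ok' by (intro q_inner_weak) (auto simp: L_def)
        then show False using \<open>\<not> q (U s) (U x) < \<alpha> - e\<close> that ok' by (auto simp: L_def)
      qed
      then show ?thesis using that by (auto simp: L_def)
    qed
  qed (auto simp: L_def)
  have far_z: "z \<in> R u \<and> u \<in> L z" if "u \<in> S" "U u \<le> 1/2" for u
  proof -
    have "q (U u) 1 \<le> \<alpha> - \<mu>" using that inS by (intro q_far) (auto simp: abs_if)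
    moreover have "\<bar>q (U u) 1 - q (U u) (U z)\<bar> \<le> \<bar>U u - U u\<bar> + \<bar>1 - U z\<bar>"
      using that inS ends by (intro q_lipschitz) auto
    ultimately have "q (U u) (U z) < \<alpha> - e" using ends inS[of z] ok' by auto
    moreover have "U u < U z"
    proof (rule ccontr)
      assume "\<not> U u < U z"
      then have "\<alpha> + \<mu> \<le> q (U u) (U z)"
        using that ends inS ok' by (intro q_near) auto
      then show False using \<open>q (U u) (U z) < \<alpha> - e\<close> ok' \<mu>_pos by auto
    qed
    ultimately show ?thesis using that ends by (auto simp: R_def L_def)
  qed
  have far_a: "a \<in> L x \<and> x \<in> R a" if "x \<in> S" "1/2 \<le> U x" for x
  proof -
    have "q 0 (U x) \<le> \<alpha> - \<mu>" using that inS by (intro q_far) (auto simp: abs_if)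
    moreover have "\<bar>q 0 (U x) - q (U a) (U x)\<bar> \<le> \<bar>0 - U a\<bar> + \<bar>U x - U x\<bar>"
      using that inS ends by (intro q_lipschitz) auto
    ultimately have "q (U a) (U x) < \<alpha> - e" using ends inS[of a] ok' by auto
    moreover have "U a < U x"
    proof (rule ccontr)
      assume "\<not> U a < U x"
      then have "\<alpha> + \<mu> \<le> q (U a) (U x)"
        using that ends inS ok' by (intro q_near) auto
      then show False using \<open>q (U a) (U x) < \<alpha> - e\<close> ok' \<mu>_pos by auto
    qed
    ultimately show ?thesis using that ends by (auto simp: R_def L_def)
  qed
  have az: "U a \<le> 1/2" "1/2 \<le> U z" using ends ok' by auto
  \<comment> \<open>The orientation is transported in two steps: \<open>a\<close> before
    \<open>z\<close> puts all of \<open>L z\<close> before \<open>z\<close>, in particular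
    \<open>u\<close>; then \<open>z\<close>, being in \<open>R u\<close> and after \<open>u\<close>,
    puts all of \<open>R u\<close> after \<open>u\<close>. The next statement is the mirror image,
    through \<open>R a\<close> and \<open>L x\<close>.\<close>
  have right': "\<sigma> u < \<sigma> x" if "u \<in> S" "U u \<le> 1/2" "x \<in> R u" for u x
  proof -
    have "\<forall>t\<in>L z. \<sigma> t < \<sigma> z" using left[of z] far_z[of a] az ends by force
    then have "\<sigma> u < \<sigma> z" using far_z that by blast
    then show ?thesis using right[of u] far_z[of u] that by force
  qed
  have left': "\<sigma> u < \<sigma> x" if "x \<in> S" "1/2 \<le> U x" "u \<in> L x" for u x
  proof -
    have "\<forall>t\<in>R a. \<sigma> a < \<sigma> t" using right[of a] far_a[of z] az ends by force
    then have "\<sigma> a < \<sigma> x" using far_a that by blast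
    then show ?thesis using left[of x] far_a[of x] that by force
  qed
  have umb: "H p r \<and> H r s" if "p \<in> S" "r \<in> S" "s \<in> S" "\<sigma> p < \<sigma> r" "\<sigma> r < \<sigma> s" "H p s" for p r s
    using io that unfolding interval_order_def by blast
  have ne: "\<sigma> u \<noteq> \<sigma> v"
  proof
    assume "\<sigma> u = \<sigma> v"
    then have "u = v" using io uv by (auto simp: interval_order_def bij_betw_def dest: inj_onD)
    then show False using uv ok' by simp
  qed
  show ?thesis
  \<comment> \<open>The separating vertex \<open>x\<close> comes after \<open>u\<close> and is
    adjacent to \<open>v\<close> only. Were \<open>v\<close> before \<open>u\<close>, the adjacency
    of \<open>v\<close> and \<open>x\<close> would force that of \<open>u\<close> and
    \<open>x\<close>.\<close>
  proof (cases "U u \<le> 1/2")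
    case True
    then obtain x where x: "x \<in> S" "U u < U x" "U x \<noteq> U v" "q (U u) (U x) < \<alpha> - e" "\<alpha> + e < q (U v) (U x)"
      using separating_point_right[OF ok S(3), of "U u" "U v"] uv inS by fastforce
    have "H v x" using x uv S by (intro adj) auto
    moreover have "\<not> H u x" using nonadj[of u x] x uv S by auto
    moreover have "\<sigma> u < \<sigma> x" using x uv True by (intro right') (auto simp: R_def)
    ultimately show ?thesis using umb[of v u x] uv x ne by (metis linorder_neqE_nat)
  next
    case False
    then have "1/2 \<le> U v" using uv ok' by auto
    then obtain x where x: "x \<in> S" "U x < U v" "U x \<noteq> U u" "q (U v) (U x) < \<alpha> - e" "\<alpha> + e < q (U u) (U x)"
      using separating_point_left[OF ok S(3), of "U u" "U v"] uv inS by fastforce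
    have "H u x" using x uv S by (intro adj) auto
    then have "H x u" by (rule H_sym)
    moreover have "\<not> H x v" using nonadj[of x v] x uv S by (auto simp: q_sym)
    moreover have "\<sigma> x < \<sigma> v" using x uv \<open>1/2 \<le> U v\<close> by (intro left') (auto simp: L_def q_sym)
    ultimately show ?thesis using umb[of x v u] uv x ne by (metis linorder_neqE_nat)
  qed
qed

definition oriented :: "real \<Rightarrow> nat set \<Rightarrow> (nat \<Rightarrow> nat) \<Rightarrow> bool" where
  "oriented \<eta> S \<sigma> \<longleftrightarrow> (\<forall>u\<in>S. \<forall>v\<in>S. U u + \<eta> \<le> U v \<longrightarrow> \<sigma> u < \<sigma> v)"

text \<open>A vertex near 0 and a vertex near 1 decide which of the two directions applies.\<close>

lemma interval_order_rigid:
  assumes ok: "scale_ok e \<eta>\<^sub>0 \<eta>" and S: "S \<subseteq> V" "finite S" "dense_points \<eta>\<^sub>0 S U"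
    and io: "interval_order H S \<sigma>"
  shows "oriented \<eta> S \<sigma> \<or> oriented \<eta> S (\<lambda>u. card S + 1 - \<sigma> u)"
proof -
  note ok' = scale_okD[OF ok]
  obtain a where a: "a \<in> S" "U a \<le> \<eta>\<^sub>0"
    using S(3)[unfolded dense_points_def, rule_format, of 0] ok' by auto
  obtain z where z: "z \<in> S" "1 - \<eta>\<^sub>0 \<le> U z"
    using S(3)[unfolded dense_points_def, rule_format, of "1 - \<eta>\<^sub>0"] ok' by auto
  have "a \<noteq> z" using a z ok' by auto
  then have ne: "\<sigma> a \<noteq> \<sigma> z" using io a z by (auto simp: interval_order_def bij_betw_def dest: inj_onD)
  show ?thesis
  proof (cases "\<sigma> a < \<sigma> z")
    case True
    then have "oriented \<eta> S \<sigma>"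
      using interval_order_oriented[OF ok S io a z] by (auto simp: oriented_def)
    then show ?thesis ..
  next
    case False
    then have "\<sigma> z < \<sigma> a" using ne by simp
    moreover have "\<sigma> a \<le> card S" using io a by (auto simp: interval_order_def bij_betw_def)
    ultimately have "card S + 1 - \<sigma> a < card S + 1 - \<sigma> z" by simp
    then have "oriented \<eta> S (\<lambda>u. card S + 1 - \<sigma> u)"
      using interval_order_oriented[OF ok S interval_order_reverse[OF io S(2)] a z] H_sym
      unfolding oriented_def by simp
    then show ?thesis ..
  qed
qed

end

section \<open>Orientation, votes and refinement\<close>

lemma antisym_ext_swap: "antisym_ext F v u = - antisym_ext F u v"
  by (simp add: antisym_ext_def)

lemma antisym_ext_self [simp]: "antisym_ext F v v = 0"
  by (simp add: antisym_ext_def)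

lemma vote_swap: "vote t S \<sigma> v u = - vote t S \<sigma> u v"
  unfolding vote_def by (simp add: conj_commute conj_left_commute)

lemma antisym_ext_sketch:
  "u \<noteq> v \<Longrightarrow> antisym_ext (sketch_comparison m t S \<sigma> a) u v = sgn (vote t S (reorient m a \<sigma>) u v)"
  unfolding antisym_ext_def sketch_comparison_def
  by (auto simp: vote_swap[of t S _ v u] sgn_minus)

lemma antisym_ext_local_refinement_bound:
  "antisym_ext (local_refinement n H F) u v \<in> {-1..1}"
  by (auto simp: antisym_ext_def local_refinement_def)

text \<open>The three counting conditions make \<zeta> separate the ends: the outer quarters contain
  at least \<zeta> vertices each, so an end of the order cannot reach past the middle, while fewer
  than \<zeta> vertices lie near 0, so the leftmost ones do belong to an end. With L = ln n these
  counts have orders L^5 and L^3, and \<zeta> is 4 L^4.\<close>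

locale recorded_orders = embedded_graph +
  fixes t m :: nat and \<zeta> \<eta>\<^sub>0 \<eta> :: real and S :: "nat \<Rightarrow> nat set" and \<sigma> :: "nat \<Rightarrow> nat \<Rightarrow> nat"
  assumes ok: "scale_ok e \<eta>\<^sub>0 \<eta>" and \<eta>4: "\<eta> \<le> 1/4"
    and S_sub: "j < t \<Longrightarrow> S j \<subseteq> V" and S_fin: "j < t \<Longrightarrow> finite (S j)"
    and S_card: "j < t \<Longrightarrow> card (S j) = m"
    and S_dense: "j < t \<Longrightarrow> dense_points \<eta>\<^sub>0 (S j) U"
    and S_left: "j < t \<Longrightarrow> \<zeta> \<le> real (card {x \<in> S j. U x \<le> 1/4})"
    and S_right: "j < t \<Longrightarrow> \<zeta> \<le> real (card {x \<in> S j. 3/4 \<le> U x})"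
    and S_end: "j < t \<Longrightarrow> real (card {x \<in> S j. U x < \<eta>\<^sub>0 + \<eta>}) < \<zeta>"
    and io: "j < t \<Longrightarrow> interval_order H (S j) (\<sigma> j)"
begin

text \<open>The sign vector that GlobalOrder ought to find: whether the recorded order runs along or
  against the hidden positions. The orders \<sigma>' below are the recorded ones turned
  accordingly.\<close>

definition orientation :: "nat \<Rightarrow> int" where
  "orientation j = (if oriented \<eta> (S j) (\<sigma> j) then 1 else -1)"

definition \<sigma>' :: "nat \<Rightarrow> nat \<Rightarrow> nat" where
  "\<sigma>' = reorient m orientation \<sigma>"

lemma orientation_cases: "orientation j = 1 \<or> orientation j = -1"
  by (simp add: orientation_def)

lemma bij_\<sigma>: "j < t \<Longrightarrow> bij_betw (\<sigma> j) (S j) {1..m}"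
  using io[of j] S_card[of j] by (simp add: interval_order_def)

lemma \<sigma>_range: "j < t \<Longrightarrow> x \<in> S j \<Longrightarrow> 1 \<le> \<sigma> j x \<and> \<sigma> j x \<le> m"
  using bij_\<sigma>[of j] by (auto simp: bij_betw_def)

lemma \<sigma>'_cases:
  "\<sigma>' j x = (if orientation j = 1 then \<sigma> j x else m + 1 - \<sigma> j x)"
  using orientation_cases[of j] by (auto simp: \<sigma>'_def reorient_def)

lemma bij_\<sigma>': 
  assumes "j < t" shows "bij_betw (\<sigma>' j) (S j) {1..m}"
proof (cases "orientation j = 1")
  case True
  then show ?thesis using bij_\<sigma>[OF assms] by (simp add: \<sigma>'_cases[abs_def])
next
  case False
  have "interval_order H (S j) (\<lambda>u. card (S j) + 1 - \<sigma> j u)"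
    using interval_order_reverse[OF io[OF assms] S_fin[OF assms]] H_sym by blast
  then show ?thesis using False assms by (simp add: \<sigma>'_cases[abs_def] interval_order_def S_card)
qed

lemma \<sigma>'_oriented:
  assumes j: "j < t" and xy: "x \<in> S j" "y \<in> S j" "U x + \<eta> \<le> U y"
  shows "\<sigma>' j x < \<sigma>' j y"
proof (cases "oriented \<eta> (S j) (\<sigma> j)")
  case True
  then show ?thesis using xy by (auto simp: \<sigma>'_cases orientation_def oriented_def)
next
  case False
  then have "oriented \<eta> (S j) (\<lambda>u. m + 1 - \<sigma> j u)"
    using interval_order_rigid[OF ok S_sub[OF j] S_fin[OF j] S_dense[OF j] io[OF j]] S_card[OF j] by simp
  then show ?thesis using xy False unfolding \<sigma>'_cases orientation_def oriented_def by auto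
qed

lemma \<sigma>'_range: "j < t \<Longrightarrow> x \<in> S j \<Longrightarrow> 1 \<le> \<sigma>' j x \<and> \<sigma>' j x \<le> m"
  using bij_\<sigma>'[of j] by (auto simp: bij_betw_def)

definition left_part :: "nat \<Rightarrow> nat set" where
  "left_part j = (if orientation j = 1 then left_end \<zeta> (S j) (\<sigma> j) else right_end m \<zeta> (S j) (\<sigma> j))"

definition right_part :: "nat \<Rightarrow> nat set" where
  "right_part j = (if orientation j = 1 then right_end m \<zeta> (S j) (\<sigma> j) else left_end \<zeta> (S j) (\<sigma> j))"

text \<open>A vertex in the right half is preceded by all the vertices of the leftmost quarter,
  because \<open>\<eta> \<le> 1/4\<close>, and these alone fill \<zeta> positions.\<close>

lemma left_part_lt:
  assumes j: "j < t" and x: "x \<in> left_part j"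
  shows "U x < 1/2"
proof (rule ccontr)
  assume "\<not> U x < 1/2"
  have xS: "x \<in> S j" using x by (auto simp: left_part_def left_end_def right_end_def split: if_splits)
  \<comment> \<open>The bound is \<open>\<zeta> + 1\<close> because reversal turns a position above
    \<open>m - \<zeta>\<close> into one below \<open>\<zeta> + 1\<close>.\<close>
  have lt: "real (\<sigma>' j x) < \<zeta> + 1"
    using x \<sigma>_range[OF j xS]
    by (auto simp: left_part_def left_end_def right_end_def \<sigma>'_cases of_nat_diff split: if_splits)
  have "card {y \<in> S j. U y \<le> 1/4} \<le> card {1..<\<sigma>' j x}"
  proof (rule card_inj_on_le[of "\<sigma>' j"])
    show "inj_on (\<sigma>' j) {y \<in> S j. U y \<le> 1/4}"
      using bij_\<sigma>'[OF j] by (auto simp: bij_betw_def intro: inj_on_subset)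
    show "\<sigma>' j ` {y \<in> S j. U y \<le> 1/4} \<subseteq> {1..<\<sigma>' j x}"
    proof safe
      fix y assume y: "y \<in> S j" "U y \<le> 1/4"
      have "\<sigma>' j y < \<sigma>' j x" using y \<eta>4 \<open>\<not> U x < 1/2\<close> by (intro \<sigma>'_oriented[OF j _ xS]) auto
      then show "\<sigma>' j y \<in> {1..<\<sigma>' j x}" using \<sigma>'_range[OF j y(1)] by simp
    qed
  qed simp
  then have "card {y \<in> S j. U y \<le> 1/4} + 1 \<le> \<sigma>' j x"
    using \<sigma>'_range[OF j xS] by (simp, arith)
  then show False using lt S_left[OF j] by linarith
qed

lemma right_part_gt:
  assumes j: "j < t" and x: "x \<in> right_part j"
  shows "1/2 < U x"
proof (rule ccontr)
  assume "\<not> 1/2 < U x"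
  have xS: "x \<in> S j" using x by (auto simp: right_part_def left_end_def right_end_def split: if_splits)
  have gt: "real m - \<zeta> < real (\<sigma>' j x)"
    using x \<sigma>_range[OF j xS]
    by (auto simp: right_part_def left_end_def right_end_def \<sigma>'_cases of_nat_diff split: if_splits)
  have "card {y \<in> S j. 3/4 \<le> U y} \<le> card {\<sigma>' j x<..m}"
  proof (rule card_inj_on_le[of "\<sigma>' j"])
    show "inj_on (\<sigma>' j) {y \<in> S j. 3/4 \<le> U y}"
      using bij_\<sigma>'[OF j] by (auto simp: bij_betw_def intro: inj_on_subset)
    show "\<sigma>' j ` {y \<in> S j. 3/4 \<le> U y} \<subseteq> {\<sigma>' j x<..m}"
    proof safe
      fix y assume y: "y \<in> S j" "3/4 \<le> U y"
      have "\<sigma>' j x < \<sigma>' j y" using y \<eta>4 \<open>\<not> 1/2 < U x\<close> by (intro \<sigma>'_oriented[OF j xS]) auto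
      then show "\<sigma>' j y \<in> {\<sigma>' j x<..m}" using \<sigma>'_range[OF j y(1)] by simp
    qed
  qed simp
  then have "card {y \<in> S j. 3/4 \<le> U y} + \<sigma>' j x \<le> m"
    using \<sigma>'_range[OF j xS] by (simp, arith)
  then show False using gt S_right[OF j] by linarith
qed

text \<open>Whatever precedes \<open>x\<close> in the order lies left of
  \<open>\<eta>\<^sub>0 + \<eta>\<close>, and there are fewer than \<zeta> such vertices.\<close>

lemma left_part_mem:
  assumes j: "j < t" and x: "x \<in> S j" "U x \<le> \<eta>\<^sub>0"
  shows "x \<in> left_part j"
proof -
  have "card {1..\<sigma>' j x} \<le> card {y \<in> S j. U y < \<eta>\<^sub>0 + \<eta>}"
  proof (rule surj_card_le[of _ _ "\<sigma>' j"])
    show "finite {y \<in> S j. U y < \<eta>\<^sub>0 + \<eta>}" using S_fin[OF j] by simp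
    show "{1..\<sigma>' j x} \<subseteq> \<sigma>' j ` {y \<in> S j. U y < \<eta>\<^sub>0 + \<eta>}"
    proof
      fix k assume k: "k \<in> {1..\<sigma>' j x}"
      then have "k \<in> {1..m}" using \<sigma>'_range[OF j x(1)] by simp
      then obtain y where y: "y \<in> S j" "k = \<sigma>' j y" using bij_betw_imp_surj_on[OF bij_\<sigma>'[OF j]] by blast
      have "U y < \<eta>\<^sub>0 + \<eta>"
      proof (rule ccontr)
        assume "\<not> U y < \<eta>\<^sub>0 + \<eta>"
        then have "\<sigma>' j x < \<sigma>' j y" using x y by (intro \<sigma>'_oriented[OF j]) auto
        then show False using k y by simp
      qed
      then show "k \<in> \<sigma>' j ` {y \<in> S j. U y < \<eta>\<^sub>0 + \<eta>}" using y by auto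
    qed
  qed
  then have "real (\<sigma>' j x) < \<zeta>" using S_end[OF j] by simp
  then show ?thesis
    using x \<sigma>_range[OF j x(1)]
    by (auto simp: left_part_def left_end_def right_end_def \<sigma>'_cases of_nat_diff split: if_splits)
qed

lemma parts_disjoint: "j < t \<Longrightarrow> k < t \<Longrightarrow> left_part j \<inter> right_part k = {}"
  using left_part_lt right_part_gt by fastforce

lemma overlap_sign_orientation:
  assumes "j < t" "k < t"
  shows "overlap_sign m \<zeta> S \<sigma> j k \<noteq> 0 \<Longrightarrow> overlap_sign m \<zeta> S \<sigma> j k = orientation j * orientation k"
    and "left_part j \<inter> left_part k \<noteq> {} \<Longrightarrow> overlap_sign m \<zeta> S \<sigma> j k = orientation j * orientation k"
proof -
  have d: "left_part j \<inter> right_part k = {}" "right_part j \<inter> left_part k = {}"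
    using parts_disjoint[of j k] parts_disjoint[of k j] assms by auto
  show "overlap_sign m \<zeta> S \<sigma> j k \<noteq> 0 \<Longrightarrow> overlap_sign m \<zeta> S \<sigma> j k = orientation j * orientation k"
    using orientation_cases[of j] orientation_cases[of k] d
    unfolding overlap_sign_def Let_def left_part_def right_part_def
    by (auto split: if_splits)
  show "left_part j \<inter> left_part k \<noteq> {} \<Longrightarrow> overlap_sign m \<zeta> S \<sigma> j k = orientation j * orientation k"
    using orientation_cases[of j] orientation_cases[of k] d
    unfolding overlap_sign_def Let_def left_part_def right_part_def
    by (auto split: if_splits)
qed

lemma valid_orientation: "valid_signs m t \<zeta> S \<sigma> orientation"
  unfolding valid_signs_def using overlap_sign_orientation(1) orientation_cases by auto

context
  assumes pairs: "\<And>u v. u \<in> V \<Longrightarrow> v \<in> V \<Longrightarrow> u \<noteq> v \<Longrightarrow> \<exists>j<t. u \<in> S j \<and> v \<in> S j"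
    and two: "\<And>u. u \<in> V \<Longrightarrow> \<exists>v\<in>V. v \<noteq> u"
begin

text \<open>Two samples need not meet at their ends, but a third sample containing a leftmost vertex
  of each has a left end in common with both, and this ties all the signs together.\<close>

lemma valid_signs_unique:
  assumes a: "valid_signs m t \<zeta> S \<sigma> a" and jk: "j < t" "k < t"
  shows "a j * orientation j = a k * orientation k"
proof -
  note ok' = scale_okD[OF ok]
  have ex: "\<exists>u\<in>S j. U u \<le> \<eta>\<^sub>0" if "j < t" for j
    using S_dense[OF that, unfolded dense_points_def, rule_format, of 0] ok' by auto
  obtain u where u: "u \<in> S j" "U u \<le> \<eta>\<^sub>0" using ex jk by blast
  obtain v where v: "v \<in> S k" "U v \<le> \<eta>\<^sub>0" using ex jk by blast
  have uvV: "u \<in> V" "v \<in> V" using u v S_sub jk by blast+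
  \<comment> \<open>\<open>pairs\<close> speaks of distinct vertices only; when the two samples
    share the chosen vertex, \<open>two\<close> supplies a partner for it.\<close>
  obtain l where l: "l < t" "u \<in> S l" "v \<in> S l"
  proof (cases "u = v")
    case True
    then show ?thesis using that two[OF uvV(1)] pairs[OF uvV(1)] by blast
  next
    case False
    then show ?thesis using that pairs[OF uvV] by blast
  qed
  have step: "a i * orientation i = a l * orientation l" if i: "i < t" "x \<in> S i" "x \<in> S l" "U x \<le> \<eta>\<^sub>0" for i x
  proof -
    have "left_part i \<inter> left_part l \<noteq> {}" using left_part_mem i l by blast
    then have eq: "overlap_sign m \<zeta> S \<sigma> i l = orientation i * orientation l"
      by (rule overlap_sign_orientation(2)[OF i(1) l(1)])
    then have "overlap_sign m \<zeta> S \<sigma> i l \<noteq> 0"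
      using orientation_cases[of i] orientation_cases[of l] by auto
    then have "orientation i * orientation l = a i * a l"
      using a i l eq unfolding valid_signs_def by metis
    moreover have "a i \<in> {-1, 1}" "a l \<in> {-1, 1}" using a i l unfolding valid_signs_def by blast+
    ultimately show ?thesis using orientation_cases[of i] orientation_cases[of l] by auto
  qed
  show ?thesis using step[of j u] step[of k v] u v l jk by simp
qed

text \<open>All samples containing both vertices cast the same vote, and \<open>pairs\<close>
  provides at least one, so the sign of the vote count is exact.\<close>

lemma sketch_correct:
  assumes a: "valid_signs m t \<zeta> S \<sigma> a"
  shows "\<exists>s\<in>{-1, 1}. \<forall>u\<in>V. \<forall>v\<in>V. U u + \<eta> \<le> U v \<longrightarrow> antisym_ext (sketch_comparison m t S \<sigma> a) u v = s"
proof (cases "t = 0")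
  case True
  then have "U u + \<eta> \<le> U v \<longrightarrow> False" if "u \<in> V" "v \<in> V" for u v
    using pairs[of u v] that scale_okD[OF ok] by force
  then show ?thesis by blast
next
  case False
  then have t0: "0 < t" by simp
  define s where "s = a 0 * orientation 0"
  have a1: "a j \<in> {-1, 1}" if "j < t" for j using a that unfolding valid_signs_def by blast
  have s1: "s \<in> {-1, 1}" using a1[OF t0] orientation_cases[of 0] by (auto simp: s_def)
  have as: "a j = s * orientation j" if "j < t" for j
  proof -
    have "a j * orientation j = s" using valid_signs_unique[OF a that t0] by (simp add: s_def)
    then show ?thesis using orientation_cases[of j] by auto
  qed
  have "sgn (vote t S (reorient m a \<sigma>) u v) = s" if uv: "u \<in> V" "v \<in> V" "U u + \<eta> \<le> U v" for u v
  proof -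
    have ne: "u \<noteq> v" using uv scale_okD[OF ok] by auto
    then obtain l where l: "l < t" "u \<in> S l" "v \<in> S l" using pairs uv by blast
    define P where "P = {j. j < t \<and> u \<in> S j \<and> v \<in> S j \<and> reorient m a \<sigma> j u < reorient m a \<sigma> j v}"
    define N where "N = {j. j < t \<and> u \<in> S j \<and> v \<in> S j \<and> reorient m a \<sigma> j u > reorient m a \<sigma> j v}"
    have fin: "finite P" "finite N" by (auto simp: P_def N_def)
    have vote: "vote t S (reorient m a \<sigma>) u v = int (card P) - int (card N)"
      by (simp add: vote_def P_def N_def)
    have lt: "\<sigma>' j u < \<sigma>' j v" if "j < t" "u \<in> S j" "v \<in> S j" for j
      using \<sigma>'_oriented that uv by blast
    show ?thesis
    proof (cases "s = 1")
      case True
      have "reorient m a \<sigma> j u < reorient m a \<sigma> j v" if "j < t" "u \<in> S j" "v \<in> S j" for j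
        using lt[OF that] as[OF that(1)] True unfolding \<sigma>'_def reorient_def by simp
      then have "l \<in> P" "N = {}" using l by (auto simp: P_def N_def dest: less_asym)
      then have "card P > 0" "card N = 0" using fin by (auto simp: card_gt_0_iff)
      then show ?thesis using vote True by simp
    next
      case False
      then have sm: "s = -1" using s1 by auto
      have "reorient m a \<sigma> j v < reorient m a \<sigma> j u" if "j < t" "u \<in> S j" "v \<in> S j" for j
        using lt[OF that] as[OF that(1)] sm orientation_cases[of j] \<sigma>_range[OF that(1,2)] \<sigma>_range[OF that(1,3)]
        unfolding \<sigma>'_def reorient_def by auto
      then have "l \<in> N" "P = {}" using l by (auto simp: P_def N_def dest: less_asym)
      then have "card N > 0" "card P = 0" using fin by (auto simp: card_gt_0_iff)
      then show ?thesis using vote sm by simp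
    qed
  qed
  moreover have "u \<noteq> v" if "U u + \<eta> \<le> U v" for u v using that scale_okD[OF ok] by auto
  ultimately show ?thesis using s1 antisym_ext_sketch by metis
qed

end

end

section \<open>Correctness of local refinement\<close>

context embedded_graph
begin

text \<open>A vertex adjacent to \<open>u\<close> but not to \<open>v\<close> cannot be within
  \<open>d\<close> of \<open>v\<close>, nor right of \<open>v\<close>, since then the rate of q
  would make it adjacent to \<open>v\<close> as well. So it lies left of \<open>v\<close> at a
  distance where the sketch is right, and all terms of a score have the same sign. A separating
  vertex shows that the two scores are not both 0.\<close>

lemma local_refinement_correct:
  assumes V: "V = {1..n}" and ok: "scale_ok e \<eta>\<^sub>V \<theta>" and dense: "dense_points \<eta>\<^sub>V V U"
    and s: "s \<in> {-1, 1}" and \<eta>: "\<eta> \<le> d"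
    and F: "\<And>u v. u \<in> V \<Longrightarrow> v \<in> V \<Longrightarrow> U u + \<eta> \<le> U v \<Longrightarrow> antisym_ext F u v = s"
    and uv: "u \<in> V" "v \<in> V" "U u + \<theta> \<le> U v"
  shows "antisym_ext (local_refinement n H F) u v = s"
proof -
  note ok' = scale_okD[OF ok]
  have ne: "u \<noteq> v" using uv ok' by auto
  have \<kappa>\<theta>: "\<kappa> * \<theta> \<le> \<kappa> * (U v - U u)" using uv \<kappa>_pos by (intro mult_left_mono) auto
  \<comment> \<open>When \<open>u\<close> and \<open>v\<close> are adjacent, \<open>v\<close> itself
    is in the difference of neighbourhoods; its comparison with itself is 0, so removing it leaves
    the score unchanged.\<close>
  define Nu where "Nu = neighbourhood n H u - neighbourhood n H v - {v}"
  define Nv where "Nv = neighbourhood n H v - neighbourhood n H u - {u}"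
  have fin: "finite Nu" "finite Nv" by (auto simp: Nu_def Nv_def neighbourhood_def)
  have Nu: "antisym_ext F x v = s" if "x \<in> Nu" for x
  proof -
    have x: "x \<in> V" "H u x" "\<not> H v x" "x \<noteq> v" using that V uv by (auto simp: Nu_def neighbourhood_def)
    have qv: "q (U v) (U x) \<le> \<alpha> + e" using adj[of v x] x uv by force
    have qu: "\<alpha> - e \<le> q (U u) (U x)" using nonadj x uv by blast
    have "\<not> \<bar>U v - U x\<bar> \<le> d" using adj_near[of v x] x uv by auto
    moreover have "\<not> U v < U x"
    proof
      assume "U v < U x"
      then have "min (\<alpha> + \<mu>) (q (U u) (U x) + \<kappa> * ((U v - U u) + (U x - U x))) \<le> q (U v) (U x)"
        using uv x U01 ok' qu by (intro q_inner) auto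
      then show False using \<kappa>\<theta> qv qu ok' by auto
    qed
    ultimately show ?thesis using F[of x v] x uv \<eta> by auto
  qed
  have Nv: "antisym_ext F x u = - s" if "x \<in> Nv" for x
  proof -
    have x: "x \<in> V" "H v x" "\<not> H u x" "x \<noteq> u" using that V uv by (auto simp: Nv_def neighbourhood_def)
    have qu: "q (U u) (U x) \<le> \<alpha> + e" using adj[of u x] x uv by force
    have qv: "\<alpha> - e \<le> q (U v) (U x)" using nonadj x uv by blast
    have "\<not> \<bar>U u - U x\<bar> \<le> d" using adj_near[of u x] x uv by auto
    moreover have "\<not> U x < U u"
    proof
      assume "U x < U u"
      then have "min (\<alpha> + \<mu>) (q (U x) (U v) + \<kappa> * ((U x - U x) + (U v - U u))) \<le> q (U x) (U u)"
        using uv x U01 ok' qv by (intro q_inner) (auto simp: q_sym)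
      then show False using \<kappa>\<theta> qv qu ok' by (auto simp: q_sym[of "U x"])
    qed
    ultimately have "antisym_ext F u x = s" using F[of u x] x uv \<eta> by auto
    then show ?thesis by (simp add: antisym_ext_swap[of F x u])
  qed
  have score_u: "refine_score n H F u v = s * int (card Nu)"
  proof -
    have *: "antisym_ext F x v = (if x = v then 0 else s)" if "x \<in> neighbourhood n H u - neighbourhood n H v" for x
      using Nu[of x] that by (auto simp: Nu_def)
    have 1: "{x \<in> neighbourhood n H u - neighbourhood n H v. antisym_ext F x v = s} = Nu"
    proof (rule set_eqI)
      fix x show "x \<in> {x \<in> neighbourhood n H u - neighbourhood n H v. antisym_ext F x v = s} \<longleftrightarrow> x \<in> Nu"
        using *[of x] s unfolding Nu_def by auto
    qed
    have 2: "{x \<in> neighbourhood n H u - neighbourhood n H v. antisym_ext F x v = - s} = {}"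
    proof -
      have "antisym_ext F x v \<noteq> - s" if "x \<in> neighbourhood n H u - neighbourhood n H v" for x
        using *[OF that] s by (cases "x = v") auto
      then show ?thesis by blast
    qed
    show ?thesis
    proof (cases "s = 1")
      case True
      show ?thesis unfolding refine_score_def by (simp only: 1[unfolded True] 2[unfolded True] True card.empty)
    next
      case False
      then have sm: "s = -1" using s by auto
      show ?thesis
        unfolding refine_score_def by (simp only: 1[unfolded sm minus_minus] 2[unfolded sm minus_minus] sm card.empty)
    qed
  qed
  have score_v: "refine_score n H F v u = - s * int (card Nv)"
  proof -
    have *: "antisym_ext F x u = (if x = u then 0 else - s)" if "x \<in> neighbourhood n H v - neighbourhood n H u" for x
      using Nv[of x] that by (auto simp: Nv_def)
    have 1: "{x \<in> neighbourhood n H v - neighbourhood n H u. antisym_ext F x u = - s} = Nv"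
    proof (rule set_eqI)
      fix x show "x \<in> {x \<in> neighbourhood n H v - neighbourhood n H u. antisym_ext F x u = - s} \<longleftrightarrow> x \<in> Nv"
        using *[of x] s unfolding Nv_def by auto
    qed
    have 2: "{x \<in> neighbourhood n H v - neighbourhood n H u. antisym_ext F x u = s} = {}"
    proof -
      have "antisym_ext F x u \<noteq> s" if "x \<in> neighbourhood n H v - neighbourhood n H u" for x
        using *[OF that] s by (cases "x = u") auto
      then show ?thesis by blast
    qed
    show ?thesis
    proof (cases "s = 1")
      case True
      show ?thesis unfolding refine_score_def by (simp only: 1[unfolded True] 2[unfolded True] True card.empty)
    next
      case False
      then have sm: "s = -1" using s by auto
      show ?thesis
        unfolding refine_score_def by (simp only: 1[unfolded sm minus_minus] 2[unfolded sm minus_minus] sm card.empty)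
    qed
  qed
  have "Nu \<noteq> {} \<or> Nv \<noteq> {}"
  proof (cases "U u \<le> 1/2")
    case True
    obtain x where x: "x \<in> V" "U u < U x" "U x \<noteq> U v" "q (U u) (U x) < \<alpha> - e" "\<alpha> + e < q (U v) (U x)"
      using separating_point_right[OF ok dense, of "U u" "U v"] uv U01 True by fastforce
    have "H v x" using x uv by (intro adj) auto
    moreover have "\<not> H u x" using nonadj[of u x] x uv by auto
    ultimately have "x \<in> Nv" using x V by (auto simp: Nv_def neighbourhood_def)
    then show ?thesis by blast
  next
    case False
    then have "1/2 \<le> U v" using uv ok' by auto
    then obtain x where x: "x \<in> V" "U x < U v" "U x \<noteq> U u" "q (U v) (U x) < \<alpha> - e" "\<alpha> + e < q (U u) (U x)"
      using separating_point_left[OF ok dense, of "U u" "U v"] uv U01 by fastforce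
    have "H u x" using x uv by (intro adj) auto
    moreover have "\<not> H v x" using nonadj[of v x] x uv by auto
    ultimately have "x \<in> Nu" using x V by (auto simp: Nu_def neighbourhood_def)
    then show ?thesis by blast
  qed
  then have pos: "card Nu > 0 \<or> card Nv > 0" using fin by (auto simp: card_gt_0_iff)
  show ?thesis
    using ne s pos unfolding antisym_ext_def local_refinement_def score_u score_v
    by (auto simp: abs_mult)
qed

end

section \<open>From pairwise comparisons to the final permutation\<close>

lemma sigma_cmp_rank:
  assumes "linear_order_on {1..n} r"
  shows "bij_betw (sigma_cmp n r F) {1..n} {1..n}"
    and "\<lbrakk>i \<in> {1..n}; j \<in> {1..n}; gamma_cmp n F j < gamma_cmp n F i\<rbrakk> \<Longrightarrow> sigma_cmp n r F j < sigma_cmp n r F i"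
proof -
  define le where "le = (\<lambda>j i. gamma_cmp n F j < gamma_cmp n F i \<or> gamma_cmp n F j = gamma_cmp n F i \<and> (j, i) \<in> r)"
  have r: "refl_on {1..n} r" "trans r" "antisym r" "total_on {1..n} r"
    using assms by (auto simp: linear_order_on_def partial_order_on_def preorder_on_def)
  have eq: "sigma_cmp n r F = (\<lambda>i. card {j \<in> {1..n}. le j i})"
    by (auto simp: sigma_cmp_def le_def)
  have l: "\<And>i. i \<in> {1..n} \<Longrightarrow> le i i"
      "\<And>i j. i \<in> {1..n} \<Longrightarrow> j \<in> {1..n} \<Longrightarrow> le i j \<Longrightarrow> le j i \<Longrightarrow> i = j"
      "\<And>i j k. i \<in> {1..n} \<Longrightarrow> j \<in> {1..n} \<Longrightarrow> k \<in> {1..n} \<Longrightarrow> le i j \<Longrightarrow> le j k \<Longrightarrow> le i k"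
      "\<And>i j. i \<in> {1..n} \<Longrightarrow> j \<in> {1..n} \<Longrightarrow> le i j \<or> le j i"
  proof -
    show "le i i" if "i \<in> {1..n}" for i using refl_onD[OF r(1) that] by (simp add: le_def)
    show "i = j" if "i \<in> {1..n}" "j \<in> {1..n}" "le i j" "le j i" for i j
      using that antisymD[OF r(3)] by (auto simp: le_def)
    show "le i k" if "i \<in> {1..n}" "j \<in> {1..n}" "k \<in> {1..n}" "le i j" "le j k" for i j k
      using that transD[OF r(2), of i j k] by (auto simp: le_def)
    show "le i j \<or> le j i" if "i \<in> {1..n}" "j \<in> {1..n}" for i j
    proof -
      have "(i, j) \<in> r \<or> (j, i) \<in> r"
        using refl_onD[OF r(1) that(1)] r(4)[unfolded total_on_def, rule_format, OF that]
        by (cases "i = j") auto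
      then show ?thesis
        unfolding le_def by (cases "gamma_cmp n F i" "gamma_cmp n F j" rule: linorder_cases) simp_all
    qed
  qed
  show "bij_betw (sigma_cmp n r F) {1..n} {1..n}"
    unfolding eq using rank_bij_betw(1)[of "{1..n}" le, OF finite_atLeastAtMost l] by simp
  show "sigma_cmp n r F j < sigma_cmp n r F i"
    if "i \<in> {1..n}" "j \<in> {1..n}" "gamma_cmp n F j < gamma_cmp n F i"
    unfolding eq using that by (intro rank_bij_betw(3)[of "{1..n}" le, OF finite_atLeastAtMost l]) (auto simp: le_def)
qed

text \<open>The difference of the two sums is evaluated vertex by vertex. A vertex between
  \<open>j\<close> and \<open>i\<close> contributes 2, an outer one 0, up to the sign
  \<open>s\<close>. Vertices close to \<open>i\<close> or \<open>j\<close> may be compared wrongly,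
  and each of them costs at most 4, the drop from 2 to -2.\<close>

lemma gamma_cmp_order:
  fixes U :: "nat \<Rightarrow> real"
  assumes s: "s \<in> {-1, 1 :: int}" and \<theta>: "0 < \<theta>"
    and F: "\<And>u v. u \<in> {1..n} \<Longrightarrow> v \<in> {1..n} \<Longrightarrow> U u + \<theta> \<le> U v \<Longrightarrow> antisym_ext F u v = s"
    and bound: "\<And>u v. antisym_ext F u v \<in> {-1..1}"
    and near: "\<And>i. i \<in> {1..n} \<Longrightarrow> real (card {k \<in> {1..n}. \<bar>U k - U i\<bar> < \<theta>}) \<le> M"
    and D: "4 * M \<le> D"
    and ij: "i \<in> {1..n}" "j \<in> {1..n}" "real (sigma_true n U i) > real (sigma_true n U j) + D"
  shows "s * gamma_cmp n F j < s * gamma_cmp n F i"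
proof -
  define N where "N = (\<lambda>i. {k \<in> {1..n}. \<bar>U k - U i\<bar> < \<theta>})"
  define B where "B = {k \<in> {1..n}. U j < U k \<and> U k \<le> U i}"
  have M0: "0 \<le> M" using near[OF ij(1)] by linarith
  have Uji: "U j < U i"
  proof (rule ccontr)
    assume "\<not> U j < U i"
    then have "sigma_true n U i \<le> sigma_true n U j"
      unfolding sigma_true_def by (intro card_mono) auto
    then show False using ij D M0 by linarith
  qed
  have "sigma_true n U i = sigma_true n U j + card B"
  proof -
    have "{k \<in> {1..n}. U k \<le> U i} = {k \<in> {1..n}. U k \<le> U j} \<union> B"
      using Uji by (auto simp: B_def)
    then show ?thesis unfolding sigma_true_def
      by (simp add: card_Un_disjoint B_def disjoint_iff)
  qed
  then have cB: "D < real (card B)" using ij by simp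
  have pw: "2 * of_bool (k \<in> B) - 4 * of_bool (k \<in> N i) - 4 * of_bool (k \<in> N j)
        \<le> s * (antisym_ext F k i - antisym_ext F k j)" if k: "k \<in> {1..n}" for k
  proof (cases "k \<in> N i \<or> k \<in> N j")
    case True
    have "\<bar>s * (antisym_ext F k i - antisym_ext F k j)\<bar> \<le> 2"
      using bound[of k i] bound[of k j] s by auto
    then have "- 2 \<le> s * (antisym_ext F k i - antisym_ext F k j)" by linarith
    then show ?thesis using True by (auto simp: of_bool_def)
  next
    case False
    then have far: "U k + \<theta> \<le> U i \<or> U i + \<theta> \<le> U k" "U k + \<theta> \<le> U j \<or> U j + \<theta> \<le> U k"
      using k by (auto simp: N_def abs_if split: if_splits)
    have ss: "s * s = 1" using s by auto
    have 1: "antisym_ext F k l = s" if "l \<in> {1..n}" "U k + \<theta> \<le> U l" for l using F k that by blast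
    have 2: "antisym_ext F k l = -s" if "l \<in> {1..n}" "U l + \<theta> \<le> U k" for l
      using F[OF that(1) k that(2)] by (simp add: antisym_ext_swap[of F k l])
    consider "U k \<le> U j" | "U j < U k" "U k \<le> U i" | "U i < U k" by linarith
    then show ?thesis
    proof cases
      case 1
      then have "U k + \<theta> \<le> U j" "U k + \<theta> \<le> U i" using far \<theta> Uji by auto
      then show ?thesis using \<open>\<And>l. _ \<Longrightarrow> _ \<Longrightarrow> antisym_ext F k l = s\<close> ij False 1 by (auto simp: B_def)
    next
      case 2
      then have "U j + \<theta> \<le> U k" "U k + \<theta> \<le> U i" using far \<theta> Uji by auto
      then have "antisym_ext F k i = s" "antisym_ext F k j = - s"
        using \<open>\<And>l. _ \<Longrightarrow> _ \<Longrightarrow> antisym_ext F k l = s\<close> \<open>\<And>l. _ \<Longrightarrow> _ \<Longrightarrow> antisym_ext F k l = - s\<close> ij by blast+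
      then show ?thesis using False ss by (auto simp: algebra_simps of_bool_def)
    next
      case 3
      then have "U i + \<theta> \<le> U k" "U j + \<theta> \<le> U k" using far \<theta> Uji by auto
      then show ?thesis using \<open>\<And>l. _ \<Longrightarrow> _ \<Longrightarrow> antisym_ext F k l = - s\<close> ij False 3 by (auto simp: B_def)
    qed
  qed
  have cardsum: "(\<Sum>k\<in>{1..n}. of_bool (k \<in> A) :: int) = int (card A)" if "A \<subseteq> {1..n}" for A
  proof -
    have "(\<Sum>k\<in>{1..n}. of_bool (k \<in> A) :: int) = (\<Sum>k\<in>A. 1)"
      using that by (intro sum.mono_neutral_cong_right) auto
    then show ?thesis by simp
  qed
  have "(\<Sum>k\<in>{1..n}. 2 * of_bool (k \<in> B) - 4 * of_bool (k \<in> N i) - 4 * of_bool (k \<in> N j))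
      \<le> (\<Sum>k\<in>{1..n}. s * (antisym_ext F k i - antisym_ext F k j))"
    by (rule sum_mono) (rule pw)
  moreover have "(\<Sum>k\<in>{1..n}. s * (antisym_ext F k i - antisym_ext F k j)) = s * (gamma_cmp n F i - gamma_cmp n F j)"
    unfolding gamma_cmp_def by (simp only: sum_subtractf sum_distrib_left right_diff_distrib)
  moreover have "(\<Sum>k\<in>{1..n}. 2 * of_bool (k \<in> B) - 4 * of_bool (k \<in> N i) - 4 * of_bool (k \<in> N j)) =
      2 * int (card B) - 4 * int (card (N i)) - 4 * int (card (N j))"
  proof -
    have "B \<subseteq> {1..n}" "N i \<subseteq> {1..n}" "N j \<subseteq> {1..n}" by (auto simp: B_def N_def)
    then show ?thesis by (simp only: sum_subtractf sum_distrib_left[symmetric] cardsum)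
  qed
  ultimately have "2 * int (card B) - 4 * int (card (N i)) - 4 * int (card (N j)) \<le> s * (gamma_cmp n F i - gamma_cmp n F j)"
    by simp
  moreover have "0 < 2 * int (card B) - 4 * int (card (N i)) - 4 * int (card (N j))"
  proof -
    have "real (card (N i)) \<le> M" "real (card (N j)) \<le> M" using near ij by (auto simp: N_def)
    then have "0 < 2 * real (card B) - 4 * real (card (N i)) - 4 * real (card (N j))" using cB D by linarith
    then show ?thesis by linarith
  qed
  ultimately show ?thesis by (simp add: right_diff_distrib)
qed

text \<open>The global sign \<open>s\<close>, which the algorithm cannot know, selects the correct
  permutation: the true order for 1, its reverse for -1.\<close>

lemma error_less_sigma_cmp:
  fixes U :: "nat \<Rightarrow> real"
  assumes s: "s \<in> {-1, 1 :: int}" and \<theta>: "0 < \<theta>"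
    and F: "\<And>u v. u \<in> {1..n} \<Longrightarrow> v \<in> {1..n} \<Longrightarrow> U u + \<theta> \<le> U v \<Longrightarrow> antisym_ext F u v = s"
    and bound: "\<And>u v. antisym_ext F u v \<in> {-1..1}"
    and near: "\<And>i. i \<in> {1..n} \<Longrightarrow> real (card {k \<in> {1..n}. \<bar>U k - U i\<bar> < \<theta>}) \<le> M"
    and D: "4 * M \<le> D"
    and r: "linear_order_on {1..n} r" and \<rho>: "\<And>i. i \<in> {1..n} \<Longrightarrow> \<rho> i = sigma_cmp n r F i"
  shows "error_less n U \<rho> D"
proof -
  note order = gamma_cmp_order[OF s \<theta> F bound near D]
  have bd: "sigma_true n U i \<le> n" for i
  proof -
    have "sigma_true n U i \<le> card {1..n}" unfolding sigma_true_def by (intro card_mono) auto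
    then show ?thesis by simp
  qed
  show ?thesis
  proof (cases "s = 1")
    case True
    have "\<rho> j < \<rho> i" if "i \<in> {1..n}" "j \<in> {1..n}" "real (sigma_true n U i) > real (sigma_true n U j) + D" for i j
      using order[of i j] that True sigma_cmp_rank(2)[OF r] \<rho> by auto
    then show ?thesis unfolding error_less_def by auto
  next
    case False
    then have "s = -1" using s by auto
    have "\<rho> j < \<rho> i" if "i \<in> {1..n}" "j \<in> {1..n}" "real (sigma_eurt n U i) > real (sigma_eurt n U j) + D" for i j
    proof -
      have "real (sigma_true n U j) > real (sigma_true n U i) + D"
        using that(3) bd[of i] bd[of j] by (simp add: sigma_eurt_def of_nat_diff)
      then show ?thesis
        using order[of j i] that \<open>s = -1\<close> sigma_cmp_rank(2)[OF r] \<rho> by auto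
    qed
    then show ?thesis unfolding error_less_def by auto
  qed
qed

section \<open>The recorded samples\<close>

lemma enumerate_eqI:
  fixes X :: "nat set"
  assumes "x \<in> X" "card (X \<inter> {..<x}) = j"
  shows "enumerate X j = x"
  using assms
proof (induction j arbitrary: X)
  case 0
  then have e: "X \<inter> {..<x} = {}" by simp
  have "(LEAST n. n \<in> X) = x"
    using 0 e by (intro Least_equality) (auto simp: disjoint_iff not_less)
  then show ?case by (simp add: enumerate_0)
next
  case (Suc j)
  define l where "l = (LEAST n. n \<in> X)"
  have l: "l \<in> X" "\<And>y. y \<in> X \<Longrightarrow> l \<le> y"
    using Suc.prems(1) unfolding l_def by (auto intro: LeastI Least_le)
  have "l \<noteq> x"
  proof
    assume "l = x"
    then have "X \<inter> {..<x} = {}" using l(2) by (auto simp: disjoint_iff not_less)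
    then show False using Suc.prems by simp
  qed
  then have lx: "l \<in> X \<inter> {..<x}" using l Suc.prems(1) by (simp add: order_less_le)
  have "(X - {l}) \<inter> {..<x} = X \<inter> {..<x} - {l}" by blast
  then have "card ((X - {l}) \<inter> {..<x}) = j" using lx Suc.prems by simp
  then have "enumerate (X - {l}) j = x" using Suc.IH[of "X - {l}"] Suc.prems \<open>l \<noteq> x\<close> by simp
  then show ?case by (simp add: l_def enumerate_Suc)
qed

lemma ex_rank_below:
  fixes X :: "nat set"
  assumes "j < card (X \<inter> {..<T})"
  shows "\<exists>x\<in>X. x < T \<and> card (X \<inter> {..<x}) = j"
proof -
  define Y where "Y = X \<inter> {..<T}"
  define r where "r = (\<lambda>x. card (X \<inter> {..<x}))"
  have mono: "r x < r y" if "x \<in> Y" "x < y" for x y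
    unfolding r_def using that by (intro psubset_card_mono) (auto simp: Y_def)
  have inj: "inj_on r Y"
    by (rule linorder_inj_onI) (use mono in \<open>force+\<close>)
  have "r ` Y \<subseteq> {..<card Y}"
  proof safe
    fix x assume "x \<in> Y"
    then show "r x < card Y" unfolding r_def by (intro psubset_card_mono) (auto simp: Y_def)
  qed
  then have "r ` Y = {..<card Y}"
    by (intro card_subset_eq) (auto simp: card_image[OF inj])
  moreover have "j \<in> {..<card Y}" using assms by (simp add: Y_def)
  ultimately have "j \<in> r ` Y" by simp
  then show ?thesis by (auto simp: Y_def r_def)
qed

text \<open>Once more than \<open>j\<close> successes occur among the first \<open>T\<close> draws,
  the recorded sample with index \<open>j\<close> is a function of these draws. This serves both for
  the probability bound and for measurability.\<close>

lemma enumerate_Int_lessThan: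
  fixes X :: "nat set"
  assumes "j < card (X \<inter> {..<T})"
  shows "enumerate X j = enumerate (X \<inter> {..<T}) j" "enumerate X j \<in> X" "enumerate X j < T"
proof -
  obtain x where x: "x \<in> X" "x < T" "card (X \<inter> {..<x}) = j" using ex_rank_below[OF assms] by blast
  have "X \<inter> {..<T} \<inter> {..<x} = X \<inter> {..<x}" using x by auto
  then show "enumerate X j = enumerate (X \<inter> {..<T}) j" "enumerate X j \<in> X" "enumerate X j < T"
    using enumerate_eqI[OF x(1,3)] enumerate_eqI[of x "X \<inter> {..<T}" j] x by simp_all
qed

lemma sampling_terminates_iff:
  "sampling_terminates t H draws \<longleftrightarrow> (\<exists>T. t \<le> card (successes H draws \<inter> {..<T}))"
proof
  let ?X = "successes H draws"
  assume *: "sampling_terminates t H draws"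
  show "\<exists>T. t \<le> card (?X \<inter> {..<T})"
  proof (cases "finite ?X")
    case True
    then obtain T where "?X \<subseteq> {..<T}" using finite_nat_bounded by blast
    then have "?X \<inter> {..<T} = ?X" by blast
    then show ?thesis using * True by (intro exI[of _ T]) (auto simp: sampling_terminates_def)
  next
    case False
    then obtain Y where Y: "Y \<subseteq> ?X" "finite Y" "card Y = t" using infinite_arbitrarily_large by blast
    then obtain T where "Y \<subseteq> {..<T}" using finite_nat_bounded by blast
    then have "card Y \<le> card (?X \<inter> {..<T})" using Y by (intro card_mono) auto
    then show ?thesis using Y by auto
  qed
next
  let ?X = "successes H draws"
  assume "\<exists>T. t \<le> card (?X \<inter> {..<T})"
  then obtain T where T: "t \<le> card (?X \<inter> {..<T})" by blast
  show "sampling_terminates t H draws"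
  proof (cases "finite ?X")
    case True
    then show ?thesis using T card_mono[OF True, of "?X \<inter> {..<T}"] by (auto simp: sampling_terminates_def)
  qed (simp add: sampling_terminates_def)
qed

lemma card_ge_blocks:
  fixes X :: "nat set"
  assumes "\<And>b. b < t \<Longrightarrow> \<exists>k\<in>X. b * B \<le> k \<and> k < (b + 1) * B"
  shows "t \<le> card (X \<inter> {..<t * B})"
proof -
  obtain g where g: "\<And>b. b < t \<Longrightarrow> g b \<in> X \<and> b * B \<le> g b \<and> g b < (b + 1) * B"
    using assms by metis
  have B: "(b + 1) * B \<le> b' * B" if "b < b'" for b b' using that by (intro mult_le_mono) auto
  have inj: "inj_on g {..<t}"
  proof (rule linorder_inj_onI)
    fix b b' assume "b < b'" "b \<in> {..<t}" "b' \<in> {..<t}"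
    then have "g b < (b + 1) * B" "b' * B \<le> g b'" using g by auto
    then show "g b \<noteq> g b'" using B[OF \<open>b < b'\<close>] by linarith
  qed auto
  have "g ` {..<t} \<subseteq> X \<inter> {..<t * B}"
  proof
    fix k assume "k \<in> g ` {..<t}"
    then obtain b where b: "b < t" "k = g b" by auto
    have "(b + 1) * B \<le> t * B" using b by (intro mult_le_mono) auto
    then show "k \<in> X \<inter> {..<t * B}" using g[OF b(1)] b by auto
  qed
  then have "card (g ` {..<t}) \<le> card (X \<inter> {..<t * B})" by (intro card_mono) auto
  then show ?thesis using card_image[OF inj] by simp
qed

text \<open>The index of a success is the number of successes before it, here at most
  \<open>k\<close> and thus below \<open>t\<close>.\<close>

lemma recorded_early_success:
  assumes "k \<in> successes H draws" "k < t"
  shows "\<exists>j<t. recorded_set H draws j = draws k"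
proof -
  let ?X = "successes H draws"
  have "card (?X \<inter> {..<k}) \<le> card {..<k}" by (intro card_mono) auto
  then have "card (?X \<inter> {..<k}) < t" using assms by simp
  moreover have "enumerate ?X (card (?X \<inter> {..<k})) = k" by (rule enumerate_eqI[OF assms(1) refl])
  ultimately show ?thesis unfolding recorded_set_def by metis
qed

definition good_sample :: "nat \<Rightarrow> nat \<Rightarrow> real \<Rightarrow> real \<Rightarrow> real \<Rightarrow> (nat \<Rightarrow> real) \<Rightarrow> nat set \<Rightarrow> bool" where
  "good_sample n m \<zeta> \<eta>\<^sub>0 \<eta> U S \<longleftrightarrow> S \<subseteq> {1..n} \<and> card S = m \<and> dense_points \<eta>\<^sub>0 S U \<and>
     \<zeta> \<le> real (card {x \<in> S. U x \<le> 1/4}) \<and> \<zeta> \<le> real (card {x \<in> S. 3/4 \<le> U x}) \<and>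
     real (card {x \<in> S. U x < \<eta>\<^sub>0 + \<eta>}) < \<zeta>"

lemma (in embedded_graph) main_output_correct:
  assumes H: "H = square_threshold n \<alpha> G" and V: "V = {1..n}" and n: "2 \<le> n"
    and ok: "scale_ok e \<eta>\<^sub>0 \<eta>" "\<eta> \<le> 1/4" "\<eta> \<le> d"
    and okV: "scale_ok e \<eta>\<^sub>V \<theta>" "dense_points \<eta>\<^sub>V {1..n} U"
    and near: "\<And>i. i \<in> {1..n} \<Longrightarrow> real (card {k \<in> {1..n}. \<bar>U k - U i\<bar> < \<theta>}) \<le> M" "4 * M \<le> D"
    and good: "\<And>j. j < t \<Longrightarrow> good_sample n m \<zeta> \<eta>\<^sub>0 \<eta> U (recorded_set H draws j)"
    and pairs: "\<And>u v. u \<in> {1..n} \<Longrightarrow> v \<in> {1..n} \<Longrightarrow> u \<noteq> v \<Longrightarrow>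
        \<exists>j<t. u \<in> recorded_set H draws j \<and> v \<in> recorded_set H draws j"
    and out: "main_output n \<alpha> m t \<zeta> G draws \<rho>"
  shows "bij_betw \<rho> {1..n} {1..n} \<and> error_less n U \<rho> D"
proof -
  define S where "S = recorded_set H draws"
  obtain \<sigma> where io: "\<And>j. j < t \<Longrightarrow> interval_order H (S j) (\<sigma> j)"
    and res: "(\<exists>a. valid_signs m t \<zeta> S \<sigma> a) \<Longrightarrow>
           (\<exists>a r. valid_signs m t \<zeta> S \<sigma> a \<and> linear_order_on {1..n} r \<and>
              (\<forall>i\<in>{1..n}. \<rho> i = sigma_cmp n r (local_refinement n H (sketch_comparison m t S \<sigma> a)) i))"
    using out unfolding main_output_def Let_def H[symmetric] S_def[symmetric] by blast
  interpret R: recorded_orders q \<alpha> d \<mu> \<kappa> e U V H t m \<zeta> \<eta>\<^sub>0 \<eta> S \<sigma>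
  proof unfold_locales
    show "finite (S j)" if "j < t" for j
      using good[OF that] by (auto simp: S_def good_sample_def intro: finite_subset)
  qed (use good ok io in \<open>auto simp: S_def V good_sample_def\<close>)
  \<comment> \<open>The existence of valid signs excludes the branch in which the output is
    arbitrary.\<close>
  obtain a r where a: "valid_signs m t \<zeta> S \<sigma> a" and r: "linear_order_on {1..n} r"
    and \<rho>: "\<And>i. i \<in> {1..n} \<Longrightarrow> \<rho> i = sigma_cmp n r (local_refinement n H (sketch_comparison m t S \<sigma> a)) i"
    using res R.valid_orientation by blast
  have two: "\<exists>v\<in>V. v \<noteq> u" if "u \<in> V" for u
    using n V by (intro bexI[of _ "if u = 1 then 2 else 1"]) auto
  obtain s where s: "s \<in> {-1, 1}"
    and F: "\<And>u v. u \<in> V \<Longrightarrow> v \<in> V \<Longrightarrow> U u + \<eta> \<le> U v \<Longrightarrow> antisym_ext (sketch_comparison m t S \<sigma> a) u v = s"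
    using R.sketch_correct[OF pairs[folded S_def V] two a] by blast
  have F': "antisym_ext (local_refinement n H (sketch_comparison m t S \<sigma> a)) u v = s"
    if "u \<in> {1..n}" "v \<in> {1..n}" "U u + \<theta> \<le> U v" for u v
    using that V okV(2) by (intro local_refinement_correct[OF V okV(1) _ s ok(3) F]) simp_all
  have "error_less n U \<rho> D"
    by (rule error_less_sigma_cmp[OF s _ F' antisym_ext_local_refinement_bound near r \<rho>])
       (use scale_okD[OF okV(1)] in auto)
  moreover have "bij_betw \<rho> {1..n} {1..n}"
    using sigma_cmp_rank(1)[OF r] bij_betw_cong[of "{1..n}" \<rho>, OF \<rho>] by blast
  ultimately show ?thesis by blast
qed

lemma (in embedded_graph) main_succeeds_if:
  assumes H: "H = square_threshold n \<alpha> (random_graph n w U W)" and V: "V = {1..n}" and n: "2 \<le> n"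
    and ok: "scale_ok e \<eta>\<^sub>0 \<eta>" "\<eta> \<le> 1/4" "\<eta> \<le> d"
    and okV: "scale_ok e \<eta>\<^sub>V \<theta>" "dense_points \<eta>\<^sub>V {1..n} U"
    and near: "\<And>i. i \<in> {1..n} \<Longrightarrow> real (card {k \<in> {1..n}. \<bar>U k - U i\<bar> < \<theta>}) \<le> M" "4 * M \<le> D"
    and good: "\<And>k. k < t * B \<Longrightarrow> good_sample n m \<zeta> \<eta>\<^sub>0 \<eta> U (draws k)"
    and blocks: "\<And>b. b < t \<Longrightarrow> \<exists>k\<in>successes H draws. b * B \<le> k \<and> k < (b + 1) * B"
    and pairs: "\<And>u v. u \<in> {1..n} \<Longrightarrow> v \<in> {1..n} \<Longrightarrow> u \<noteq> v \<Longrightarrow>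
        \<exists>k\<in>successes H draws. k < t \<and> u \<in> draws k \<and> v \<in> draws k"
  shows "main_succeeds n \<alpha> m t \<zeta> w D (U, W, draws)"
proof -
  have T: "t \<le> card (successes H draws \<inter> {..<t * B})" by (rule card_ge_blocks[OF blocks])
  have rec: "good_sample n m \<zeta> \<eta>\<^sub>0 \<eta> U (recorded_set H draws j)" if "j < t" for j
    unfolding recorded_set_def using that T by (intro good enumerate_Int_lessThan) simp
  have pairs': "\<exists>j<t. u \<in> recorded_set H draws j \<and> v \<in> recorded_set H draws j"
    if uv: "u \<in> {1..n}" "v \<in> {1..n}" "u \<noteq> v" for u v
  proof -
    obtain k where k: "k \<in> successes H draws" "k < t" "u \<in> draws k" "v \<in> draws k"
      using pairs[OF uv] by blast
    then show ?thesis using recorded_early_success[OF k(1,2)] by auto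
  qed
  have "sampling_terminates t H draws" unfolding sampling_terminates_iff using T by blast
  then show ?thesis
    unfolding main_succeeds_def Let_def
    using main_output_correct[OF H V n ok okV near rec pairs'] by (simp add: H[symmetric])
qed

section \<open>Measurability of the success event\<close>

definition order_pattern :: "nat \<Rightarrow> (nat \<Rightarrow> real) \<Rightarrow> (nat \<times> nat) set" where
  "order_pattern n U = {(i, j). i \<in> {1..n} \<and> j \<in> {1..n} \<and> U j \<le> U i}"

lemma error_less_order_pattern:
  assumes "order_pattern n U = order_pattern n U'"
  shows "error_less n U \<rho> D \<longleftrightarrow> error_less n U' \<rho> D"
proof -
  have "sigma_true n U i = sigma_true n U' i" if "i \<in> {1..n}" for i
  proof -
    have "{j \<in> {1..n}. U j \<le> U i} = {j. (i, j) \<in> order_pattern n U}"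
      "{j \<in> {1..n}. U' j \<le> U' i} = {j. (i, j) \<in> order_pattern n U'}"
      using that by (auto simp: order_pattern_def)
    then show ?thesis using assms by (simp add: sigma_true_def)
  qed
  then show ?thesis by (simp add: error_less_def sigma_eurt_def)
qed

text \<open>Cut off at \<open>t\<close> so that two sequences of draws with the same first
  \<open>t\<close> successes give equal functions, which makes it a value that a predicate may
  depend on.\<close>

definition recorded_prefix :: "nat \<Rightarrow> (nat \<Rightarrow> nat \<Rightarrow> bool) \<Rightarrow> (nat \<Rightarrow> nat set) \<Rightarrow> nat \<Rightarrow> nat set" where
  "recorded_prefix t H draws j = (if j < t then recorded_set H draws j else {})"

definition output_of_sets ::
    "nat \<Rightarrow> nat \<Rightarrow> nat \<Rightarrow> real \<Rightarrow> (nat \<Rightarrow> nat \<Rightarrow> bool) \<Rightarrow> (nat \<Rightarrow> nat set) \<Rightarrow> (nat \<Rightarrow> nat) \<Rightarrow> bool" where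
  "output_of_sets n m t \<zeta> H S \<rho> \<longleftrightarrow>
      (\<exists>\<sigma>. (\<forall>j<t. interval_order H (S j) (\<sigma> j)) \<and>
          ((\<exists>a. valid_signs m t \<zeta> S \<sigma> a) \<longrightarrow>
           (\<exists>a r. valid_signs m t \<zeta> S \<sigma> a \<and> linear_order_on {1..n} r \<and>
              (\<forall>i\<in>{1..n}.
                 \<rho> i = sigma_cmp n r (local_refinement n H (sketch_comparison m t S \<sigma> a)) i))))"

lemma output_of_sets_cong:
  assumes "\<And>j. j < t \<Longrightarrow> S j = S' j"
  shows "output_of_sets n m t \<zeta> H S \<rho> \<longleftrightarrow> output_of_sets n m t \<zeta> H S' \<rho>"
proof -
  have 1: "valid_signs m t \<zeta> S \<sigma> a \<longleftrightarrow> valid_signs m t \<zeta> S' \<sigma> a" for \<sigma> a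
    unfolding valid_signs_def overlap_sign_def Let_def using assms by simp
  have "vote t S \<sigma> u v = vote t S' \<sigma> u v" for \<sigma> u v
    unfolding vote_def using assms by (auto intro!: arg_cong2[where f="(-)"] arg_cong[where f="\<lambda>X. int (card X)"])
  then have 2: "sketch_comparison m t S \<sigma> a = sketch_comparison m t S' \<sigma> a" for \<sigma> a
    by (simp add: sketch_comparison_def fun_eq_iff)
  have 3: "(\<forall>j<t. interval_order H (S j) (\<sigma> j)) \<longleftrightarrow> (\<forall>j<t. interval_order H (S' j) (\<sigma> j))" for \<sigma>
    using assms by simp
  show ?thesis unfolding output_of_sets_def 1 2 3 ..
qed

lemma main_output_prefix:
  "main_output n \<alpha> m t \<zeta> G draws \<rho> \<longleftrightarrow>
   output_of_sets n m t \<zeta> (square_threshold n \<alpha> G) (recorded_prefix t (square_threshold n \<alpha> G) draws) \<rho>"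
proof -
  have "main_output n \<alpha> m t \<zeta> G draws \<rho> \<longleftrightarrow>
      output_of_sets n m t \<zeta> (square_threshold n \<alpha> G) (recorded_set (square_threshold n \<alpha> G) draws) \<rho>"
    by (simp add: main_output_def output_of_sets_def Let_def)
  also have "\<dots> \<longleftrightarrow> output_of_sets n m t \<zeta> (square_threshold n \<alpha> G) (recorded_prefix t (square_threshold n \<alpha> G) draws) \<rho>"
    by (rule output_of_sets_cong) (simp add: recorded_prefix_def)
  finally show ?thesis .
qed

abbreviation sample_space :: "nat \<Rightarrow> nat \<Rightarrow> nat set measure" where
  "sample_space n m \<equiv> uniform_count_measure {S. S \<subseteq> {1..n} \<and> card S = m}"

lemma finite_samples [simp]: "finite {S. S \<subseteq> {1..n::nat} \<and> card S = m}"
  by (rule finite_subset[of _ "Pow {1..n}"]) auto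

lemma sets_PiM_samples_finite:
  assumes "finite I"
  shows "sets (\<Pi>\<^sub>M k\<in>I. sample_space n m) = Pow (I \<rightarrow>\<^sub>E {S. S \<subseteq> {1..n} \<and> card S = m})"
proof -
  have "sets (\<Pi>\<^sub>M k\<in>I. sample_space n m) = sets (\<Pi>\<^sub>M k\<in>I. count_space {S. S \<subseteq> {1..n} \<and> card S = m})"
    by (intro sets_PiM_cong refl) (simp add: sets_uniform_count_measure_count_space)
  also have "(\<Pi>\<^sub>M k\<in>I. count_space {S. S \<subseteq> {1..n} \<and> card S = m}) = count_space (I \<rightarrow>\<^sub>E {S. S \<subseteq> {1..n} \<and> card S = m})"
    by (intro count_space_PiM_finite assms countable_finite) simp
  finally show ?thesis by simp
qed

text \<open>The event factors through the projection to finitely many coordinates with finitely many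
  values each, where every set is measurable. So nothing about the predicate has to be
  known.\<close>

lemma sets_PiM_samples_prefix:
  fixes T :: nat
  assumes "\<And>x y. \<lbrakk>\<And>k. k < T \<Longrightarrow> x k = y k\<rbrakk> \<Longrightarrow> P x \<longleftrightarrow> P y"
  shows "{x \<in> space (\<Pi>\<^sub>M k\<in>UNIV. sample_space n m). P x} \<in> sets (\<Pi>\<^sub>M k\<in>UNIV. sample_space n m)"
proof -
  have m: "(\<lambda>x. restrict x {..<T}) \<in> (\<Pi>\<^sub>M k\<in>UNIV. sample_space n m) \<rightarrow>\<^sub>M (\<Pi>\<^sub>M k\<in>{..<T}. sample_space n m)"
    by (rule measurable_restrict_subset) simp
  define A where "A = {x \<in> {..<T} \<rightarrow>\<^sub>E {S. S \<subseteq> {1..n} \<and> card S = m}. P x}"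
  have "A \<in> sets (\<Pi>\<^sub>M k\<in>{..<T}. sample_space n m)"
    unfolding sets_PiM_samples_finite[OF finite_lessThan] A_def by blast
  from measurable_sets[OF m this]
  have "(\<lambda>x. restrict x {..<T}) -` A \<inter> space (\<Pi>\<^sub>M k\<in>UNIV. sample_space n m) \<in> sets (\<Pi>\<^sub>M k\<in>UNIV. sample_space n m)" .
  also have "(\<lambda>x. restrict x {..<T}) -` A \<inter> space (\<Pi>\<^sub>M k\<in>UNIV. sample_space n m) =
      {x \<in> space (\<Pi>\<^sub>M k\<in>UNIV. sample_space n m). P x}"
  proof -
    have "P (restrict x {..<T}) \<longleftrightarrow> P x" for x by (rule assms) simp
    then show ?thesis
      by (auto simp: A_def space_PiM space_uniform_count_measure PiE_def Pi_def)
  qed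
  finally show ?thesis .
qed

text \<open>A countable union over the number \<open>T\<close> of draws after which \<open>t\<close>
  successes have occurred; each member is determined by the first \<open>T\<close> draws.\<close>

lemma sets_terminates:
  "{x \<in> space (\<Pi>\<^sub>M k\<in>UNIV. sample_space n m). sampling_terminates t H x \<and> Q (recorded_prefix t H x)}
     \<in> sets (\<Pi>\<^sub>M k\<in>UNIV. sample_space n m)" (is "?A \<in> _")
proof -
  have "?A = (\<Union>T. {x \<in> space (\<Pi>\<^sub>M k\<in>UNIV. sample_space n m).
      t \<le> card (successes H x \<inter> {..<T}) \<and> Q (recorded_prefix t H x)})"
    unfolding sampling_terminates_iff by auto
  also have "\<dots> \<in> sets (\<Pi>\<^sub>M k\<in>UNIV. sample_space n m)"
  proof (intro sets.countable_UN, safe)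
    fix T
    show "{x \<in> space (\<Pi>\<^sub>M k\<in>UNIV. sample_space n m).
      t \<le> card (successes H x \<inter> {..<T}) \<and> Q (recorded_prefix t H x)} \<in> sets (\<Pi>\<^sub>M k\<in>UNIV. sample_space n m)"
    proof (rule sets_PiM_samples_prefix)
      fix x y :: "nat \<Rightarrow> nat set"
      assume xy: "\<And>k. k < T \<Longrightarrow> x k = y k"
      then have eq: "successes H x \<inter> {..<T} = successes H y \<inter> {..<T}"
        by (auto simp: successes_def)
      have "recorded_prefix t H x = recorded_prefix t H y" if "t \<le> card (successes H x \<inter> {..<T})"
      proof
        fix j
        show "recorded_prefix t H x j = recorded_prefix t H y j"
        proof (cases "j < t")
          case True
          then have j: "j < card (successes H x \<inter> {..<T})" "j < card (successes H y \<inter> {..<T})"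
            using that eq by auto
          have "enumerate (successes H x) j = enumerate (successes H y) j"
            using enumerate_Int_lessThan(1)[OF j(1)] enumerate_Int_lessThan(1)[OF j(2)] eq by simp
          then show ?thesis
            using True enumerate_Int_lessThan(3)[OF j(1)] xy by (simp add: recorded_prefix_def recorded_set_def)
        qed (simp add: recorded_prefix_def)
      qed
      moreover have "t \<le> card (successes H x \<inter> {..<T}) \<longleftrightarrow> t \<le> card (successes H y \<inter> {..<T})"
        by (simp only: eq)
      ultimately show "(t \<le> card (successes H x \<inter> {..<T}) \<and> Q (recorded_prefix t H x)) =
        (t \<le> card (successes H y \<inter> {..<T}) \<and> Q (recorded_prefix t H y))" by metis
    qed
  qed
  finally show ?thesis .
qed

lemma space_unif01 [simp]: "space unif01 = {0..1}"
  by (simp add: unif01_def space_restrict_space)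

lemma measurable_ident_unif01: "(\<lambda>x. x) \<in> unif01 \<rightarrow>\<^sub>M borel"
  unfolding unif01_def by (rule measurable_restrict_space1) simp

lemma measurable_component_unif01:
  "i \<in> I \<Longrightarrow> (\<lambda>x. x i) \<in> (\<Pi>\<^sub>M i\<in>I. unif01) \<rightarrow>\<^sub>M borel"
  by (rule measurable_compose[OF _ measurable_ident_unif01]) (rule measurable_component_singleton)

abbreviation edge_slots :: "nat \<Rightarrow> (nat \<times> nat) set" where
  "edge_slots n \<equiv> {(i, j). 1 \<le> i \<and> i < j \<and> j \<le> n}"

lemma edge_slot_mem: "i \<in> {1..n} \<Longrightarrow> j \<in> {1..n} \<Longrightarrow> i \<noteq> j \<Longrightarrow> (min i j, max i j) \<in> edge_slots n"
  by (auto simp: min_def max_def)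

text \<open>The measure of a non-measurable set is 0, so measurability of the success event is part of
  the claim. The event depends on the graph, on the order of the vertex variables, and on a finite
  but unbounded number of draws.\<close>

lemma sets_main_succeeds:
  assumes w: "(\<lambda>(x, y). w x y) \<in> borel_measurable (borel \<Otimes>\<^sub>M borel)"
  shows "{\<omega> \<in> space (run_space n m). main_succeeds n \<alpha> m t \<zeta> w D \<omega>} \<in> sets (run_space n m)"
proof -
  let ?\<Omega> = "run_space n m"
  let ?D = "\<Pi>\<^sub>M k\<in>UNIV. sample_space n m"
  have mU: "(\<lambda>\<omega>. fst \<omega> i) \<in> borel_measurable ?\<Omega>" if "i \<in> {1..n}" for i
    unfolding run_space_def by (rule measurable_compose[OF measurable_fst measurable_component_unif01[OF that]])
  have mW: "(\<lambda>\<omega>. fst (snd \<omega>) e) \<in> borel_measurable ?\<Omega>" if "e \<in> edge_slots n" for e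
    unfolding run_space_def
    by (rule measurable_compose[OF measurable_snd measurable_compose[OF measurable_fst measurable_component_unif01[OF that]]])
  have draws [measurable]: "(\<lambda>\<omega>. snd (snd \<omega>)) \<in> ?\<Omega> \<rightarrow>\<^sub>M ?D"
    unfolding run_space_def by measurable
  define E where "E = (\<lambda>\<omega>::(nat \<Rightarrow> real) \<times> (nat \<times> nat \<Rightarrow> real) \<times> (nat \<Rightarrow> nat set). {(i, j). random_graph n w (fst \<omega>) (fst (snd \<omega>)) i j})"
  define P where "P = (\<lambda>\<omega>::(nat \<Rightarrow> real) \<times> (nat \<times> nat \<Rightarrow> real) \<times> (nat \<Rightarrow> nat set). order_pattern n (fst \<omega>))"
  define K where "K = ({1..n} \<times> {1..n} :: (nat \<times> nat) set)"
  have EK: "E \<omega> \<subseteq> K" "P \<omega> \<subseteq> K"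
    for \<omega> :: "(nat \<Rightarrow> real) \<times> (nat \<times> nat \<Rightarrow> real) \<times> (nat \<Rightarrow> nat set)"
    by (auto simp: E_def P_def K_def random_graph_def order_pattern_def)
  have mE: "{\<omega> \<in> space ?\<Omega>. E \<omega> = A} \<in> sets ?\<Omega>" if "A \<subseteq> K" for A
  proof -
    have "{\<omega> \<in> space ?\<Omega>. E \<omega> = A} = {\<omega> \<in> space ?\<Omega>. \<forall>ij\<in>K. (ij \<in> E \<omega> \<longleftrightarrow> ij \<in> A)}"
      using EK(1) that by blast
    also have "\<dots> \<in> sets ?\<Omega>"
    proof (rule sets.sets_Collect_finite_All)
      show "{\<omega> \<in> space ?\<Omega>. ij \<in> E \<omega> \<longleftrightarrow> ij \<in> A} \<in> sets ?\<Omega>" if ijK: "ij \<in> K" for ij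
      proof (cases "fst ij = snd ij")
        case True
        then have "ij \<notin> E \<omega>" for \<omega> by (cases ij) (auto simp: E_def random_graph_def)
        then show ?thesis by simp
      next
        case False
        obtain i j where ij: "ij = (i, j)" "i \<in> {1..n}" "j \<in> {1..n}" "i \<noteq> j"
          using ijK False by (cases ij) (auto simp: K_def)
        have "(\<lambda>\<omega>. (\<lambda>(x, y). w x y) (fst \<omega> i, fst \<omega> j)) \<in> borel_measurable ?\<Omega>"
          by (rule measurable_compose[OF measurable_Pair[OF mU[OF ij(2)] mU[OF ij(3)]] w])
        then have less: "{\<omega> \<in> space ?\<Omega>. fst (snd \<omega>) (min i j, max i j) < w (fst \<omega> i) (fst \<omega> j)} \<in> sets ?\<Omega>"
          by (intro borel_measurable_less mW[OF edge_slot_mem[OF ij(2-4)]]) simp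
        have "{\<omega> \<in> space ?\<Omega>. ij \<in> E \<omega> \<longleftrightarrow> ij \<in> A} =
          {\<omega> \<in> space ?\<Omega>. (fst (snd \<omega>) (min i j, max i j) < w (fst \<omega> i) (fst \<omega> j)) \<longleftrightarrow> ij \<in> A}"
          using ij by (auto simp: E_def random_graph_def)
        also have "\<dots> \<in> sets ?\<Omega>"
          using less sets.sets_Collect_neg[OF less] by (cases "ij \<in> A") simp_all
        finally show ?thesis .
      qed
    qed (auto simp: K_def)
    finally show ?thesis .
  qed
  have mP: "{\<omega> \<in> space ?\<Omega>. P \<omega> = A} \<in> sets ?\<Omega>" if "A \<subseteq> K" for A
  proof -
    have "{\<omega> \<in> space ?\<Omega>. P \<omega> = A} = {\<omega> \<in> space ?\<Omega>. \<forall>ij\<in>K. (ij \<in> P \<omega> \<longleftrightarrow> ij \<in> A)}"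
      using EK(2) that by blast
    also have "\<dots> \<in> sets ?\<Omega>"
    proof (rule sets.sets_Collect_finite_All)
      show "{\<omega> \<in> space ?\<Omega>. ij \<in> P \<omega> \<longleftrightarrow> ij \<in> A} \<in> sets ?\<Omega>" if ijK: "ij \<in> K" for ij
      proof -
        obtain i j where ij: "ij = (i, j)" "i \<in> {1..n}" "j \<in> {1..n}" using ijK by (auto simp: K_def)
        have le: "{\<omega> \<in> space ?\<Omega>. fst \<omega> j \<le> fst \<omega> i} \<in> sets ?\<Omega>"
          by (rule borel_measurable_le[OF mU[OF ij(3)] mU[OF ij(2)]])
        have "{\<omega> \<in> space ?\<Omega>. ij \<in> P \<omega> \<longleftrightarrow> ij \<in> A} = {\<omega> \<in> space ?\<Omega>. (fst \<omega> j \<le> fst \<omega> i) \<longleftrightarrow> ij \<in> A}"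
          using ij by (auto simp: P_def order_pattern_def)
        also have "\<dots> \<in> sets ?\<Omega>"
          using le sets.sets_Collect_neg[OF le] by (cases "ij \<in> A") simp_all
        finally show ?thesis .
      qed
    qed (auto simp: K_def)
    finally show ?thesis .
  qed
  define Hof where "Hof = (\<lambda>A. square_threshold n \<alpha> (\<lambda>i j. (i, j) \<in> A))"
  \<comment> \<open>The quantifier over \<open>U\<close> removes the dependence on the actual
    positions: \<open>error_less\<close> is the same for all positions with the pattern
    \<open>B\<close>.\<close>
  define Q where "Q = (\<lambda>A B S. \<exists>U. order_pattern n U = B \<and>
     (\<forall>\<rho>. output_of_sets n m t \<zeta> (Hof A) S \<rho> \<longrightarrow> bij_betw \<rho> {1..n} {1..n} \<and> error_less n U \<rho> D))"
  have mQ: "{\<omega> \<in> space ?\<Omega>. sampling_terminates t (Hof A) (snd (snd \<omega>)) \<and>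
       Q A B (recorded_prefix t (Hof A) (snd (snd \<omega>)))} \<in> sets ?\<Omega>" for A B
  proof -
    have "{\<omega> \<in> space ?\<Omega>. sampling_terminates t (Hof A) (snd (snd \<omega>)) \<and>
       Q A B (recorded_prefix t (Hof A) (snd (snd \<omega>)))} =
      (\<lambda>\<omega>. snd (snd \<omega>)) -` {x \<in> space ?D. sampling_terminates t (Hof A) x \<and>
       Q A B (recorded_prefix t (Hof A) x)} \<inter> space ?\<Omega>"
      using measurable_space[OF draws] by blast
    also have "\<dots> \<in> sets ?\<Omega>" by (rule measurable_sets[OF draws sets_terminates])
    finally show ?thesis .
  qed
  have eq: "main_succeeds n \<alpha> m t \<zeta> w D \<omega> \<longleftrightarrow> sampling_terminates t (Hof (E \<omega>)) (snd (snd \<omega>)) \<and>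
       Q (E \<omega>) (P \<omega>) (recorded_prefix t (Hof (E \<omega>)) (snd (snd \<omega>)))" for \<omega> :: "(nat \<Rightarrow> real) \<times> (nat \<times> nat \<Rightarrow> real) \<times> (nat \<Rightarrow> nat set)"
  proof (cases \<omega>)
    case (fields U W dr)
    have G: "random_graph n w U W = (\<lambda>i j. (i, j) \<in> E \<omega>)" by (simp add: E_def fields fun_eq_iff)
    have "(\<exists>U'. order_pattern n U' = order_pattern n U \<and> (\<forall>\<rho>. R \<rho> \<longrightarrow> bij_betw \<rho> {1..n} {1..n} \<and> error_less n U' \<rho> D))
        \<longleftrightarrow> (\<forall>\<rho>. R \<rho> \<longrightarrow> bij_betw \<rho> {1..n} {1..n} \<and> error_less n U \<rho> D)" for R
      using error_less_order_pattern[of n _ U] by blast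
    then show ?thesis
      unfolding main_succeeds_def fields Let_def main_output_prefix
      by (simp add: G[unfolded fields] Hof_def Q_def P_def fields)
  qed
  \<comment> \<open>On each of the finitely many pieces with fixed graph and fixed pattern, the
    remaining condition concerns the draws alone.\<close>
  have split: "{\<omega> \<in> space ?\<Omega>. R (E \<omega>) (P \<omega>) \<omega>} =
    (\<Union>A\<in>Pow K. \<Union>B\<in>Pow K. {\<omega> \<in> space ?\<Omega>. E \<omega> = A} \<inter> {\<omega> \<in> space ?\<Omega>. P \<omega> = B} \<inter>
      {\<omega> \<in> space ?\<Omega>. R A B \<omega>})" for R
    using EK by auto
  have "{\<omega> \<in> space ?\<Omega>. main_succeeds n \<alpha> m t \<zeta> w D \<omega>} =
    (\<Union>A\<in>Pow K. \<Union>B\<in>Pow K. {\<omega> \<in> space ?\<Omega>. E \<omega> = A} \<inter> {\<omega> \<in> space ?\<Omega>. P \<omega> = B} \<inter>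
      {\<omega> \<in> space ?\<Omega>. sampling_terminates t (Hof A) (snd (snd \<omega>)) \<and>
       Q A B (recorded_prefix t (Hof A) (snd (snd \<omega>)))})"
    unfolding eq by (rule split)
  also have "\<dots> \<in> sets ?\<Omega>"
    by (intro sets.finite_UN sets.Int mE mP mQ) (auto simp: K_def)
  finally show ?thesis .
qed

section \<open>Random samples of fixed size\<close>

lemma card_supersets:
  assumes "finite V" "T \<subseteq> V" "card T \<le> m"
  shows "card {S. S \<subseteq> V \<and> card S = m \<and> T \<subseteq> S} = (card V - card T) choose (m - card T)"
proof -
  have fT: "finite T" using assms by (auto intro: finite_subset)
  have "bij_betw (\<lambda>S. S - T) {S. S \<subseteq> V \<and> card S = m \<and> T \<subseteq> S} {R. R \<subseteq> V - T \<and> card R = m - card T}"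
  proof (rule bij_betwI[where g="\<lambda>R. R \<union> T"])
    show "(\<lambda>S. S - T) \<in> {S. S \<subseteq> V \<and> card S = m \<and> T \<subseteq> S} \<rightarrow> {R. R \<subseteq> V - T \<and> card R = m - card T}"
      using fT by (auto simp: card_Diff_subset)
    show "(\<lambda>R. R \<union> T) \<in> {R. R \<subseteq> V - T \<and> card R = m - card T} \<rightarrow> {S. S \<subseteq> V \<and> card S = m \<and> T \<subseteq> S}"
    proof
      fix R assume "R \<in> {R. R \<subseteq> V - T \<and> card R = m - card T}"
      then have R: "R \<subseteq> V - T" "card R = m - card T" by auto
      then have "finite R" "R \<inter> T = {}" using assms(1) by (auto intro: finite_subset)
      then have "card (R \<union> T) = m" using fT R assms(3) by (simp add: card_Un_disjoint)
      then show "R \<union> T \<in> {S. S \<subseteq> V \<and> card S = m \<and> T \<subseteq> S}" using R assms(2) by auto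
    qed
  qed auto
  then have "card {S. S \<subseteq> V \<and> card S = m \<and> T \<subseteq> S} = card {R. R \<subseteq> V - T \<and> card R = m - card T}"
    by (rule bij_betw_same_card)
  also have "\<dots> = (card V - card T) choose (m - card T)"
    using assms fT by (subst n_subsets) (auto simp: card_Diff_subset)
  finally show ?thesis .
qed

text \<open>The ratio of the two binomials is the product of the fractions
  \<open>(b - i) / (n - i)\<close>, none of which exceeds \<open>b / n\<close>.\<close>

lemma binomial_ratio_le:
  assumes "b \<le> n" "M \<le> n"
  shows "real (b choose M) \<le> (real b / real n) ^ M * real (n choose M)"
  using assms(2)
proof (induction M)
  case (Suc M)
  have step: "real (Suc M) * real (a choose Suc M) = (real a - real M) * real (a choose M)" for a
  proof (cases "M \<le> a")
    case True
    then show ?thesis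
      using binomial_absorb_comp[of a M] by (metis of_nat_diff of_nat_mult binomial_absorption binomial_absorb_comp mult.commute)
  next
    case False
    then show ?thesis by (simp add: binomial_eq_0)
  qed
  have n0: "0 < n" using Suc by simp
  have "(real b - real M) \<le> (real b / real n) * (real n - real M)"
    using mult_left_mono[of "real b" "real n" "real M"] assms n0 by (simp add: field_simps)
  then have "(real b - real M) * real (b choose M) \<le> (real b / real n) * (real n - real M) * real (b choose M)"
    by (rule mult_right_mono) simp
  also have "\<dots> \<le> (real b / real n) * (real n - real M) * ((real b / real n) ^ M * real (n choose M))"
    using Suc by (intro mult_left_mono) auto
  also have "\<dots> = (real b / real n) ^ Suc M * ((real n - real M) * real (n choose M))"
    by simp
  finally have "real (Suc M) * real (b choose Suc M) \<le> (real b / real n) ^ Suc M * (real (Suc M) * real (n choose Suc M))"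
    using step[of b] step[of n] by simp
  then show ?case by (simp add: mult.left_commute del: of_nat_Suc power_Suc)
qed simp

text \<open>The bound 4 allows for prescribing two given vertices together with an uncertain
  pair.\<close>

locale samples =
  fixes n m :: nat
  assumes m4: "4 \<le> m" and mn: "m \<le> n"
begin

definition N :: "nat set measure" where
  "N = sample_space n m"

lemma space_N: "space N = {S. S \<subseteq> {1..n} \<and> card S = m}"
  by (simp add: N_def space_uniform_count_measure)

lemma sets_N: "sets N = Pow (space N)"
  by (simp add: N_def space_uniform_count_measure sets_uniform_count_measure)

lemma card_space_N: "card (space N) = n choose m"
  unfolding space_N using n_subsets[of "{1..n}" m] by simp

lemma choose_pos: "0 < real (n choose m)"
  using mn by simp

sublocale prob_space N
  unfolding N_def
proof (rule prob_space_uniform_count_measure)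
  show "{S. S \<subseteq> {1..n} \<and> card S = m} \<noteq> {}"
    using card_space_N choose_pos unfolding space_N by (metis card.empty less_irrefl of_nat_0)
qed simp

lemma prob_eq: "A \<subseteq> space N \<Longrightarrow> prob A = real (card A) / real (n choose m)"
  using measure_uniform_count_measure[OF finite_samples[of n m]] card_space_N
  unfolding space_N by (simp add: N_def)

lemma mem_sets: "A \<subseteq> space N \<Longrightarrow> A \<in> sets N"
  by (simp add: sets_N)

text \<open>The probability that a uniform \<open>m\<close>-subset contains \<open>k\<close> given
  vertices.\<close>

definition p :: "nat \<Rightarrow> real" where
  "p k = real ((n - k) choose (m - k)) / real (n choose m)"

lemma p_nonneg: "0 \<le> p k"
  by (simp add: p_def)

lemma prob_superset:
  assumes "T \<subseteq> {1..n}" "card T = k" "k \<le> m"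
  shows "prob {S \<in> space N. T \<subseteq> S} = p k"
proof -
  have "{S \<in> space N. T \<subseteq> S} = {S. S \<subseteq> {1..n} \<and> card S = m \<and> T \<subseteq> S}" by (auto simp: space_N)
  then have "card {S \<in> space N. T \<subseteq> S} = (n - k) choose (m - k)"
    using card_supersets[of "{1..n}" T m] assms by simp
  moreover have "prob {S \<in> space N. T \<subseteq> S} = real (card {S \<in> space N. T \<subseteq> S}) / real (n choose m)"
    by (rule prob_eq) auto
  ultimately show ?thesis by (simp add: p_def)
qed

lemma p_Suc: 
  assumes "k < m" shows "p (Suc k) = p k * (real (m - k) / real (n - k))"
proof -
  have "Suc (m - Suc k) * (Suc (n - Suc k) choose Suc (m - Suc k)) = Suc (n - Suc k) * ((n - Suc k) choose (m - Suc k))"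
    by (rule Suc_times_binomial)
  then have "(m - k) * ((n - k) choose (m - k)) = (n - k) * ((n - Suc k) choose (m - Suc k))"
    using assms mn by (simp add: Suc_diff_Suc)
  then have "real (m - k) * real ((n - k) choose (m - k)) = real (n - k) * real ((n - Suc k) choose (m - Suc k))"
    by (metis of_nat_mult)
  moreover have "real (n - k) \<noteq> 0" using assms mn by simp
  ultimately have "real ((n - Suc k) choose (m - Suc k)) = real ((n - k) choose (m - k)) * (real (m - k) / real (n - k))"
    by (simp add: nonzero_eq_divide_eq mult.commute)
  then show ?thesis unfolding p_def by simp
qed

lemma p_Suc_le: 
  assumes "k < m" shows "p (Suc k) \<le> p k * (real m / real n)"
proof -
  have "real (m - k) / real (n - k) \<le> real m / real n"
  proof -
    have "real k * real m \<le> real k * real n" using mn by (intro mult_left_mono) auto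
    then have "(real m - real k) * real n \<le> real m * (real n - real k)" by (simp add: algebra_simps)
    then show ?thesis using assms mn by (simp add: divide_simps of_nat_diff)
  qed
  then show ?thesis unfolding p_Suc[OF assms] by (intro mult_left_mono p_nonneg)
qed

lemma p_0: "p 0 = 1"
  using choose_pos by (simp add: p_def)

text \<open>Crude, but it matches the number of successes: with (n log n)^2 draws every pair of
  vertices is still expected to be covered about (log n)^2 times up to a constant.\<close>

lemma p2_ge: "1 / (real n)\<^sup>2 \<le> p 2"
proof -
  have "p (Suc (Suc 0)) = (real m / real n) * (real (m - 1) / real (n - 1))"
    using p_Suc[of 0] p_Suc[of 1] m4 by (simp add: p_0)
  moreover have "1 / real n \<le> real m / real n" using m4 mn by (intro divide_right_mono) auto
  moreover have "1 / real n \<le> real (m - 1) / real (n - 1)"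
    using m4 mn by (intro frac_le) auto
  ultimately show ?thesis
    using mult_mono[of "1 / real n" "real m / real n" "1 / real n" "real (m - 1) / real (n - 1)"]
    by (simp add: power2_eq_square numeral_2_eq_2)
qed

lemma p3_le: "p 3 \<le> p 2 * (real m / real n)"
  using p_Suc_le[of 2] m4 by (simp add: numeral_3_eq_3)

lemma p4_le: "p 4 \<le> p 2 * (real m / real n)\<^sup>2"
proof -
  have "p 4 \<le> p 3 * (real m / real n)" using p_Suc_le[of 3] m4 by (simp add: numeral_3_eq_3 eval_nat_numeral)
  also have "\<dots> \<le> (p 2 * (real m / real n)) * (real m / real n)" by (intro mult_right_mono p3_le) simp
  finally show ?thesis by (simp add: power2_eq_square mult.assoc)
qed

text \<open>Union bound over the \<open>M\<close>-subsets of \<open>B\<close>, combined with the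
  identity that \<open>n choose M\<close> times \<open>p M\<close> is \<open>m choose M\<close>. It
  replaces a concentration inequality for the hypergeometric distribution; the three estimates that
  follow are applications, two of them to the complement of the given set.\<close>

lemma prob_inter_ge:
  assumes B: "B \<subseteq> {1..n}" and M: "M \<le> m"
  shows "prob {S \<in> space N. M \<le> card (S \<inter> B)} \<le> real (m choose M) * (real (card B) / real n) ^ M"
proof -
  define \<T> where "\<T> = {T. T \<subseteq> B \<and> card T = M}"
  have finB: "finite B" using B by (rule finite_subset) simp
  have fin: "finite \<T>" using finB by (auto simp: \<T>_def)
  have cB: "card B \<le> n" using card_mono[OF _ B] by simp
  have "{S \<in> space N. M \<le> card (S \<inter> B)} \<subseteq> (\<Union>T\<in>\<T>. {S \<in> space N. T \<subseteq> S})"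
  proof
    fix S assume S: "S \<in> {S \<in> space N. M \<le> card (S \<inter> B)}"
    then have "M \<le> card (S \<inter> B)" by simp
    then obtain T where "T \<subseteq> S \<inter> B" "card T = M" by (rule obtain_subset_with_card_n)
    then show "S \<in> (\<Union>T\<in>\<T>. {S \<in> space N. T \<subseteq> S})" using S by (auto simp: \<T>_def)
  qed
  then have "prob {S \<in> space N. M \<le> card (S \<inter> B)} \<le> prob (\<Union>T\<in>\<T>. {S \<in> space N. T \<subseteq> S})"
    by (intro finite_measure_mono mem_sets) auto
  also have "\<dots> \<le> (\<Sum>T\<in>\<T>. prob {S \<in> space N. T \<subseteq> S})"
    by (intro finite_measure_subadditive_finite fin) (auto intro!: mem_sets)
  also have "\<dots> = (\<Sum>T\<in>\<T>. p M)"
    using B M by (intro sum.cong refl prob_superset) (auto simp: \<T>_def)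
  also have "\<dots> = real (card B choose M) * p M"
    using n_subsets[OF finB] by (simp add: \<T>_def)
  also have "\<dots> \<le> ((real (card B) / real n) ^ M * real (n choose M)) * p M"
    using cB M mn by (intro mult_right_mono binomial_ratio_le p_nonneg) auto
  also have "\<dots> = real (m choose M) * (real (card B) / real n) ^ M"
  proof -
    have "(n choose m) * (m choose M) = (n choose M) * ((n - M) choose (m - M))"
      using M mn by (intro choose_mult) auto
    then have "real (n choose m) * real (m choose M) = real (n choose M) * real ((n - M) choose (m - M))"
      by (metis of_nat_mult)
    then have "real (n choose M) * p M = real (m choose M)"
      using choose_pos by (simp add: p_def nonzero_divide_eq_eq mult.commute)
    then have "(real (card B) / real n) ^ M * (real (n choose M) * p M) = (real (card B) / real n) ^ M * real (m choose M)"
      by simp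
    then show ?thesis by (simp only: mult_ac)
  qed
  finally show ?thesis .
qed

lemma prob_disjoint:
  assumes A: "A \<subseteq> {1..n}" "real n * a \<le> real (card A)" "0 \<le> a"
  shows "prob {S \<in> space N. S \<inter> A = {}} \<le> (1 - a) ^ m"
proof -
  have n0: "0 < n" using m4 mn by simp
  have eq: "{S \<in> space N. S \<inter> A = {}} \<subseteq> {S \<in> space N. m \<le> card (S \<inter> ({1..n} - A))}"
  proof
    fix S assume S: "S \<in> {S \<in> space N. S \<inter> A = {}}"
    then have "S \<inter> ({1..n} - A) = S" by (auto simp: space_N)
    then show "S \<in> {S \<in> space N. m \<le> card (S \<inter> ({1..n} - A))}" using S by (auto simp: space_N)
  qed
  have "prob {S \<in> space N. S \<inter> A = {}} \<le> prob {S \<in> space N. m \<le> card (S \<inter> ({1..n} - A))}"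
    by (intro finite_measure_mono eq mem_sets) auto
  also have "\<dots> \<le> real (m choose m) * (real (card ({1..n} - A)) / real n) ^ m"
    by (rule prob_inter_ge) auto
  also have "\<dots> \<le> (1 - a) ^ m"
  proof -
    have "card ({1..n} - A) = n - card A" using A by (simp add: card_Diff_subset finite_subset)
    moreover have "card A \<le> n" using card_mono[OF _ A(1)] by simp
    ultimately have "real (card ({1..n} - A)) / real n \<le> 1 - a"
      using A n0 by (simp add: of_nat_diff field_simps)
    then show ?thesis by (simp add: power_mono)
  qed
  finally show ?thesis .
qed

lemma prob_inter_less:
  assumes A: "A \<subseteq> {1..n}" "real n / 8 \<le> real (card A)" and k: "\<zeta> \<le> real k" "k \<le> m"
  shows "prob {S \<in> space N. real (card (S \<inter> A)) < \<zeta>} \<le> real m ^ k * (7 / 8) ^ (m - k)"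
proof -
  have n0: "0 < n" using m4 mn by simp
  have eq: "{S \<in> space N. real (card (S \<inter> A)) < \<zeta>} \<subseteq> {S \<in> space N. m - k \<le> card (S \<inter> ({1..n} - A))}"
  proof
    fix S assume S: "S \<in> {S \<in> space N. real (card (S \<inter> A)) < \<zeta>}"
    then have fS: "finite S" "S \<subseteq> {1..n}" "card S = m" by (auto simp: space_N intro: finite_subset)
    have "(S \<inter> A) \<union> (S \<inter> ({1..n} - A)) = S" using fS by auto
    moreover have "card ((S \<inter> A) \<union> (S \<inter> ({1..n} - A))) = card (S \<inter> A) + card (S \<inter> ({1..n} - A))"
      using fS by (intro card_Un_disjoint) auto
    ultimately have "card S = card (S \<inter> A) + card (S \<inter> ({1..n} - A))" by simp
    moreover have "card (S \<inter> A) < k" using S k by simp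
    ultimately show "S \<in> {S \<in> space N. m - k \<le> card (S \<inter> ({1..n} - A))}" using S fS by auto
  qed
  have "prob {S \<in> space N. real (card (S \<inter> A)) < \<zeta>} \<le> prob {S \<in> space N. m - k \<le> card (S \<inter> ({1..n} - A))}"
    by (intro finite_measure_mono eq mem_sets) auto
  also have "\<dots> \<le> real (m choose (m - k)) * (real (card ({1..n} - A)) / real n) ^ (m - k)"
    by (rule prob_inter_ge) auto
  also have "\<dots> \<le> real m ^ k * (7 / 8) ^ (m - k)"
  proof (intro mult_mono power_mono)
    have "m choose (m - k) = m choose k" by (rule binomial_symmetric[OF k(2), symmetric])
    also have "\<dots> \<le> m ^ k" by (rule binomial_le_pow) (use k in simp)
    finally show "real (m choose (m - k)) \<le> real m ^ k" by (metis of_nat_le_iff of_nat_power)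
    have "card ({1..n} - A) = n - card A" using A by (simp add: card_Diff_subset finite_subset)
    moreover have "card A \<le> n" using card_mono[OF _ A(1)] by simp
    ultimately show "real (card ({1..n} - A)) / real n \<le> 7 / 8"
      using A n0 by (simp add: of_nat_diff field_simps)
  qed auto
  finally show ?thesis .
qed

lemma prob_inter_large:
  assumes A: "A \<subseteq> {1..n}" "real (card A) \<le> \<beta> * real n" and k: "real k < \<zeta> + 1" "k \<le> m" and \<beta>: "0 \<le> \<beta>"
  shows "prob {S \<in> space N. \<zeta> \<le> real (card (S \<inter> A))} \<le> (real m * \<beta>) ^ k / fact k"
proof -
  have n0: "0 < n" using m4 mn by simp
  have eq: "{S \<in> space N. \<zeta> \<le> real (card (S \<inter> A))} \<subseteq> {S \<in> space N. k \<le> card (S \<inter> A)}"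
    using k by auto
  have "prob {S \<in> space N. \<zeta> \<le> real (card (S \<inter> A))} \<le> prob {S \<in> space N. k \<le> card (S \<inter> A)}"
    by (intro finite_measure_mono eq mem_sets) auto
  also have "\<dots> \<le> real (m choose k) * (real (card A) / real n) ^ k"
    by (rule prob_inter_ge[OF A(1) k(2)])
  also have "\<dots> \<le> (real m ^ k / fact k) * \<beta> ^ k"
  proof (intro mult_mono power_mono)
    have "(m choose k) * fact k \<le> m ^ k" by (rule binomial_fact_pow)
    then have "real ((m choose k) * fact k) \<le> real (m ^ k)" by (simp only: of_nat_le_iff)
    then show "real (m choose k) \<le> real m ^ k / fact k" by (simp add: field_simps)
    show "real (card A) / real n \<le> \<beta>" using A n0 by (simp add: field_simps)
  qed auto
  also have "\<dots> = (real m * \<beta>) ^ k / fact k" by (simp add: power_mult_distrib)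
  finally show ?thesis .
qed

text \<open>The three ways to be a bad sample: one of \<open>K\<close> bins is missed, an outer
  quarter receives too few vertices, or the neighbourhood of 0 receives too many.\<close>

definition sample_defect :: "nat \<Rightarrow> nat \<Rightarrow> real \<Rightarrow> real" where
  "sample_defect K k \<beta> = real K * (1 - 1 / (2 * real K)) ^ m + 2 * (real m ^ k * (7 / 8) ^ (m - k)) + (real m * \<beta>) ^ k / fact k"

text \<open>An interval of length \<open>2 / real K\<close> contains a whole bin, namely the first
  one that starts at or after \<open>a\<close>.\<close>

lemma dense_points_bins:
  assumes K: "0 < K" and bins: "\<And>i. i < K \<Longrightarrow> \<exists>x\<in>S. real i / real K \<le> U x \<and> U x \<le> (real i + 1) / real K"
  shows "dense_points (2 / real K) S U"
  unfolding dense_points_def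
proof (intro allI impI)
  fix a :: real assume a: "0 \<le> a \<and> a + 2 / real K \<le> 1"
  define i where "i = nat \<lceil>a * real K\<rceil>"
  have "0 \<le> a * real K" using a by simp
  then have i: "a * real K \<le> real i" "real i < a * real K + 1" by (auto simp: i_def) linarith+
  have "(a + 2 / real K) * real K \<le> 1 * real K" using a by (intro mult_right_mono) auto
  then have "a * real K + 2 \<le> real K" using K by (simp add: distrib_right)
  then have "i < K" using i by linarith
  then obtain x where x: "x \<in> S" "real i / real K \<le> U x" "U x \<le> (real i + 1) / real K" using bins by blast
  have "a \<le> real i / real K" using i K by (simp add: field_simps)
  moreover have "(real i + 1) / real K \<le> (a * real K + 2) / real K"
    using i by (intro divide_right_mono) auto
  then have "(real i + 1) / real K \<le> a + 2 / real K" using K by (simp add: add_divide_distrib)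
  ultimately show "\<exists>x\<in>S. a \<le> U x \<and> U x \<le> a + 2 / real K" using x by (intro bexI[of _ x]) auto
qed

lemma prob_not_good_sample:
  assumes K: "0 < K"
    and bins: "\<And>i. i < K \<Longrightarrow> real n / (2 * real K) \<le> real (card {x \<in> {1..n}. real i / real K \<le> U x \<and> U x \<le> (real i + 1) / real K})"
    and left: "real n / 8 \<le> real (card {x \<in> {1..n}. U x \<le> 1/4})"
    and right: "real n / 8 \<le> real (card {x \<in> {1..n}. 3/4 \<le> U x})"
    and tail: "real (card {x \<in> {1..n}. U x < 2 / real K + \<eta>}) \<le> \<beta> * real n" "0 \<le> \<beta>"
    and k: "\<zeta> \<le> real k" "real k < \<zeta> + 1" "k \<le> m"
  shows "prob {S \<in> space N. \<not> good_sample n m \<zeta> (2 / real K) \<eta> U S} \<le> sample_defect K k \<beta>"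
proof -
  define bin where "bin = (\<lambda>i::nat. {x \<in> {1..n}. real i / real K \<le> U x \<and> U x \<le> (real i + 1) / real K})"
  define L where "L = {x \<in> {1..n}. U x \<le> 1/4}"
  define R where "R = {x \<in> {1..n}. 3/4 \<le> U x}"
  define E where "E = {x \<in> {1..n}. U x < 2 / real K + \<eta>}"
  define F1 where "F1 = (\<Union>i\<in>{..<K}. {S \<in> space N. S \<inter> bin i = {}})"
  define F2 where "F2 = {S \<in> space N. real (card (S \<inter> L)) < \<zeta>}"
  define F3 where "F3 = {S \<in> space N. real (card (S \<inter> R)) < \<zeta>}"
  define F4 where "F4 = {S \<in> space N. \<zeta> \<le> real (card (S \<inter> E))}"
  have sub: "{S \<in> space N. \<not> good_sample n m \<zeta> (2 / real K) \<eta> U S} \<subseteq> F1 \<union> F2 \<union> F3 \<union> F4"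
  proof
    fix S assume S: "S \<in> {S \<in> space N. \<not> good_sample n m \<zeta> (2 / real K) \<eta> U S}"
    show "S \<in> F1 \<union> F2 \<union> F3 \<union> F4"
    proof (rule ccontr)
      assume no: "S \<notin> F1 \<union> F2 \<union> F3 \<union> F4"
      have sN: "S \<subseteq> {1..n}" "card S = m" "S \<in> space N" using S by (auto simp: space_N)
      have "dense_points (2 / real K) S U"
      proof (rule dense_points_bins[OF K])
        fix i assume "i < K"
        then have "S \<inter> bin i \<noteq> {}" using no sN by (auto simp: F1_def)
        then show "\<exists>x\<in>S. real i / real K \<le> U x \<and> U x \<le> (real i + 1) / real K" by (auto simp: bin_def)
      qed
      moreover have "S \<inter> L = {x \<in> S. U x \<le> 1/4}" "S \<inter> R = {x \<in> S. 3/4 \<le> U x}" "S \<inter> E = {x \<in> S. U x < 2 / real K + \<eta>}"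
        using sN by (auto simp: L_def R_def E_def)
      then have "\<zeta> \<le> real (card {x \<in> S. U x \<le> 1/4})" "\<zeta> \<le> real (card {x \<in> S. 3/4 \<le> U x})"
         "real (card {x \<in> S. U x < 2 / real K + \<eta>}) < \<zeta>"
        using no sN by (auto simp: F2_def F3_def F4_def)
      ultimately show False using S sN by (auto simp: good_sample_def)
    qed
  qed
  have mem: "F1 \<in> sets N" "F2 \<in> sets N" "F3 \<in> sets N" "F4 \<in> sets N"
    by (auto intro!: mem_sets simp: F1_def F2_def F3_def F4_def)
  have p1: "prob F1 \<le> real K * (1 - 1 / (2 * real K)) ^ m"
  proof -
    have "prob F1 \<le> (\<Sum>i\<in>{..<K}. prob {S \<in> space N. S \<inter> bin i = {}})"
      unfolding F1_def by (intro finite_measure_subadditive_finite) (auto intro!: mem_sets)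
    also have "\<dots> \<le> (\<Sum>i\<in>{..<K}. (1 - 1 / (2 * real K)) ^ m)"
      using bins by (intro sum_mono prob_disjoint) (auto simp: bin_def)
    finally show ?thesis by simp
  qed
  have p2: "prob F2 \<le> real m ^ k * (7 / 8) ^ (m - k)"
    unfolding F2_def by (rule prob_inter_less) (use left k in \<open>auto simp: L_def\<close>)
  have p3: "prob F3 \<le> real m ^ k * (7 / 8) ^ (m - k)"
    unfolding F3_def by (rule prob_inter_less) (use right k in \<open>auto simp: R_def\<close>)
  have p4: "prob F4 \<le> (real m * \<beta>) ^ k / fact k"
    unfolding F4_def by (rule prob_inter_large) (use tail k in \<open>auto simp: E_def\<close>)
  have "prob {S \<in> space N. \<not> good_sample n m \<zeta> (2 / real K) \<eta> U S} \<le> prob (F1 \<union> F2 \<union> F3 \<union> F4)"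
    using mem by (intro finite_measure_mono sub) auto
  also have "\<dots> \<le> prob F1 + prob F2 + prob F3 + prob F4"
    using mem by (intro order_trans[OF measure_Un_le] add_right_mono sets.Un) auto
  also have "\<dots> \<le> sample_defect K k \<beta>" using p1 p2 p3 p4 by (simp add: sample_defect_def)
  finally show ?thesis .
qed

text \<open>The pair \<open>u\<close>, \<open>v\<close> may itself be uncertain, but a cherry has a
  second uncertain pair, one with a vertex outside \<open>u\<close>, \<open>v\<close>. Its other
  vertex is \<open>u\<close> or \<open>v\<close>, which gives at most \<open>2 * R\<close> choices
  of three prescribed vertices, or is not, which gives at most \<open>n * R\<close> choices of four.
  Relative to \<open>p 2\<close> both contributions are small.\<close>

lemma prob_pair_cherry:
  assumes sym: "\<And>x y. unc x y \<Longrightarrow> unc y x" and irr: "\<And>x. \<not> unc x x"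
    and R: "\<And>x. x \<in> {1..n} \<Longrightarrow> real (card {y \<in> {1..n}. unc x y}) \<le> R"
    and uv: "u \<in> {1..n}" "v \<in> {1..n}" "u \<noteq> v"
  shows "prob {S \<in> space N. u \<in> S \<and> v \<in> S \<and> (\<exists>a\<in>S. \<exists>b\<in>S. \<exists>b'\<in>S. b \<noteq> b' \<and> unc a b \<and> unc a b')}
     \<le> p 2 * (2 * R * (real m / real n) + R * (real m)\<^sup>2 / real n)"
proof -
  define X where "X = (\<lambda>y. {x \<in> {1..n}. unc y x} - {u, v})"
  have cX: "real (card (X y)) \<le> R" if "y \<in> {1..n}" for y
  proof -
    have "card (X y) \<le> card {x \<in> {1..n}. unc y x}" by (intro card_mono) (auto simp: X_def)
    then show ?thesis using R[OF that] by simp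
  qed
  have R0: "0 \<le> R" using R[OF uv(1)] by linarith
  have finX: "finite (X y)" for y by (simp add: X_def)
  define E where "E = (\<lambda>T. {S \<in> space N. T \<subseteq> S})"
  have memE: "E T \<in> sets N" for T by (auto intro!: mem_sets simp: E_def)
  define A where "A = (\<Union>y\<in>{u, v}. \<Union>x\<in>X y. E {u, v, x})"
  define B where "B = (\<Union>x\<in>{1..n} - {u, v}. \<Union>y\<in>X x. E {u, v, x, y})"
  have mem: "A \<in> sets N" "B \<in> sets N" unfolding A_def B_def using finX memE by auto
  have sub: "{S \<in> space N. u \<in> S \<and> v \<in> S \<and> (\<exists>a\<in>S. \<exists>b\<in>S. \<exists>b'\<in>S. b \<noteq> b' \<and> unc a b \<and> unc a b')} \<subseteq> A \<union> B"
  proof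
    fix S assume S: "S \<in> {S \<in> space N. u \<in> S \<and> v \<in> S \<and> (\<exists>a\<in>S. \<exists>b\<in>S. \<exists>b'\<in>S. b \<noteq> b' \<and> unc a b \<and> unc a b')}"
    then obtain a b b' where abb: "a \<in> S" "b \<in> S" "b' \<in> S" "b \<noteq> b'" "unc a b" "unc a b'" by blast
    have "a \<noteq> b" "a \<noteq> b'" using abb irr by auto
    then have "\<exists>x\<in>S - {u, v}. \<exists>y\<in>S. unc x y"
      using abb sym[OF abb(5)] sym[OF abb(6)] by (cases "a \<in> {u, v}"; cases "b \<in> {u, v}") blast+
    then obtain x y where xy: "x \<in> S" "x \<notin> {u, v}" "y \<in> S" "unc x y" by blast
    have SV: "S \<subseteq> {1..n}" using S by (auto simp: space_N)
    show "S \<in> A \<union> B"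
    proof (cases "y \<in> {u, v}")
      case True
      have "x \<in> X y" using xy SV sym[OF xy(4)] by (auto simp: X_def)
      moreover have "S \<in> E {u, v, x}" using S xy by (auto simp: E_def)
      ultimately have "S \<in> A" using True unfolding A_def by blast
      then show ?thesis by blast
    next
      case False
      have "y \<in> X x" using xy SV False by (auto simp: X_def)
      moreover have "S \<in> E {u, v, x, y}" using S xy by (auto simp: E_def)
      ultimately have "S \<in> B" using xy SV unfolding B_def by blast
      then show ?thesis by blast
    qed
  qed
  have pA: "prob A \<le> 2 * R * p 3"
  proof -
    have "prob A \<le> (\<Sum>y\<in>{u, v}. prob (\<Union>x\<in>X y. E {u, v, x}))"
      unfolding A_def using finX memE by (intro finite_measure_subadditive_finite) auto
    also have "\<dots> \<le> (\<Sum>y\<in>{u, v}. R * p 3)"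
    proof (rule sum_mono)
      fix y assume "y \<in> {u, v}"
      then have y: "y \<in> {1..n}" using uv by auto
      have "prob (\<Union>x\<in>X y. E {u, v, x}) \<le> (\<Sum>x\<in>X y. prob (E {u, v, x}))"
        using finX memE by (intro finite_measure_subadditive_finite) auto
      also have "\<dots> = (\<Sum>x\<in>X y. p 3)"
        unfolding E_def using uv m4 by (intro sum.cong refl prob_superset) (auto simp: X_def)
      also have "\<dots> \<le> R * p 3" using cX[OF y] by (simp add: mult_right_mono p_nonneg)
      finally show "prob (\<Union>x\<in>X y. E {u, v, x}) \<le> R * p 3" .
    qed
    finally show ?thesis using uv by simp
  qed
  have pB: "prob B \<le> real n * (R * p 4)"
  proof -
    have "prob B \<le> (\<Sum>x\<in>{1..n} - {u, v}. prob (\<Union>y\<in>X x. E {u, v, x, y}))"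
      unfolding B_def using finX memE by (intro finite_measure_subadditive_finite) auto
    also have "\<dots> \<le> (\<Sum>x\<in>{1..n} - {u, v}. R * p 4)"
    proof (rule sum_mono)
      fix x assume x: "x \<in> {1..n} - {u, v}"
      have "prob (\<Union>y\<in>X x. E {u, v, x, y}) \<le> (\<Sum>y\<in>X x. prob (E {u, v, x, y}))"
        using finX memE by (intro finite_measure_subadditive_finite) auto
      also have "\<dots> = (\<Sum>y\<in>X x. p 4)"
      proof (intro sum.cong refl)
        fix y assume y: "y \<in> X x"
        then have "x \<noteq> y" using irr by (auto simp: X_def)
        then show "prob (E {u, v, x, y}) = p 4"
          unfolding E_def using uv m4 x y by (intro prob_superset) (auto simp: X_def)
      qed
      also have "\<dots> \<le> R * p 4" using cX[of x] x by (simp add: mult_right_mono p_nonneg)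
      finally show "prob (\<Union>y\<in>X x. E {u, v, x, y}) \<le> R * p 4" .
    qed
    also have "\<dots> = real (card ({1..n} - {u, v})) * (R * p 4)" by simp
    also have "\<dots> \<le> real n * (R * p 4)"
    proof (intro mult_right_mono mult_nonneg_nonneg R0 p_nonneg)
      have "card ({1..n} - {u, v}) \<le> card {1..n}" by (intro card_mono) auto
      then show "real (card ({1..n} - {u, v})) \<le> real n" by simp
    qed
    finally show ?thesis .
  qed
  have n0: "0 < real n" using m4 mn by simp
  have "prob {S \<in> space N. u \<in> S \<and> v \<in> S \<and> (\<exists>a\<in>S. \<exists>b\<in>S. \<exists>b'\<in>S. b \<noteq> b' \<and> unc a b \<and> unc a b')} \<le> prob (A \<union> B)"
    using mem by (intro finite_measure_mono sub) auto
  also have "\<dots> \<le> prob A + prob B" using mem by (intro measure_Un_le) auto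
  also have "\<dots> \<le> 2 * R * p 3 + real n * (R * p 4)" using pA pB by simp
  also have "\<dots> \<le> 2 * R * (p 2 * (real m / real n)) + real n * (R * (p 2 * (real m / real n)\<^sup>2))"
    using R0 by (intro add_mono mult_left_mono p3_le p4_le) auto
  also have "\<dots> = p 2 * (2 * R * (real m / real n) + R * (real m)\<^sup>2 / real n)"
    using n0 by (simp add: field_simps power2_eq_square)
  finally show ?thesis .
qed

end

text \<open>A sample containing the pair fails only if it is bad or has a cherry. Of
  \<open>p 2\<close> the cherries take at most a quarter and bad samples at most a quarter of
  \<open>1 / n^2\<close>, which leaves half of the latter.\<close>

lemma (in embedded_graph) prob_pair_success:
  fixes n m :: nat
  assumes nm: "samples n m" and V: "V = {1..n}" and \<eta>\<^sub>0: "0 < \<eta>\<^sub>0" "3 * \<eta>\<^sub>0 \<le> d" "\<eta>\<^sub>0 \<le> 1"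
    and R: "\<And>x. x \<in> {1..n} \<Longrightarrow> real (card {y \<in> {1..n}. uncertain x y}) \<le> R"
    and uv: "u \<in> {1..n}" "v \<in> {1..n}" "u \<noteq> v"
    and small: "2 * R * (real m / real n) + R * (real m)\<^sup>2 / real n \<le> 1/4"
    and good: "measure (sample_space n m) {S \<in> space (sample_space n m). \<not> good_sample n m \<zeta> \<eta>\<^sub>0 \<eta> U S} \<le> 1 / (4 * (real n)\<^sup>2)"
  shows "1 / (2 * (real n)\<^sup>2) \<le> measure (sample_space n m)
      {S \<in> space (sample_space n m). u \<in> S \<and> v \<in> S \<and> connected_graph H S \<and> unit_interval_graph H S}"
proof -
  interpret samples n m by fact
  define Z where "Z = {S \<in> space N. u \<in> S \<and> v \<in> S \<and> connected_graph H S \<and> unit_interval_graph H S}"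
  define B1 where "B1 = {S \<in> space N. \<not> good_sample n m \<zeta> \<eta>\<^sub>0 \<eta> U S}"
  define B2 where "B2 = {S \<in> space N. u \<in> S \<and> v \<in> S \<and>
      (\<exists>a\<in>S. \<exists>b\<in>S. \<exists>b'\<in>S. b \<noteq> b' \<and> uncertain a b \<and> uncertain a b')}"
  have mem: "Z \<in> sets N" "B1 \<in> sets N" "B2 \<in> sets N"
    by (auto intro!: mem_sets simp: Z_def B1_def B2_def)
  have sub: "{S \<in> space N. {u, v} \<subseteq> S} \<subseteq> Z \<union> B1 \<union> B2"
  proof
    fix S assume S: "S \<in> {S \<in> space N. {u, v} \<subseteq> S}"
    then have SV: "S \<subseteq> V" "finite S" by (auto simp: space_N V intro: finite_subset)
    show "S \<in> Z \<union> B1 \<union> B2"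
    proof (rule ccontr)
      assume no: "S \<notin> Z \<union> B1 \<union> B2"
      then have "dense_points \<eta>\<^sub>0 S U" using S by (auto simp: B1_def good_sample_def)
      then have "connected_graph H S" using \<eta>\<^sub>0 by (intro connected_dense[OF SV]) auto
      moreover have "unit_interval_graph H S"
        using no S by (intro unit_interval_if_no_cherry[OF SV]) (auto simp: B2_def)
      ultimately show False using no S by (auto simp: Z_def)
    qed
  qed
  have "p 2 = prob {S \<in> space N. {u, v} \<subseteq> S}"
    using uv m4 by (intro prob_superset[symmetric]) auto
  also have "\<dots> \<le> prob (Z \<union> B1 \<union> B2)" using mem by (intro finite_measure_mono sub) auto
  also have "\<dots> \<le> prob Z + prob B1 + prob B2"
    using mem by (intro order_trans[OF measure_Un_le] add_right_mono measure_Un_le) auto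
  also have "prob B2 \<le> p 2 * (2 * R * (real m / real n) + R * (real m)\<^sup>2 / real n)"
    unfolding B2_def by (rule prob_pair_cherry[OF _ _ R uv]) (auto simp: uncertain_def q_sym)
  also have "\<dots> \<le> p 2 * (1/4)" by (intro mult_left_mono small p_nonneg)
  finally have "3/4 * p 2 \<le> prob Z + prob B1" by simp
  moreover have "prob B1 \<le> 1/4 * (1 / (real n)\<^sup>2)" using good by (simp add: B1_def N_def)
  ultimately have "1/2 * (1 / (real n)\<^sup>2) \<le> prob Z" using p2_ge by linarith
  then show ?thesis by (simp add: Z_def N_def)
qed

section \<open>Concentration for the vertex and edge variables\<close>

lemma card_filter_sum:
  "finite A \<Longrightarrow> real (card {x \<in> A. P x}) = (\<Sum>x\<in>A. if P x then 1 else 0)"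
  by (simp add: sum.inter_filter[symmetric])

text \<open>Fubini in place of conditional probabilities: exceptional first coordinates are charged
  to \<open>\<beta>\<close>, all other slices to \<open>\<delta>\<close>. It is applied to freeze
  two vertex variables, then all vertex variables, then the edge variables.\<close>

lemma pair_slice_bound:
  assumes M1: "prob_space M1" and M2: "prob_space M2" and A: "A \<in> sets (M1 \<Otimes>\<^sub>M M2)"
    and B: "B \<in> sets M1" "emeasure M1 B \<le> \<beta>"
    and slice: "\<And>x. x \<in> space M1 \<Longrightarrow> x \<notin> B \<Longrightarrow> emeasure M2 (Pair x -` A) \<le> \<delta>"
  shows "emeasure (M1 \<Otimes>\<^sub>M M2) A \<le> \<beta> + \<delta>"
proof -
  interpret M1: prob_space M1 by fact
  interpret M2: prob_space M2 by fact
  have "emeasure (M1 \<Otimes>\<^sub>M M2) A = (\<integral>\<^sup>+x. emeasure M2 (Pair x -` A) \<partial>M1)"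
    by (rule M2.emeasure_pair_measure_alt[OF A])
  also have "\<dots> \<le> (\<integral>\<^sup>+x. indicator B x + \<delta> \<partial>M1)"
  proof (rule nn_integral_mono)
    fix x assume "x \<in> space M1"
    then show "emeasure M2 (Pair x -` A) \<le> indicator B x + \<delta>"
      using slice[of x] M2.emeasure_le_1[of "Pair x -` A"] by (cases "x \<in> B") (auto intro: add_increasing2)
  qed
  also have "\<dots> = emeasure M1 B + \<delta>"
    using B by (simp add: nn_integral_add M1.emeasure_space_1)
  also have "\<dots> \<le> \<beta> + \<delta>" using B by (intro add_right_mono)
  finally show ?thesis .
qed

lemma indep_vars_PiM_coordinates:
  assumes "\<And>i. i \<in> I \<Longrightarrow> prob_space (M i)" "I \<noteq> {}"
  shows "prob_space.indep_vars (PiM I M) M (\<lambda>i \<omega>. \<omega> i) I"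
proof -
  interpret prob_space "PiM I M" by (rule prob_space_PiM[OF assms(1)])
  have "distr (PiM I M) (PiM I M) (\<lambda>x. \<lambda>i\<in>I. x i) = distr (PiM I M) (PiM I M) (\<lambda>x. x)"
    by (intro distr_cong) (auto simp: space_PiM PiE_def extensional_def restrict_def fun_eq_iff)
  also have "\<dots> = PiM I M" by simp
  also have "\<dots> = PiM I (\<lambda>i. distr (PiM I M) (M i) (\<lambda>\<omega>. \<omega> i))"
    by (intro PiM_cong refl distr_PiM_component[symmetric] assms(1))
  finally show ?thesis
    by (subst indep_vars_iff_distr_eq_PiM'[OF assms(2)]) auto
qed

text \<open>The summands live on disjoint blocks of coordinates, since a common neighbour depends on
  two edge variables. The parameter \<open>N\<close> only bounds the number of summands, so that all
  applications share the exponent with \<open>n\<close>.\<close>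

lemma hoeffding_PiM:
  fixes Y :: "'j \<Rightarrow> ('i \<Rightarrow> 'a) \<Rightarrow> real" and N :: real
  assumes M: "\<And>i. i \<in> I \<Longrightarrow> prob_space (M i)" "I \<noteq> {}"
    and L: "finite L" "real (card L) \<le> N" and \<epsilon>: "0 < \<epsilon>"
    and K: "\<And>j. j \<in> L \<Longrightarrow> K j \<subseteq> I" "disjoint_family_on K L"
    and Y: "\<And>j. j \<in> L \<Longrightarrow> Y j \<in> borel_measurable (PiM (K j) M)"
    and Y01: "\<And>j \<omega>. j \<in> L \<Longrightarrow> \<omega> \<in> space (PiM I M) \<Longrightarrow> Y j (restrict \<omega> (K j)) \<in> {0..1}"
    and e: "\<And>j. j \<in> L \<Longrightarrow> (\<integral>\<omega>. Y j (restrict \<omega> (K j)) \<partial>PiM I M) = m j"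
  shows "measure (PiM I M) {\<omega> \<in> space (PiM I M). \<epsilon> \<le> \<bar>(\<Sum>j\<in>L. Y j (restrict \<omega> (K j))) - (\<Sum>j\<in>L. m j)\<bar>}
           \<le> 2 * exp (- 2 * \<epsilon>\<^sup>2 / N)"
proof (cases "L = {}")
  case True
  then show ?thesis using \<epsilon> by simp
next
  case False
  interpret prob_space "PiM I M" by (rule prob_space_PiM[OF M(1)])
  define X where "X = (\<lambda>j \<omega>. Y j (restrict \<omega> (K j)))"
  have "indep_vars M (\<lambda>i \<omega>. \<omega> i) I" by (rule indep_vars_PiM_coordinates[OF M])
  then have "indep_vars (\<lambda>j. PiM (K j) M) (\<lambda>j \<omega>. restrict (\<lambda>i. \<omega> i) (K j)) L"
    by (rule indep_vars_restrict[OF _ K])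
  then have ind: "indep_vars (\<lambda>_. borel) X L"
    unfolding X_def by (rule indep_vars_compose2[where Y=Y]) (use Y in auto)
  interpret H: Hoeffding_ineq "PiM I M" L X "\<lambda>_. 0" "\<lambda>_. 1" "\<Sum>j\<in>L. m j"
    by unfold_locales (use L ind Y01 e in \<open>auto simp: X_def cong: sum.cong\<close>)
  have c: "(\<Sum>j\<in>L. ((1::real) - 0)\<^sup>2) = real (card L)" by simp
  have c0: "0 < card L" using False L by (simp add: card_gt_0_iff)
  have "prob {x \<in> space (PiM I M). \<epsilon> \<le> \<bar>(\<Sum>j\<in>L. X j x) - (\<Sum>j\<in>L. m j)\<bar>} \<le> 2 * exp (- 2 * \<epsilon>\<^sup>2 / real (card L))"
    using H.Hoeffding_ineq_abs_ge[of \<epsilon>] \<epsilon> c0 by (simp add: c)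
  also have "\<dots> \<le> 2 * exp (- 2 * \<epsilon>\<^sup>2 / N)"
    using L c0 by (auto simp: divide_left_mono intro!: divide_left_mono)
  finally show ?thesis by (simp add: X_def)
qed

lemma prob_space_unif01: "prob_space unif01"
  unfolding unif01_def by (rule prob_space_restrict_space) auto

lemma integral_unif01:
  fixes h :: "real \<Rightarrow> real"
  assumes "h \<in> borel_measurable borel" "\<And>z. \<bar>h z\<bar> \<le> B"
  shows "(\<integral>z. h z \<partial>unif01) = integral {0..1} h"
proof -
  have "(\<integral>z. h z \<partial>unif01) = (LINT z:{0..1}|lborel. h z)"
    unfolding unif01_def set_lebesgue_integral_def by (rule Bochner_Integration.integral_restrict_space) simp
  also have "\<dots> = integral {0..1} h"
  proof (rule set_borel_integral_eq_integral)
    show "set_integrable lborel {0..1} h" by (rule set_integrable_bounded_borel[OF assms])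
  qed
  finally show ?thesis .
qed

lemma measure_unif01_Icc:
  assumes "0 \<le> a" "a \<le> b" "b \<le> 1"
  shows "measure unif01 {a..b} = b - a"
  unfolding unif01_def using assms by (subst measure_restrict_space) auto

lemma measure_unif01_less:
  assumes "0 \<le> a" "a \<le> 1"
  shows "measure unif01 ({..<a} \<inter> {0..1}) = a"
proof -
  have "{..<a} \<inter> {0..1} = {0..<a}" using assms by auto
  then show ?thesis unfolding unif01_def using assms by (subst measure_restrict_space) auto
qed

lemma measurable_unif01_borel: "h \<in> borel_measurable borel \<Longrightarrow> h \<in> borel_measurable unif01"
  by (rule measurable_compose[OF measurable_ident_unif01])

lemma integral_PiM_unif01_component:
  assumes "j \<in> I" "h \<in> borel_measurable borel"
  shows "(\<integral>\<omega>. h (\<omega> j) \<partial>(\<Pi>\<^sub>M i\<in>I. unif01)) = (\<integral>z. h z \<partial>unif01 :: real)"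
proof -
  have "(\<integral>z. h z \<partial>distr (\<Pi>\<^sub>M i\<in>I. unif01) unif01 (\<lambda>\<omega>. \<omega> j)) = (\<integral>\<omega>. h (\<omega> j) \<partial>(\<Pi>\<^sub>M i\<in>I. unif01))"
    using assms by (intro integral_distr measurable_unif01_borel) auto
  also have "distr (\<Pi>\<^sub>M i\<in>I. unif01) unif01 (\<lambda>\<omega>. \<omega> j) = unif01"
    using assms by (intro distr_PiM_component prob_space_unif01)
  finally show ?thesis by simp
qed

lemma interval_count_concentration:
  assumes n: "0 < n" and \<epsilon>: "0 < \<epsilon>" and ab: "0 \<le> a" "a \<le> b" "b \<le> 1"
  shows "measure (\<Pi>\<^sub>M i\<in>{1..n}. unif01)
     {U \<in> space (\<Pi>\<^sub>M i\<in>{1..n}. unif01). \<epsilon> \<le> \<bar>real (card {x \<in> {1..n}. a \<le> U x \<and> U x \<le> b}) - real n * (b - a)\<bar>}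
     \<le> 2 * exp (- 2 * \<epsilon>\<^sup>2 / real n)"
proof -
  define Y where "Y = (\<lambda>(j::nat) \<omega>. indicator {a..b} (\<omega> j) :: real)"
  have ind: "(indicator {a..b} :: real \<Rightarrow> real) \<in> borel_measurable borel" by measurable
  have card: "(\<Sum>j\<in>{1..n}. Y j (restrict U {j})) = real (card {x \<in> {1..n}. a \<le> U x \<and> U x \<le> b})" for U
  proof -
    have "real (card {x \<in> {1..n}. a \<le> U x \<and> U x \<le> b}) = (\<Sum>x\<in>{1..n}. if a \<le> U x \<and> U x \<le> b then 1 else 0)"
      by (rule card_filter_sum) simp
    also have "\<dots> = (\<Sum>j\<in>{1..n}. Y j (restrict U {j}))"
      by (intro sum.cong) (auto simp: Y_def indicator_def)
    finally show ?thesis by simp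
  qed
  have e: "(\<integral>\<omega>. Y j (restrict \<omega> {j}) \<partial>(\<Pi>\<^sub>M i\<in>{1..n}. unif01)) = b - a" if "j \<in> {1..n}" for j
  proof -
    have "(\<integral>\<omega>. Y j (restrict \<omega> {j}) \<partial>(\<Pi>\<^sub>M i\<in>{1..n}. unif01)) = (\<integral>z. indicator {a..b} z \<partial>unif01)"
      using integral_PiM_unif01_component[OF that ind] by (simp add: Y_def)
    also have "\<dots> = measure unif01 ({a..b} \<inter> space unif01)"
      by (rule Bochner_Integration.integral_indicator)
    also have "{a..b} \<inter> space unif01 = {a..b}" using ab by auto
    finally show ?thesis by (simp only: measure_unif01_Icc[OF ab])
  qed
  have "measure (\<Pi>\<^sub>M i\<in>{1..n}. unif01) {U \<in> space (\<Pi>\<^sub>M i\<in>{1..n}. unif01).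
      \<epsilon> \<le> \<bar>(\<Sum>j\<in>{1..n}. Y j (restrict U {j})) - (\<Sum>j\<in>{1..n}. b - a)\<bar>} \<le> 2 * exp (- 2 * \<epsilon>\<^sup>2 / real n)"
  proof (rule hoeffding_PiM)
    show "Y j \<in> borel_measurable (\<Pi>\<^sub>M i\<in>{j}. unif01)" for j
      unfolding Y_def by (rule measurable_compose[OF measurable_component_unif01 ind]) simp
  qed (use n \<epsilon> e in \<open>auto simp: prob_space_unif01 disjoint_family_on_def Y_def indicator_def\<close>)
  then show ?thesis unfolding card by simp
qed

section \<open>Codegrees averaged over the edge variables\<close>

context link_profile
begin

lemma sq_eq_unif01: "sq x y = (\<integral>z. \<phi> (z - x) * \<phi> (z - y) \<partial>unif01)"
  unfolding sq_def by (rule integral_unif01[symmetric, where B=1]) (auto simp: phi_mult_abs_le)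

lemma sq_measurable [measurable]: "(\<lambda>(x, y). sq x y) \<in> borel_measurable (borel \<Otimes>\<^sub>M borel)"
proof -
  interpret prob_space unif01 by (rule prob_space_unif01)
  have z: "(\<lambda>p. snd p) \<in> ((borel :: real measure) \<Otimes>\<^sub>M (borel :: real measure)) \<Otimes>\<^sub>M unif01 \<rightarrow>\<^sub>M borel"
    by (rule measurable_compose[OF measurable_snd measurable_ident_unif01])
  have "(\<lambda>p. \<phi> (snd p - fst (fst p)) * \<phi> (snd p - snd (fst p))) \<in> borel_measurable ((borel \<Otimes>\<^sub>M borel) \<Otimes>\<^sub>M unif01)"
    by (intro borel_measurable_times measurable_compose[OF _ phi_measurable] borel_measurable_diff z) measurable
  then have "(\<lambda>p. \<integral>z. \<phi> (z - fst p) * \<phi> (z - snd p) \<partial>unif01) \<in> borel_measurable (borel \<Otimes>\<^sub>M borel)"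
    by (intro borel_measurable_lebesgue_integral) (simp add: case_prod_beta)
  then show ?thesis by (simp add: sq_eq_unif01 case_prod_beta)
qed

text \<open>The expected number of common neighbours of \<open>u\<close> and \<open>v\<close> when
  all positions are fixed.\<close>

definition mean_codegree :: "nat \<Rightarrow> (nat \<Rightarrow> real) \<Rightarrow> nat \<Rightarrow> nat \<Rightarrow> real" where
  "mean_codegree n U u v = (\<Sum>x\<in>{1..n} - {u, v}. \<phi> (U x - U u) * \<phi> (U x - U v))"

lemma mean_codegree_measurable:
  assumes "u \<in> {1..n}" "v \<in> {1..n}"
  shows "(\<lambda>U. mean_codegree n U u v - (real n - 2) * sq (U u) (U v)) \<in> borel_measurable (\<Pi>\<^sub>M i\<in>{1..n}. unif01)"
proof -
  have c: "(\<lambda>U. U i) \<in> borel_measurable (\<Pi>\<^sub>M i\<in>{1..n}. unif01)" if "i \<in> {1..n}" for i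
    by (rule measurable_component_unif01[OF that])
  have "(\<lambda>U. (\<lambda>(x, y). sq x y) (U u, U v)) \<in> borel_measurable (\<Pi>\<^sub>M i\<in>{1..n}. unif01)"
    by (rule measurable_compose[OF measurable_Pair[OF c[OF assms(1)] c[OF assms(2)]] sq_measurable])
  then have 1: "(\<lambda>U. sq (U u) (U v)) \<in> borel_measurable (\<Pi>\<^sub>M i\<in>{1..n}. unif01)" by simp
  have 2: "(\<lambda>U. mean_codegree n U u v) \<in> borel_measurable (\<Pi>\<^sub>M i\<in>{1..n}. unif01)"
    unfolding mean_codegree_def using assms
    by (intro borel_measurable_sum borel_measurable_times measurable_compose[OF _ phi_measurable] borel_measurable_diff c) auto
  show ?thesis by (intro borel_measurable_diff borel_measurable_times 1 2 borel_measurable_const)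
qed

text \<open>The summands share the positions of \<open>u\<close> and \<open>v\<close> and are not
  independent. With these two coordinates frozen the others are independent, and each summand has
  mean \<open>sq (y u) (y v)\<close>.\<close>

lemma mean_codegree_concentration:
  assumes n: "3 \<le> n" and uv: "u \<in> {1..n}" "v \<in> {1..n}" "u \<noteq> v" and \<epsilon>: "0 < \<epsilon>"
  shows "measure (\<Pi>\<^sub>M i\<in>{1..n}. unif01) {U \<in> space (\<Pi>\<^sub>M i\<in>{1..n}. unif01).
      \<epsilon> \<le> \<bar>mean_codegree n U u v - (real n - 2) * sq (U u) (U v)\<bar>} \<le> 2 * exp (- 2 * \<epsilon>\<^sup>2 / real n)"
proof -
  let ?P = "\<lambda>I. \<Pi>\<^sub>M i\<in>I. unif01" 
  define I where "I = {u, v}"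
  define J where "J = {1..n} - {u, v}"
  have IJ: "I \<inter> J = {}" "finite I" "finite J" "I \<union> J = {1..n}" using uv by (auto simp: I_def J_def)
  have cJ: "card J = n - 2" using uv by (simp add: J_def card_Diff_subset)
  have J0: "J \<noteq> {}"
  proof
    assume "J = {}"
    then show False using cJ n by simp
  qed
  interpret product_prob_space "\<lambda>_::nat. unif01" UNIV
    by (intro product_prob_spaceI prob_space_unif01)
  define B where "B = {U \<in> space (?P {1..n}). \<epsilon> \<le> \<bar>mean_codegree n U u v - (real n - 2) * sq (U u) (U v)\<bar>}"
  have B: "B \<in> sets (?P {1..n})"
    unfolding B_def
    by (intro borel_measurable_le borel_measurable_const borel_measurable_abs mean_codegree_measurable uv)
  have m: "merge I J \<in> ?P I \<Otimes>\<^sub>M ?P J \<rightarrow>\<^sub>M ?P (I \<union> J)" by (rule measurable_merge)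
  define A where "A = merge I J -` B \<inter> space (?P I \<Otimes>\<^sub>M ?P J)"
  have A: "A \<in> sets (?P I \<Otimes>\<^sub>M ?P J)" unfolding A_def using m B IJ by (intro measurable_sets) auto
  have "emeasure (?P {1..n}) B = emeasure (distr (?P I \<Otimes>\<^sub>M ?P J) (?P (I \<union> J)) (merge I J)) B"
    using distr_merge[OF IJ(1-3)] IJ(4) by simp
  also have "\<dots> = emeasure (?P I \<Otimes>\<^sub>M ?P J) A"
    unfolding A_def using m B IJ by (intro emeasure_distr) auto
  also have "\<dots> \<le> 0 + ennreal (2 * exp (- 2 * \<epsilon>\<^sup>2 / real n))"
  proof (rule pair_slice_bound[where B="{}"])
    show "prob_space (?P I)" "prob_space (?P J)" by (intro prob_space_PiM prob_space_unif01)+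
    show "A \<in> sets (?P I \<Otimes>\<^sub>M ?P J)" by (rule A)
    fix y assume y: "y \<in> space (?P I)"
    interpret PJ: prob_space "?P J" by (intro prob_space_PiM prob_space_unif01)
    define g where "g = (\<lambda>z. \<phi> (z - y u) * \<phi> (z - y v))"
    have g: "g \<in> borel_measurable borel" unfolding g_def by measurable
    define F where "F = {z \<in> space (?P J). \<epsilon> \<le> \<bar>(\<Sum>j\<in>J. g (restrict z {j} j)) - (\<Sum>j\<in>J. sq (y u) (y v))\<bar>}"
    have mF: "F \<in> sets (?P J)"
      unfolding F_def
      by (intro borel_measurable_le borel_measurable_const borel_measurable_abs borel_measurable_diff
          borel_measurable_sum)
         (auto intro!: measurable_compose[OF measurable_component_unif01 g])
    have "measure (?P J) F \<le> 2 * exp (- 2 * \<epsilon>\<^sup>2 / real n)"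
      unfolding F_def
    proof (rule hoeffding_PiM[where Y="\<lambda>j \<omega>. g (\<omega> j)" and K="\<lambda>j. {j}"])
      show "(\<lambda>\<omega>. g (\<omega> j)) \<in> borel_measurable (?P {j})" for j
        by (rule measurable_compose[OF measurable_component_unif01 g]) simp
      show "(\<integral>\<omega>. g (restrict \<omega> {j} j) \<partial>?P J) = sq (y u) (y v)" if "j \<in> J" for j
        using integral_PiM_unif01_component[OF that g] by (simp add: sq_eq_unif01 g_def)
      show "g (restrict \<omega> {j} j) \<in> {0..1}" for j and \<omega> :: "nat \<Rightarrow> real"
        using nonneg le1 by (auto simp: g_def intro!: mult_le_one)
    qed (use IJ J0 cJ \<epsilon> in \<open>auto simp: prob_space_unif01 disjoint_family_on_def\<close>)
    then have le: "emeasure (?P J) F \<le> ennreal (2 * exp (- 2 * \<epsilon>\<^sup>2 / real n))"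
      by (simp add: PJ.emeasure_eq_measure ennreal_leI)
    have "Pair y -` A \<subseteq> F"
    proof
      fix z assume "z \<in> Pair y -` A"
      then have z: "z \<in> space (?P J)" "merge I J (y, z) \<in> B" using y by (auto simp: A_def space_pair_measure)
      have "merge I J (y, z) u = y u" "merge I J (y, z) v = y v" "\<And>x. x \<in> J \<Longrightarrow> merge I J (y, z) x = z x"
        using IJ by (auto simp: merge_def I_def J_def)
      then have "mean_codegree n (merge I J (y, z)) u v = (\<Sum>j\<in>J. g (z j))"
        unfolding mean_codegree_def g_def J_def[symmetric] by (intro sum.cong) auto
      moreover have "real (card J) = real n - 2"
        using cJ n by (simp add: of_nat_diff)
      ultimately show "z \<in> F"
        using z \<open>merge I J (y, z) u = y u\<close> \<open>merge I J (y, z) v = y v\<close> by (simp add: F_def B_def)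
    qed
    then show "emeasure (?P J) (Pair y -` A) \<le> ennreal (2 * exp (- 2 * \<epsilon>\<^sup>2 / real n))"
      using le mF by (meson emeasure_mono order_trans)
  qed auto
  finally have "emeasure (?P {1..n}) B \<le> ennreal (2 * exp (- 2 * \<epsilon>\<^sup>2 / real n))" by simp
  then show ?thesis
    unfolding B_def[symmetric] measure_def by (intro enn2real_leI) auto
qed

end

section \<open>Codegrees for fixed positions\<close>

definition slot :: "nat \<Rightarrow> nat \<Rightarrow> nat \<times> nat" where
  "slot i j = (min i j, max i j)"

lemma slot_eq_iff: "slot i j = slot k l \<longleftrightarrow> i = k \<and> j = l \<or> i = l \<and> j = k"
  by (auto simp: slot_def min_def max_def)

text \<open>For fixed positions the pairs of edge variables at different \<open>x\<close> are
  disjoint, because \<open>x\<close> runs outside \<open>{u, v}\<close>. \<open>P\<close> and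
  \<open>Q\<close> stand for the edge probabilities to \<open>u\<close> and
  \<open>v\<close>.\<close>

lemma codegree_concentration:
  assumes n: "3 \<le> n" and uv: "u \<in> {1..n}" "v \<in> {1..n}" "u \<noteq> v" and \<epsilon>: "0 < \<epsilon>"
    and P: "\<And>x. x \<in> {1..n} \<Longrightarrow> P x \<in> {0..1}" and Q: "\<And>x. x \<in> {1..n} \<Longrightarrow> Q x \<in> {0..1::real}"
  shows "measure (\<Pi>\<^sub>M e\<in>edge_slots n. unif01) {W \<in> space (\<Pi>\<^sub>M e\<in>edge_slots n. unif01).
      \<epsilon> \<le> \<bar>real (card {x \<in> {1..n} - {u, v}. W (slot u x) < P x \<and> W (slot v x) < Q x})
            - (\<Sum>x\<in>{1..n} - {u, v}. P x * Q x)\<bar>} \<le> 2 * exp (- 2 * \<epsilon>\<^sup>2 / real n)"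
proof -
  let ?P = "\<Pi>\<^sub>M e\<in>edge_slots n. unif01"
  define L where "L = {1..n} - {u, v}"
  define K where "K = (\<lambda>x. {slot u x, slot v x})"
  have KE: "K x \<subseteq> edge_slots n" if "x \<in> L" for x
    using that uv edge_slot_mem[of u n x] edge_slot_mem[of v n x] by (auto simp: K_def L_def slot_def)
  define Y where "Y = (\<lambda>x W. indicator {..<P x} (W (slot u x)) * indicator {..<Q x} (W (slot v x)) :: real)"
  have card: "(\<Sum>x\<in>L. Y x (restrict W (K x))) = real (card {x \<in> L. W (slot u x) < P x \<and> W (slot v x) < Q x})" for W
  proof -
    have "real (card {x \<in> L. W (slot u x) < P x \<and> W (slot v x) < Q x}) =
        (\<Sum>x\<in>L. if W (slot u x) < P x \<and> W (slot v x) < Q x then 1 else 0)"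
      by (rule card_filter_sum) (simp add: L_def)
    also have "\<dots> = (\<Sum>x\<in>L. Y x (restrict W (K x)))"
      by (intro sum.cong) (auto simp: Y_def K_def indicator_def)
    finally show ?thesis by simp
  qed
  interpret PP: product_prob_space "\<lambda>_. unif01" "edge_slots n"
    by (intro product_prob_spaceI prob_space_unif01)
  have e: "(\<integral>W. Y x (restrict W (K x)) \<partial>?P) = P x * Q x" if x: "x \<in> L" for x
  proof -
    \<comment> \<open>The indicator of a common neighbour is that of a box in two coordinates, so
      its integral is a product of two lengths.\<close>
    define X where "X = (\<lambda>e. if e = slot u x then {..<P x} \<inter> {0..1} else {..<Q x} \<inter> {0..1::real})"
    have ne: "slot u x \<noteq> slot v x" using uv by (simp add: slot_eq_iff)
    define E where "E = {W \<in> space ?P. \<forall>e\<in>K x. W e \<in> X e}"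
    have XS: "X e \<in> sets unif01" for e
      unfolding X_def unif01_def by (auto simp: sets_restrict_space_iff)
    have "(\<integral>W. Y x (restrict W (K x)) \<partial>?P) = (\<integral>W. indicator E W \<partial>?P)"
    proof (intro Bochner_Integration.integral_cong refl)
      fix W assume W: "W \<in> space ?P"
      have "W (slot u x) \<in> {0..1}" "W (slot v x) \<in> {0..1}"
        using W KE[OF x] by (auto simp: space_PiM PiE_def Pi_def K_def)
      then show "Y x (restrict W (K x)) = indicator E W"
        using W ne by (auto simp: Y_def E_def K_def X_def indicator_def)
    qed
    also have "\<dots> = measure ?P (E \<inter> space ?P)" by (rule Bochner_Integration.integral_indicator)
    also have "E \<inter> space ?P = E" by (auto simp: E_def)
    also have "emeasure ?P E = (\<Prod>e\<in>K x. emeasure unif01 (X e))"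
      unfolding E_def by (rule PP.emeasure_PiM_Collect) (use KE[OF x] XS in \<open>auto simp: K_def\<close>)
    then have "measure ?P E = measure unif01 (X (slot u x)) * measure unif01 (X (slot v x))"
      using ne by (simp add: measure_def K_def enn2real_mult)
    also have "\<dots> = P x * Q x"
      using ne x P[of x] Q[of x] by (simp add: X_def measure_unif01_less L_def)
    finally show ?thesis .
  qed
  have "(1, 2) \<in> edge_slots n" using n by simp
  then have E0: "edge_slots n \<noteq> {}" by blast
  have cL: "real (card L) \<le> real n" using card_mono[of "{1..n}" L] by (simp add: L_def)
  have "measure ?P {W \<in> space ?P. \<epsilon> \<le> \<bar>(\<Sum>x\<in>L. Y x (restrict W (K x))) - (\<Sum>x\<in>L. P x * Q x)\<bar>} \<le> 2 * exp (- 2 * \<epsilon>\<^sup>2 / real n)"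
  proof (rule hoeffding_PiM)
    show "disjoint_family_on K L"
      using uv by (auto simp: disjoint_family_on_def K_def L_def slot_eq_iff)
    show "Y x \<in> borel_measurable (\<Pi>\<^sub>M e\<in>K x. unif01)" for x
      unfolding Y_def
      by (intro borel_measurable_times measurable_compose[OF measurable_component_unif01 borel_measurable_indicator])
         (auto simp: K_def)
    show "Y x (restrict W (K x)) \<in> {0..1}" for x W by (auto simp: Y_def indicator_def)
    show "real (card L) \<le> real n" by (rule cL)
    show "finite L" by (simp add: L_def)
    show "(\<integral>W. Y x (restrict W (K x)) \<partial>?P) = P x * Q x" if "x \<in> L" for x by (rule e[OF that])
  qed (use \<epsilon> KE E0 in \<open>auto simp: prob_space_unif01\<close>)
  then show ?thesis unfolding card by (simp add: L_def)
qed

section \<open>Typical vertex and edge variables\<close>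

locale interval_graphon =
  link_profile \<phi> c d + profile: square_profile sq \<alpha> d \<mu> \<kappa>
  for \<phi> :: "real \<Rightarrow> real" and c d \<alpha> \<mu> \<kappa> :: real
begin

abbreviation kernel :: "real \<Rightarrow> real \<Rightarrow> real" where
  "kernel x y \<equiv> \<phi> (x - y)"

text \<open>Counts are controlled only for intervals with endpoints in the grid of multiples of
  \<open>1 / n\<close>, a family small enough for a union bound. Rounding to the grid later costs 2
  vertices.\<close>

definition good_vertices :: "nat \<Rightarrow> real \<Rightarrow> (nat \<Rightarrow> real) \<Rightarrow> bool" where
  "good_vertices n \<epsilon> U \<longleftrightarrow>
     (\<forall>i\<in>{0..n}. \<forall>j\<in>{0..n}. i < j \<longrightarrow>
        \<bar>real (card {x \<in> {1..n}. real i / real n \<le> U x \<and> U x \<le> real j / real n}) -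
          real n * (real j / real n - real i / real n)\<bar> < \<epsilon>) \<and>
     (\<forall>u\<in>{1..n}. \<forall>v\<in>{1..n}. u \<noteq> v \<longrightarrow> \<bar>mean_codegree n U u v - (real n - 2) * sq (U u) (U v)\<bar> < \<epsilon>)"

definition good_edges :: "nat \<Rightarrow> real \<Rightarrow> (nat \<Rightarrow> real) \<Rightarrow> (nat \<times> nat \<Rightarrow> real) \<Rightarrow> bool" where
  "good_edges n \<epsilon> U W \<longleftrightarrow>
     (\<forall>u\<in>{1..n}. \<forall>v\<in>{1..n}. u \<noteq> v \<longrightarrow>
        \<bar>real (card {x \<in> {1..n} - {u, v}. W (slot u x) < \<phi> (U x - U u) \<and> W (slot v x) < \<phi> (U x - U v)})
          - mean_codegree n U u v\<bar> < \<epsilon>)"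

abbreviation vertex_space :: "nat \<Rightarrow> (nat \<Rightarrow> real) measure" where
  "vertex_space n \<equiv> \<Pi>\<^sub>M i\<in>{1..n}. unif01"

abbreviation edge_space :: "nat \<Rightarrow> (nat \<times> nat \<Rightarrow> real) measure" where
  "edge_space n \<equiv> \<Pi>\<^sub>M e\<in>edge_slots n. unif01"

lemma interval_count_measurable:
  "(\<lambda>U. real (card {x \<in> {1..n}. a \<le> U x \<and> U x \<le> b})) \<in> borel_measurable (vertex_space n)"
proof -
  have "(\<lambda>U. \<Sum>x\<in>{1..n}. indicator {a..b} (U x) :: real) \<in> borel_measurable (vertex_space n)"
    by (intro borel_measurable_sum measurable_compose[OF measurable_component_unif01 borel_measurable_indicator]) auto
  also have "(\<lambda>U. \<Sum>x\<in>{1..n}. indicator {a..b} (U x) :: real) = (\<lambda>U. real (card {x \<in> {1..n}. a \<le> U x \<and> U x \<le> b}))"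
  proof
    fix U :: "nat \<Rightarrow> real"
    have "real (card {x \<in> {1..n}. a \<le> U x \<and> U x \<le> b}) = (\<Sum>x\<in>{1..n}. if a \<le> U x \<and> U x \<le> b then 1 else 0)"
      by (rule card_filter_sum) simp
    also have "\<dots> = (\<Sum>x\<in>{1..n}. indicator {a..b} (U x))"
      by (intro sum.cong) (auto simp: indicator_def)
    finally show "(\<Sum>x\<in>{1..n}. indicator {a..b} (U x)) = real (card {x \<in> {1..n}. a \<le> U x \<and> U x \<le> b})" by simp
  qed
  finally show ?thesis .
qed

text \<open>Union bound over at most \<open>4 * n^2\<close> grid intervals and \<open>n^2\<close>
  pairs of vertices, each with Hoeffding probability \<open>2 * E\<close>; hence the factor
  10.\<close>

lemma bad_vertices_bound:
  assumes n: "3 \<le> n" and \<epsilon>: "0 < \<epsilon>"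
  shows "{U \<in> space (vertex_space n). \<not> good_vertices n \<epsilon> U} \<in> sets (vertex_space n)"
    and "emeasure (vertex_space n) {U \<in> space (vertex_space n). \<not> good_vertices n \<epsilon> U}
      \<le> ennreal (10 * (real n)\<^sup>2 * exp (- 2 * \<epsilon>\<^sup>2 / real n))"
proof -
  interpret P: prob_space "vertex_space n" by (intro prob_space_PiM prob_space_unif01)
  define E where "E = exp (- 2 * \<epsilon>\<^sup>2 / real n)"
  define A where "A = (\<lambda>(i, j). {U \<in> space (vertex_space n).
      \<epsilon> \<le> \<bar>real (card {x \<in> {1..n}. real i / real n \<le> U x \<and> U x \<le> real j / real n}) - real n * (real j / real n - real i / real n)\<bar>})"
  define B where "B = (\<lambda>(u, v). {U \<in> space (vertex_space n). \<epsilon> \<le> \<bar>mean_codegree n U u v - (real n - 2) * sq (U u) (U v)\<bar>})"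
  define I where "I = {(i, j). i \<in> {0..n} \<and> j \<in> {0..n} \<and> i < j}"
  define J where "J = {(u, v). u \<in> {1..n} \<and> v \<in> {1..n} \<and> u \<noteq> v}"
  have sub: "I \<subseteq> {0..n} \<times> {0..n}" "J \<subseteq> {1..n} \<times> {1..n}" by (auto simp: I_def J_def)
  have fin: "finite I" "finite J" using sub by (auto intro: finite_subset)
  have "card I \<le> card ({0..n} \<times> {0..n})" "card J \<le> card ({1..n} \<times> {1..n})"
    by (rule card_mono[OF _ sub(1)], simp, rule card_mono[OF _ sub(2)], simp)
  then have cardIJ: "real (card I) \<le> 4 * (real n)\<^sup>2" "real (card J) \<le> (real n)\<^sup>2"
  proof -
    assume "card I \<le> card ({0..n} \<times> {0..n})" "card J \<le> card ({1..n} \<times> {1..n})"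
    then have "card I \<le> (n + 1) * (n + 1)" "card J \<le> n * n" by auto
    moreover have "(n + 1) * (n + 1) \<le> (2 * n) * (2 * n)" using n by (intro mult_le_mono) auto
    ultimately have "card I \<le> 4 * n\<^sup>2" "card J \<le> n\<^sup>2" by (auto simp: power2_eq_square)
    then show "real (card I) \<le> 4 * (real n)\<^sup>2" "real (card J) \<le> (real n)\<^sup>2"
      using of_nat_mono[of "card I" "4 * n\<^sup>2", where 'a=real] of_nat_mono[of "card J" "n\<^sup>2", where 'a=real] by simp_all
  qed
  have A: "A p \<in> sets (vertex_space n)" for p
    unfolding A_def case_prod_beta
    by (intro borel_measurable_le borel_measurable_const borel_measurable_abs borel_measurable_diff interval_count_measurable)
  have B: "B p \<in> sets (vertex_space n)" if pJ: "p \<in> J" for p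
  proof -
    obtain u v where p: "p = (u, v)" "u \<in> {1..n}" "v \<in> {1..n}" using pJ by (auto simp: J_def)
    show ?thesis unfolding p B_def prod.case
      by (intro borel_measurable_le borel_measurable_const borel_measurable_abs mean_codegree_measurable p)
  qed
  have pA: "P.prob (A p) \<le> 2 * E" if pI: "p \<in> I" for p
  proof -
    obtain i j where p: "p = (i, j)" "i < j" "j \<le> n" using pI by (auto simp: I_def)
    show ?thesis unfolding p A_def E_def prod.case
      using p n \<epsilon> by (intro interval_count_concentration) (auto simp: field_simps)
  qed
  have pB: "P.prob (B p) \<le> 2 * E" if "p \<in> J" for p
    using that mean_codegree_concentration[OF n _ _ _ \<epsilon>] unfolding B_def J_def E_def by auto
  have eq: "{U \<in> space (vertex_space n). \<not> good_vertices n \<epsilon> U} = (\<Union>p\<in>I. A p) \<union> (\<Union>p\<in>J. B p)"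
  proof (rule set_eqI)
    fix U
    have "U \<in> (\<Union>p\<in>I. A p) \<union> (\<Union>p\<in>J. B p) \<longleftrightarrow> (\<exists>i\<in>{0..n}. \<exists>j\<in>{0..n}. i < j \<and> U \<in> A (i, j)) \<or>
        (\<exists>u\<in>{1..n}. \<exists>v\<in>{1..n}. u \<noteq> v \<and> U \<in> B (u, v))"
      unfolding I_def J_def by blast
    also have "\<dots> \<longleftrightarrow> U \<in> {U \<in> space (vertex_space n). \<not> good_vertices n \<epsilon> U}"
      unfolding good_vertices_def A_def B_def prod.case mem_Collect_eq not_all Bex_def Ball_def not_imp de_Morgan_conj not_less by blast
    finally show "U \<in> {U \<in> space (vertex_space n). \<not> good_vertices n \<epsilon> U} \<longleftrightarrow> U \<in> (\<Union>p\<in>I. A p) \<union> (\<Union>p\<in>J. B p)" by simp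
  qed
  show "{U \<in> space (vertex_space n). \<not> good_vertices n \<epsilon> U} \<in> sets (vertex_space n)"
    unfolding eq using A B fin by (intro sets.Un sets.finite_UN) auto
  have E0: "0 \<le> E" by (simp add: E_def)
  have "P.prob ((\<Union>p\<in>I. A p) \<union> (\<Union>p\<in>J. B p)) \<le> P.prob (\<Union>p\<in>I. A p) + P.prob (\<Union>p\<in>J. B p)"
    using A B fin by (intro measure_Un_le sets.finite_UN) auto
  also have "\<dots> \<le> (\<Sum>p\<in>I. P.prob (A p)) + (\<Sum>p\<in>J. P.prob (B p))"
    using A B fin by (intro add_mono P.finite_measure_subadditive_finite) auto
  also have "\<dots> \<le> (\<Sum>p\<in>I. 2 * E) + (\<Sum>p\<in>J. 2 * E)"
    by (intro add_mono sum_mono pA pB)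
  also have "\<dots> = real (card I) * (2 * E) + real (card J) * (2 * E)" by simp
  also have "\<dots> \<le> (4 * (real n)\<^sup>2) * (2 * E) + (real n)\<^sup>2 * (2 * E)"
    using cardIJ E0 by (intro add_mono mult_right_mono) auto
  also have "\<dots> = 10 * (real n)\<^sup>2 * E" by simp
  finally show "emeasure (vertex_space n) {U \<in> space (vertex_space n). \<not> good_vertices n \<epsilon> U}
      \<le> ennreal (10 * (real n)\<^sup>2 * exp (- 2 * \<epsilon>\<^sup>2 / real n))"
    unfolding eq E_def[symmetric] P.emeasure_eq_measure by (rule ennreal_leI)
qed

lemma bad_edges_bound:
  assumes n: "3 \<le> n" and \<epsilon>: "0 < \<epsilon>"
  shows "{W \<in> space (edge_space n). \<not> good_edges n \<epsilon> U W} \<in> sets (edge_space n)"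
    and "emeasure (edge_space n) {W \<in> space (edge_space n). \<not> good_edges n \<epsilon> U W}
      \<le> ennreal (2 * (real n)\<^sup>2 * exp (- 2 * \<epsilon>\<^sup>2 / real n))"
proof -
  interpret P: prob_space "edge_space n" by (intro prob_space_PiM prob_space_unif01)
  define E where "E = exp (- 2 * \<epsilon>\<^sup>2 / real n)"
  define cnt where "cnt = (\<lambda>u v W. real (card {x \<in> {1..n} - {u, v}. W (slot u x) < \<phi> (U x - U u) \<and> W (slot v x) < \<phi> (U x - U v)}))"
  define B where "B = (\<lambda>(u, v). {W \<in> space (edge_space n). \<epsilon> \<le> \<bar>cnt u v W - mean_codegree n U u v\<bar>})"
  define J where "J = {(u, v). u \<in> {1..n} \<and> v \<in> {1..n} \<and> u \<noteq> v}"
  have sub: "J \<subseteq> {1..n} \<times> {1..n}" by (auto simp: J_def)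
  have fin: "finite J" using sub by (auto intro: finite_subset)
  have "card J \<le> card ({1..n} \<times> {1..n})"
    by (rule card_mono[OF _ sub]) simp
  then have "card J \<le> n\<^sup>2" by (simp add: power2_eq_square)
  then have cardJ: "real (card J) \<le> (real n)\<^sup>2"
    using of_nat_mono[of "card J" "n\<^sup>2", where 'a=real] by simp
  have cnt: "cnt u v \<in> borel_measurable (edge_space n)" if uv: "u \<in> {1..n}" "v \<in> {1..n}" "u \<noteq> v" for u v
  proof -
    have "(\<lambda>W. \<Sum>x\<in>{1..n} - {u, v}. indicator {..<\<phi> (U x - U u)} (W (slot u x)) * indicator {..<\<phi> (U x - U v)} (W (slot v x)) :: real)
        \<in> borel_measurable (edge_space n)"
      using uv edge_slot_mem
      by (intro borel_measurable_sum borel_measurable_times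
          measurable_compose[OF measurable_component_unif01 borel_measurable_indicator]) (auto simp: slot_def min_def max_def)
    also have "(\<lambda>W. \<Sum>x\<in>{1..n} - {u, v}. indicator {..<\<phi> (U x - U u)} (W (slot u x)) * indicator {..<\<phi> (U x - U v)} (W (slot v x)) :: real) = cnt u v"
    proof
      fix W
      have "cnt u v W = (\<Sum>x\<in>{1..n} - {u, v}. if W (slot u x) < \<phi> (U x - U u) \<and> W (slot v x) < \<phi> (U x - U v) then 1 else 0)"
        unfolding cnt_def by (rule card_filter_sum) simp
      also have "\<dots> = (\<Sum>x\<in>{1..n} - {u, v}. indicator {..<\<phi> (U x - U u)} (W (slot u x)) * indicator {..<\<phi> (U x - U v)} (W (slot v x)))"
        by (intro sum.cong) (auto simp: indicator_def)
      finally show "(\<Sum>x\<in>{1..n} - {u, v}. indicator {..<\<phi> (U x - U u)} (W (slot u x)) * indicator {..<\<phi> (U x - U v)} (W (slot v x))) = cnt u v W"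
        by simp
    qed
    finally show ?thesis .
  qed
  have B: "B p \<in> sets (edge_space n)" if "p \<in> J" for p
    using that cnt unfolding B_def J_def
    by (auto intro!: borel_measurable_le borel_measurable_const borel_measurable_abs borel_measurable_diff)
  have pB: "P.prob (B p) \<le> 2 * E" if pJ: "p \<in> J" for p
  proof -
    obtain u v where p: "p = (u, v)" "u \<in> {1..n}" "v \<in> {1..n}" "u \<noteq> v" using pJ by (auto simp: J_def)
    show ?thesis
      unfolding p B_def E_def prod.case cnt_def mean_codegree_def
      by (rule codegree_concentration[OF n p(2-4) \<epsilon>]) (auto simp: nonneg le1)
  qed
  have eq: "{W \<in> space (edge_space n). \<not> good_edges n \<epsilon> U W} = (\<Union>p\<in>J. B p)"
  proof (rule set_eqI)
    fix W
    have "W \<in> (\<Union>p\<in>J. B p) \<longleftrightarrow> (\<exists>u\<in>{1..n}. \<exists>v\<in>{1..n}. u \<noteq> v \<and> W \<in> B (u, v))"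
      unfolding J_def by blast
    also have "\<dots> \<longleftrightarrow> W \<in> {W \<in> space (edge_space n). \<not> good_edges n \<epsilon> U W}"
      unfolding good_edges_def B_def cnt_def prod.case mem_Collect_eq not_all Bex_def Ball_def not_imp not_less by blast
    finally show "W \<in> {W \<in> space (edge_space n). \<not> good_edges n \<epsilon> U W} \<longleftrightarrow> W \<in> (\<Union>p\<in>J. B p)" by simp
  qed
  show "{W \<in> space (edge_space n). \<not> good_edges n \<epsilon> U W} \<in> sets (edge_space n)"
    unfolding eq using B fin by (intro sets.finite_UN) auto
  have E0: "0 \<le> E" by (simp add: E_def)
  have "P.prob (\<Union>p\<in>J. B p) \<le> (\<Sum>p\<in>J. P.prob (B p))"
    using B fin by (intro P.finite_measure_subadditive_finite) auto
  also have "\<dots> \<le> (\<Sum>p\<in>J. 2 * E)" by (intro sum_mono pB)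
  also have "\<dots> = real (card J) * (2 * E)" by simp
  also have "\<dots> \<le> (real n)\<^sup>2 * (2 * E)" using cardJ E0 by (intro mult_right_mono) auto
  also have "\<dots> = 2 * (real n)\<^sup>2 * E" by simp
  finally show "emeasure (edge_space n) {W \<in> space (edge_space n). \<not> good_edges n \<epsilon> U W}
      \<le> ennreal (2 * (real n)\<^sup>2 * exp (- 2 * \<epsilon>\<^sup>2 / real n))"
    unfolding eq E_def[symmetric] P.emeasure_eq_measure by (rule ennreal_leI)
qed

lemma interval_count_upper:
  assumes good: "good_vertices n \<epsilon> U" and n: "0 < n" and \<epsilon>: "0 < \<epsilon>" and ab: "0 \<le> a" "a \<le> b" "b \<le> 1"
  shows "real (card {x \<in> {1..n}. a \<le> U x \<and> U x \<le> b}) \<le> real n * (b - a) + 2 + \<epsilon>"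
proof -
  define i where "i = nat \<lfloor>a * real n\<rfloor>"
  define j where "j = nat \<lceil>b * real n\<rceil>"
  have b0: "0 \<le> b" using ab by simp
  have an: "0 \<le> a * real n" "0 \<le> b * real n" "b * real n \<le> real n" "a * real n \<le> b * real n"
    using ab b0 n by (auto intro: mult_right_mono mult_left_le_one_le)
  have ri: "real i = real_of_int \<lfloor>a * real n\<rfloor>" and rj: "real j = real_of_int \<lceil>b * real n\<rceil>"
    using an by (simp_all add: i_def j_def)
  have i: "real i \<le> a * real n" "a * real n < real i + 1" using ri by linarith+
  have j: "b * real n \<le> real j" "real j < b * real n + 1" using rj by linarith+
  have jn: "j \<le> n" using j an by linarith
  have ij': "i \<le> j" using i j an by linarith
  show ?thesis
  proof (cases "i < j")
    case True
    have "{x \<in> {1..n}. a \<le> U x \<and> U x \<le> b} \<subseteq> {x \<in> {1..n}. real i / real n \<le> U x \<and> U x \<le> real j / real n}"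
    proof safe
      fix x assume "a \<le> U x" "U x \<le> b"
      moreover have "real i / real n \<le> a" "b \<le> real j / real n" using i j n by (auto simp: field_simps)
      ultimately show "real i / real n \<le> U x" "U x \<le> real j / real n" by auto
    qed
    then have "card {x \<in> {1..n}. a \<le> U x \<and> U x \<le> b} \<le> card {x \<in> {1..n}. real i / real n \<le> U x \<and> U x \<le> real j / real n}"
      by (intro card_mono) auto
    moreover have "\<bar>real (card {x \<in> {1..n}. real i / real n \<le> U x \<and> U x \<le> real j / real n}) - real n * (real j / real n - real i / real n)\<bar> < \<epsilon>"
      using good True jn by (auto simp: good_vertices_def)
    moreover have "real n * (real j / real n - real i / real n) = real j - real i"
      using n by (simp add: field_simps)
    moreover have "real j - real i \<le> real n * (b - a) + 2" using i j by (simp add: algebra_simps)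
    ultimately show ?thesis by linarith
  next
    case False
    then have ij: "i = j" using ij' by simp
    have "a * real n = b * real n" "a * real n = real i" using i j an ij by linarith+
    then have ab': "a = b" using n by simp
    \<comment> \<open>The interval is a single grid point here; it is enclosed in the grid cell to
      its right, or to its left when the point is 1.\<close>
    define i' where "i' = (if i < n then i else i - 1)"
    have i': "i' < n" "real i' / real n \<le> a" "a \<le> real (i' + 1) / real n"
      using \<open>a * real n = real i\<close> n jn ij by (auto simp: i'_def field_simps of_nat_diff)
    have "{x \<in> {1..n}. a \<le> U x \<and> U x \<le> b} \<subseteq> {x \<in> {1..n}. real i' / real n \<le> U x \<and> U x \<le> real (i' + 1) / real n}"
      using i' ab' by auto
    then have "card {x \<in> {1..n}. a \<le> U x \<and> U x \<le> b} \<le> card {x \<in> {1..n}. real i' / real n \<le> U x \<and> U x \<le> real (i' + 1) / real n}"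
      by (intro card_mono) auto
    moreover have "\<bar>real (card {x \<in> {1..n}. real i' / real n \<le> U x \<and> U x \<le> real (i' + 1) / real n}) - real n * (real (i' + 1) / real n - real i' / real n)\<bar> < \<epsilon>"
      using good i' unfolding good_vertices_def by (elim conjE ballE[of _ _ i'] ballE[of _ _ "i' + 1"]) auto
    moreover have "real n * (real (i' + 1) / real n - real i' / real n) = 1"
      using n by (simp add: field_simps)
    ultimately show ?thesis using ab' by simp
  qed
qed

lemma interval_count_lower:
  assumes good: "good_vertices n \<epsilon> U" and n: "0 < n" and \<epsilon>: "0 < \<epsilon>" and ab: "0 \<le> a" "a \<le> b" "b \<le> 1"
  shows "real n * (b - a) - 2 - \<epsilon> \<le> real (card {x \<in> {1..n}. a \<le> U x \<and> U x \<le> b})"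
proof -
  define i where "i = nat \<lceil>a * real n\<rceil>"
  define j where "j = nat \<lfloor>b * real n\<rfloor>"
  have b0: "0 \<le> b" using ab by simp
  have an: "0 \<le> a * real n" "0 \<le> b * real n" "b * real n \<le> real n" "a * real n \<le> b * real n"
    using ab b0 n by (auto intro: mult_right_mono mult_left_le_one_le)
  have ri: "real i = real_of_int \<lceil>a * real n\<rceil>" and rj: "real j = real_of_int \<lfloor>b * real n\<rfloor>"
    using an by (simp_all add: i_def j_def)
  have i: "a * real n \<le> real i" "real i < a * real n + 1" using ri by linarith+
  have j: "real j \<le> b * real n" "b * real n < real j + 1" using rj by linarith+
  have jn: "j \<le> n" using j an by linarith
  show ?thesis
  proof (cases "i < j")
    case True
    have "{x \<in> {1..n}. real i / real n \<le> U x \<and> U x \<le> real j / real n} \<subseteq> {x \<in> {1..n}. a \<le> U x \<and> U x \<le> b}"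
    proof safe
      fix x assume "real i / real n \<le> U x" "U x \<le> real j / real n"
      moreover have "a \<le> real i / real n" "real j / real n \<le> b" using i j n by (auto simp: field_simps)
      ultimately show "a \<le> U x" "U x \<le> b" by auto
    qed
    then have "card {x \<in> {1..n}. real i / real n \<le> U x \<and> U x \<le> real j / real n} \<le> card {x \<in> {1..n}. a \<le> U x \<and> U x \<le> b}"
      by (intro card_mono) auto
    moreover have "\<bar>real (card {x \<in> {1..n}. real i / real n \<le> U x \<and> U x \<le> real j / real n}) - real n * (real j / real n - real i / real n)\<bar> < \<epsilon>"
      using good True jn by (auto simp: good_vertices_def)
    moreover have "real n * (real j / real n - real i / real n) = real j - real i"
      using n by (simp add: field_simps)
    moreover have "real n * (b - a) - 2 \<le> real j - real i" using i j by (simp add: algebra_simps)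
    ultimately show ?thesis by linarith
  next
    case False
    \<comment> \<open>No grid cell fits inside, so the claimed lower bound is negative.\<close>
    then have "real n * (b - a) \<le> 2" using i j by (simp add: algebra_simps)
    then show ?thesis using \<epsilon> by linarith
  qed
qed

end

section \<open>Success probability of a single run\<close>

context interval_graphon
begin

lemma common_neighbours:
  assumes uv: "u \<in> {1..n}" "v \<in> {1..n}" "u \<noteq> v"
  shows "{x \<in> {1..n}. random_graph n kernel U W u x \<and> random_graph n kernel U W v x} =
     {x \<in> {1..n} - {u, v}. W (slot u x) < \<phi> (U x - U u) \<and> W (slot v x) < \<phi> (U x - U v)}"
  using uv by (auto simp: random_graph_def slot_def phi_commute)

text \<open>The codegree deviates from its mean by less than \<open>2 * \<epsilon>\<close>: one
  \<open>\<epsilon>\<close> from the edges for fixed positions, one from the positions. Dividing by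
  \<open>n - 2\<close> gives the uncertainty \<open>e\<close> in q.\<close>

lemma embedded_graph_square_threshold:
  assumes gv: "good_vertices n \<epsilon> U" and ge: "good_edges n \<epsilon> U W"
    and U: "\<And>v. v \<in> {1..n} \<Longrightarrow> U v \<in> {0..1}"
    and n: "3 \<le> n" and e: "2 * \<epsilon> \<le> (real n - 2) * e" "0 \<le> e" "e < \<mu>"
  shows "embedded_graph sq \<alpha> d \<mu> \<kappa> e U {1..n} (square_threshold n \<alpha> (random_graph n kernel U W))"
proof -
  define H where "H = square_threshold n \<alpha> (random_graph n kernel U W)"
  define cnt where "cnt = (\<lambda>u v. real (card {x \<in> {1..n}. random_graph n kernel U W u x \<and> random_graph n kernel U W v x}))"
  have H: "H u v \<longleftrightarrow> u \<in> {1..n} \<and> v \<in> {1..n} \<and> u \<noteq> v \<and> \<alpha> * (real n - 2) < cnt u v" for u v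
    by (simp add: H_def square_threshold_def cnt_def)
  have cnt: "\<bar>cnt u v - (real n - 2) * sq (U u) (U v)\<bar> < 2 * \<epsilon>" if uv: "u \<in> {1..n}" "v \<in> {1..n}" "u \<noteq> v" for u v
  proof -
    have "\<bar>cnt u v - mean_codegree n U u v\<bar> < \<epsilon>"
      using ge uv unfolding good_edges_def cnt_def common_neighbours[OF uv] by blast
    moreover have "\<bar>mean_codegree n U u v - (real n - 2) * sq (U u) (U v)\<bar> < \<epsilon>"
      using gv uv unfolding good_vertices_def by blast
    ultimately show ?thesis by linarith
  qed
  have n2: "0 < real n - 2" using n by simp
  show ?thesis
    unfolding H_def[symmetric]
  proof unfold_locales
    show "H v u" if "H u v" for u v
    proof -
      have "{x \<in> {1..n}. random_graph n kernel U W u x \<and> random_graph n kernel U W v x} =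
        {x \<in> {1..n}. random_graph n kernel U W v x \<and> random_graph n kernel U W u x}" by blast
      then show ?thesis using that by (simp add: H cnt_def)
    qed
    show "\<not> H u u" for u by (simp add: H)
    show "H u v" if uv: "u \<in> {1..n}" "v \<in> {1..n}" "u \<noteq> v" and q: "\<alpha> + e < sq (U u) (U v)" for u v
    proof -
      have "(real n - 2) * (\<alpha> + e) < (real n - 2) * sq (U u) (U v)" using q n2 by (rule mult_strict_left_mono)
      then have "\<alpha> * (real n - 2) < cnt u v" using cnt[OF uv] e(1) by (simp add: algebra_simps abs_less_iff)
      then show ?thesis using uv by (simp add: H)
    qed
    show "\<alpha> - e \<le> sq (U u) (U v)" if "u \<in> {1..n}" "v \<in> {1..n}" and h: "H u v" for u v
    proof (rule ccontr)
      assume "\<not> \<alpha> - e \<le> sq (U u) (U v)"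
      then have "(real n - 2) * sq (U u) (U v) < (real n - 2) * (\<alpha> - e)" using n2 by (intro mult_strict_left_mono) auto
      moreover have "\<alpha> * (real n - 2) < cnt u v" "u \<noteq> v" using h by (auto simp: H)
      ultimately show False using cnt[of u v] that e(1) by (simp add: algebra_simps abs_less_iff)
    qed
  qed (use U e in auto)
qed

lemma dense_vertices:
  assumes gv: "good_vertices n \<epsilon> U" and n: "0 < n" and \<epsilon>: "0 < \<epsilon>" and \<eta>: "2 + \<epsilon> < real n * \<eta>" "0 \<le> \<eta>"
  shows "dense_points \<eta> {1..n} U"
  unfolding dense_points_def
proof (intro allI impI)
  fix a :: real assume a: "0 \<le> a \<and> a + \<eta> \<le> 1"
  have "real n * (a + \<eta> - a) - 2 - \<epsilon> \<le> real (card {x \<in> {1..n}. a \<le> U x \<and> U x \<le> a + \<eta>})"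
    by (rule interval_count_lower[OF gv n \<epsilon>]) (use a \<eta> in auto)
  then have "0 < card {x \<in> {1..n}. a \<le> U x \<and> U x \<le> a + \<eta>}" using \<eta> by auto
  then have "{x \<in> {1..n}. a \<le> U x \<and> U x \<le> a + \<eta>} \<noteq> {}" by (metis card.empty less_irrefl)
  then show "\<exists>x\<in>{1..n}. a \<le> U x \<and> U x \<le> a + \<eta>" by blast
qed

lemma few_near_vertices:
  assumes gv: "good_vertices n \<epsilon> U" and n: "0 < n" and \<epsilon>: "0 < \<epsilon>" and \<theta>: "0 \<le> \<theta>"
    and U: "\<And>v. v \<in> {1..n} \<Longrightarrow> U v \<in> {0..1}" and i: "i \<in> {1..n}"
  shows "real (card {k \<in> {1..n}. \<bar>U k - U i\<bar> < \<theta>}) \<le> real n * (2 * \<theta>) + 2 + \<epsilon>"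
proof -
  define a where "a = max 0 (U i - \<theta>)"
  define b where "b = min 1 (U i + \<theta>)"
  have ab: "0 \<le> a" "a \<le> b" "b \<le> 1" "b - a \<le> 2 * \<theta>" using U[OF i] \<theta> by (auto simp: a_def b_def)
  have "card {k \<in> {1..n}. \<bar>U k - U i\<bar> < \<theta>} \<le> card {x \<in> {1..n}. a \<le> U x \<and> U x \<le> b}"
    using U by (intro card_mono) (auto simp: a_def b_def abs_less_iff)
  then have "real (card {k \<in> {1..n}. \<bar>U k - U i\<bar> < \<theta>}) \<le> real n * (b - a) + 2 + \<epsilon>"
    using interval_count_upper[OF gv n \<epsilon> ab(1-3)] by linarith
  also have "\<dots> \<le> real n * (2 * \<theta>) + 2 + \<epsilon>" using ab by (intro add_right_mono mult_left_mono) auto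
  finally show ?thesis .
qed

text \<open>Along one side of \<open>x\<close> the function q changes at rate at least \<kappa> near
  the level \<alpha>, so the vertices on that side with q within \<open>e\<close> of \<alpha> fill a
  window of length at most \<open>2 * e / \<kappa>\<close>. The outer factor 2 accounts for the two
  sides.\<close>

lemma few_uncertain:
  assumes gv: "good_vertices n \<epsilon> U" and n: "0 < n" and \<epsilon>: "0 < \<epsilon>"
    and E: "embedded_graph sq \<alpha> d \<mu> \<kappa> e U {1..n} H" and x: "x \<in> {1..n}"
  shows "real (card {y \<in> {1..n}. embedded_graph.uncertain sq \<alpha> e U x y}) \<le> 2 * (real n * (2 * e / \<kappa>) + 2 + \<epsilon>)"
proof -
  interpret embedded_graph sq \<alpha> d \<mu> \<kappa> e U "{1..n}" H by fact
  define r where "r = 2 * e / \<kappa>"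
  have r0: "0 \<le> r" using e_nonneg profile.\<kappa>_pos by (simp add: r_def)
  have win: "\<exists>a b. 0 \<le> a \<and> a \<le> b \<and> b \<le> 1 \<and> b - a \<le> r \<and> (\<forall>y\<in>Y. a \<le> U y \<and> U y \<le> b)"
    if Y: "Y \<subseteq> {1..n}" and close: "\<And>y y'. y \<in> Y \<Longrightarrow> y' \<in> Y \<Longrightarrow> U y' \<le> U y \<Longrightarrow> \<kappa> * (U y - U y') \<le> 2 * e" for Y
  proof (cases "Y = {}")
    case True
    then show ?thesis using r0 by (intro exI[of _ 0]) auto
  next
    case False
    have fin: "finite Y" using Y by (rule finite_subset) simp
    define a where "a = Min (U ` Y)"
    define b where "b = Max (U ` Y)"
    have "a \<in> U ` Y" "b \<in> U ` Y" unfolding a_def b_def using fin False by (auto intro!: Min_in Max_in)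
    then obtain ya yb where y: "ya \<in> Y" "yb \<in> Y" "a = U ya" "b = U yb" by blast
    have mm: "a \<le> U y \<and> U y \<le> b" if "y \<in> Y" for y unfolding a_def b_def using fin that by auto
    have "\<kappa> * (b - a) \<le> 2 * e" using close[of yb ya] y mm by auto
    then have "b - a \<le> r" using profile.\<kappa>_pos by (simp add: r_def field_simps)
    moreover have "0 \<le> a" "b \<le> 1" using U01 y Y by force+
    ultimately show ?thesis using mm y by (intro exI[of _ a] exI[of _ b]) auto
  qed
  have cnt: "real (card Y) \<le> real n * r + 2 + \<epsilon>"
    if Y: "Y \<subseteq> {1..n}" and close: "\<And>y y'. y \<in> Y \<Longrightarrow> y' \<in> Y \<Longrightarrow> U y' \<le> U y \<Longrightarrow> \<kappa> * (U y - U y') \<le> 2 * e" for Y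
  proof -
    obtain a b where ab: "0 \<le> a" "a \<le> b" "b \<le> 1" "b - a \<le> r" "\<forall>y\<in>Y. a \<le> U y \<and> U y \<le> b"
      using win[OF Y close] by blast
    have "card Y \<le> card {x \<in> {1..n}. a \<le> U x \<and> U x \<le> b}" using ab Y by (intro card_mono) auto
    then have "real (card Y) \<le> real n * (b - a) + 2 + \<epsilon>"
      using interval_count_upper[OF gv n \<epsilon> ab(1-3)] by linarith
    also have "\<dots> \<le> real n * r + 2 + \<epsilon>" using ab by (intro add_right_mono mult_left_mono) auto
    finally show ?thesis .
  qed
  define Y where "Y = {y \<in> {1..n}. uncertain x y \<and> U x \<le> U y}"
  define Z where "Z = {y \<in> {1..n}. uncertain x y \<and> U y < U x}"
  have unc: "\<alpha> - e \<le> sq (U x) (U y)" "sq (U x) (U y) \<le> \<alpha> + e" if "uncertain x y" for y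
    using that by (auto simp: uncertain_def)
  have "real (card Y) \<le> real n * r + 2 + \<epsilon>"
  proof (rule cnt)
    fix y y' assume y: "y \<in> Y" "y' \<in> Y" "U y' \<le> U y"
    then have "min (\<alpha> + \<mu>) (sq (U x) (U y) + \<kappa> * ((U x - U x) + (U y - U y'))) \<le> sq (U x) (U y')"
      using U01[OF x] U01[of y] e_less unc(1)[of y] by (intro profile.q_inner) (auto simp: Y_def)
    then show "\<kappa> * (U y - U y') \<le> 2 * e"
      using y unc(1)[of y] unc(2)[of y'] e_less by (auto simp: Y_def)
  qed (auto simp: Y_def)
  moreover have "real (card Z) \<le> real n * r + 2 + \<epsilon>"
  proof (rule cnt)
    fix y y' assume y: "y \<in> Z" "y' \<in> Z" "U y' \<le> U y"
    then have "min (\<alpha> + \<mu>) (sq (U y') (U x) + \<kappa> * ((U y - U y') + (U x - U x))) \<le> sq (U y) (U x)"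
      using U01[OF x] U01[of y'] e_less unc(1)[of y'] by (intro profile.q_inner) (auto simp: Z_def sq_sym)
    then show "\<kappa> * (U y - U y') \<le> 2 * e"
      using y unc(1)[of y'] unc(2)[of y] e_less by (auto simp: Z_def sq_sym)
  qed (auto simp: Z_def)
  moreover have "card {y \<in> {1..n}. uncertain x y} \<le> card Y + card Z"
  proof -
    have "{y \<in> {1..n}. uncertain x y} = Y \<union> Z" by (auto simp: Y_def Z_def)
    then show ?thesis by (simp add: card_Un_le)
  qed
  ultimately show ?thesis by (simp add: r_def)
qed

end

section \<open>Independent draws on a typical graph\<close>

lemma prob_draws_all:
  fixes n m :: nat and I :: "nat set"
  assumes nm: "samples n m" and I: "finite I" and A: "A \<subseteq> {S. S \<subseteq> {1..n} \<and> card S = m}"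
  shows "emeasure (\<Pi>\<^sub>M k\<in>UNIV. sample_space n m) {x \<in> space (\<Pi>\<^sub>M k\<in>UNIV. sample_space n m). \<forall>k\<in>I. x k \<in> A}
     = ennreal (measure (sample_space n m) A ^ card I)"
proof -
  interpret samples n m by fact
  have P: "prob_space (sample_space n m)" using prob_space_axioms by (simp add: N_def)
  interpret PP: product_prob_space "\<lambda>_::nat. sample_space n m" UNIV
    by (intro product_prob_spaceI P)
  have "A \<in> sets (sample_space n m)" using A mem_sets[of A] by (simp add: N_def space_uniform_count_measure)
  then have "emeasure (\<Pi>\<^sub>M k\<in>UNIV. sample_space n m) {x \<in> space (\<Pi>\<^sub>M k\<in>UNIV. sample_space n m). \<forall>k\<in>I. x k \<in> A}
    = (\<Prod>k\<in>I. emeasure (sample_space n m) A)"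
    using I by (intro PP.emeasure_PiM_Collect) auto
  also have "\<dots> = ennreal (measure (sample_space n m) A ^ card I)"
    using emeasure_eq_measure[of A] by (simp add: N_def ennreal_power)
  finally show ?thesis .
qed

text \<open>Only the first \<open>t * B\<close> draws matter: with high probability each of the \<open>t\<close> blocks of \<open>B\<close>
  consecutive draws contains a success, so the \<open>t\<close> recorded samples are among them, and every
  success among the first \<open>t\<close> draws is recorded. This avoids conditioning on success.\<close>

locale finite_run = interval_graphon \<phi> c d \<alpha> \<mu> \<kappa> + samples n m
  for \<phi> :: "real \<Rightarrow> real" and c d \<alpha> \<mu> \<kappa> :: real and n m :: nat +
  fixes t B K k :: nat and \<epsilon> e \<eta> \<eta>\<^sub>V \<theta> \<zeta> \<beta> M R D :: real
  assumes \<epsilon>_pos: "0 < \<epsilon>"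
    and e_ge: "2 * \<epsilon> \<le> (real n - 2) * e"
    and K_pos: "0 < K"
    and okS: "profile.scale_ok e (2 / real K) \<eta>" "\<eta> \<le> 1/4" "\<eta> \<le> d"
    and okV: "profile.scale_ok e \<eta>\<^sub>V \<theta>"
    and \<eta>V: "2 + \<epsilon> < real n * \<eta>\<^sub>V"
    and M: "real n * (2 * \<theta>) + 2 + \<epsilon> \<le> M" "4 * M \<le> D"
    and R: "2 * (real n * (2 * e / \<kappa>) + 2 + \<epsilon>) \<le> R"
    and bins: "2 + \<epsilon> \<le> real n / (2 * real K)" "2 + \<epsilon> \<le> real n / 8"
    and \<beta>: "real n * (2 / real K + \<eta>) + 2 + \<epsilon> \<le> \<beta> * real n"
    and k: "\<zeta> \<le> real k" "real k < \<zeta> + 1" "k \<le> m"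
    and small: "2 * R * (real m / real n) + R * (real m)\<^sup>2 / real n \<le> 1/4"
    and defect: "sample_defect K k \<beta> \<le> 1 / (4 * (real n)\<^sup>2)"
begin

lemma n3: "3 \<le> n" and n0: "0 < n"
  using m4 mn by auto

abbreviation draw_space :: "(nat \<Rightarrow> nat set) measure" where
  "draw_space \<equiv> \<Pi>\<^sub>M k\<in>UNIV. sample_space n m"

lemma prob_space_draws: "prob_space draw_space"
  using prob_space_axioms by (intro prob_space_PiM) (simp add: N_def)

text \<open>The three failures to be excluded: a bad sample among the first \<open>t * B\<close>
  draws, a pair of vertices without successful sample among the first \<open>t\<close> draws, a
  block without success.\<close>

definition draw_bound :: real where
  "draw_bound = real (t * B) * sample_defect K k \<beta> +
     (real n)\<^sup>2 * (1 - 1 / (2 * (real n)\<^sup>2)) ^ t + real t * (1 - 1 / (2 * (real n)\<^sup>2)) ^ B"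

context
  fixes U :: "nat \<Rightarrow> real" and W :: "nat \<times> nat \<Rightarrow> real"
  assumes U: "\<And>v. v \<in> {1..n} \<Longrightarrow> U v \<in> {0..1}"
    and gv: "good_vertices n \<epsilon> U" and ge: "good_edges n \<epsilon> U W"
begin

definition H :: "nat \<Rightarrow> nat \<Rightarrow> bool" where
  "H = square_threshold n \<alpha> (random_graph n kernel U W)"

lemma embedded: "embedded_graph sq \<alpha> d \<mu> \<kappa> e U {1..n} H"
  unfolding H_def using profile.scale_okD[OF okS(1)]
  by (intro embedded_graph_square_threshold[OF gv ge U n3 e_ge]) auto

lemma not_good_sample_bound:
  "measure (sample_space n m) {S \<in> space (sample_space n m). \<not> good_sample n m \<zeta> (2 / real K) \<eta> U S} \<le> sample_defect K k \<beta>"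
proof -
  note up = interval_count_upper[OF gv n0 \<epsilon>_pos] and lo = interval_count_lower[OF gv n0 \<epsilon>_pos]
  have e1: "{x \<in> {1..n}. U x \<le> 1/4} = {x \<in> {1..n}. 0 \<le> U x \<and> U x \<le> 1/4}" using U by auto
  have e2: "{x \<in> {1..n}. 3/4 \<le> U x} = {x \<in> {1..n}. 3/4 \<le> U x \<and> U x \<le> 1}" using U by auto
  have "prob {S \<in> space N. \<not> good_sample n m \<zeta> (2 / real K) \<eta> U S} \<le> sample_defect K k \<beta>"
  proof (rule prob_not_good_sample[OF K_pos])
    show "real n / (2 * real K) \<le> real (card {x \<in> {1..n}. real i / real K \<le> U x \<and> U x \<le> (real i + 1) / real K})"
      if "i < K" for i
    proof -
      have "real n * ((real i + 1) / real K - real i / real K) - 2 - \<epsilon>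
          \<le> real (card {x \<in> {1..n}. real i / real K \<le> U x \<and> U x \<le> (real i + 1) / real K})"
        using that K_pos by (intro lo) (auto simp: field_simps)
      moreover have "real n * ((real i + 1) / real K - real i / real K) = 2 * (real n / (2 * real K))"
        using K_pos by (simp add: field_simps)
      ultimately show ?thesis using bins(1) by linarith
    qed
    show "real n / 8 \<le> real (card {x \<in> {1..n}. U x \<le> 1/4})"
      unfolding e1 using lo[of 0 "1/4"] bins(2) by simp
    show "real n / 8 \<le> real (card {x \<in> {1..n}. 3/4 \<le> U x})"
      unfolding e2 using lo[of "3/4" 1] bins(2) by simp
    have s: "2 / real K + \<eta> \<le> 1" "0 \<le> 2 / real K + \<eta>"
      using profile.scale_okD(2,4,7)[OF okS(1)] okS(2) by linarith+
    have "card {x \<in> {1..n}. U x < 2 / real K + \<eta>} \<le> card {x \<in> {1..n}. 0 \<le> U x \<and> U x \<le> 2 / real K + \<eta>}"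
      using U by (intro card_mono) auto
    then show "real (card {x \<in> {1..n}. U x < 2 / real K + \<eta>}) \<le> \<beta> * real n"
      using up[of 0 "2 / real K + \<eta>"] s \<beta> by simp
    have "0 \<le> real n * (2 / real K + \<eta>)" using s by simp
    then have "0 \<le> \<beta> * real n" using \<beta> \<epsilon>_pos by linarith
    then show "0 \<le> \<beta>" using n0 by (simp add: zero_le_mult_iff)
  qed (use k in auto)
  then show ?thesis by (simp add: N_def)
qed

lemma pair_success_bound:
  assumes uv: "u \<in> {1..n}" "v \<in> {1..n}" "u \<noteq> v"
  shows "1 / (2 * (real n)\<^sup>2) \<le> measure (sample_space n m)
      {S \<in> space (sample_space n m). u \<in> S \<and> v \<in> S \<and> connected_graph H S \<and> unit_interval_graph H S}"
proof -
  interpret E: embedded_graph sq \<alpha> d \<mu> \<kappa> e U "{1..n}" H by (rule embedded)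
  have "real (card {y \<in> {1..n}. E.uncertain x y}) \<le> R" if "x \<in> {1..n}" for x
    using few_uncertain[OF gv n0 \<epsilon>_pos embedded that] R by linarith
  note R' = this
  show ?thesis
  proof (rule E.prob_pair_success[OF samples_axioms refl _ _ _ R' uv small])
    show "0 < 2 / real K" "3 * (2 / real K) \<le> d" "2 / real K \<le> 1"
      using profile.scale_okD(2-4)[OF okS(1)] by linarith+
    show "measure (sample_space n m) {S \<in> space (sample_space n m). \<not> good_sample n m \<zeta> (2 / real K) \<eta> U S}
        \<le> 1 / (4 * (real n)\<^sup>2)"
      using not_good_sample_bound defect by linarith
  qed
qed

lemma draws_bound:
  "emeasure draw_space {x \<in> space draw_space. \<not> main_succeeds n \<alpha> m t \<zeta> kernel D (U, W, x)} \<le> ennreal draw_bound"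
proof -
  interpret E: embedded_graph sq \<alpha> d \<mu> \<kappa> e U "{1..n}" H by (rule embedded)
  interpret PD: prob_space draw_space by (rule prob_space_draws)
  define s where "s = 1 / (2 * (real n)\<^sup>2)"
  define \<Omega> where "\<Omega> = {S. S \<subseteq> {1..n} \<and> card S = m}"
  have sp: "space (sample_space n m) = \<Omega>" by (simp add: \<Omega>_def space_uniform_count_measure)
  have s01: "0 \<le> 1 - s"
  proof -
    have "1 \<le> (real n)\<^sup>2" using n0 by (simp add: one_le_power)
    then have "0 < 2 * (real n)\<^sup>2" "1 \<le> 2 * (real n)\<^sup>2" by linarith+
    then have "1 / (2 * (real n)\<^sup>2) \<le> 1" by (simp only: divide_le_eq_1_pos)
    then show ?thesis by (simp add: s_def)
  qed
  define Bad where "Bad = {S \<in> \<Omega>. \<not> good_sample n m \<zeta> (2 / real K) \<eta> U S}"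
  define Win where "Win = (\<lambda>(u, v). {S \<in> \<Omega>. u \<in> S \<and> v \<in> S \<and> connected_graph H S \<and> unit_interval_graph H S})"
  define J where "J = {(u, v). u \<in> {1..n} \<and> v \<in> {1..n} \<and> u \<noteq> v}"
  have Jsub: "J \<subseteq> {1..n} \<times> {1..n}" by (auto simp: J_def)
  have finJ: "finite J" using Jsub by (rule finite_subset) simp
  have "card J \<le> card ({1..n} \<times> {1..n})" by (rule card_mono[OF _ Jsub]) simp
  then have "card J \<le> n\<^sup>2" by (simp add: power2_eq_square)
  then have cardJ: "real (card J) \<le> (real n)\<^sup>2" using of_nat_mono[of "card J" "n\<^sup>2", where 'a=real] by simp
  define F where "F = (\<lambda>I A. {x \<in> space draw_space. \<forall>k\<in>I. x k \<in> A})"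
  have mF: "F I A \<in> sets draw_space" if fI: "finite I" for I A
  proof -
    obtain T where "I \<subseteq> {..<T}" using finite_nat_bounded[OF fI] by blast
    then show ?thesis unfolding F_def by (intro sets_PiM_samples_prefix[of T]) (metis lessThan_iff subsetD)
  qed
  have pF: "PD.prob (F I A) = measure (sample_space n m) A ^ card I" if "finite I" "A \<subseteq> \<Omega>" for I A
    using prob_draws_all[OF samples_axioms that(1), of A] that(2)
    by (simp add: F_def \<Omega>_def measure_def)
  have pfail: "measure (sample_space n m) (\<Omega> - Win p) \<le> 1 - s" if pJ: "p \<in> J" for p
  proof -
    obtain u v where p: "p = (u, v)" "u \<in> {1..n}" "v \<in> {1..n}" "u \<noteq> v" using pJ by (auto simp: J_def)
    have "s \<le> measure (sample_space n m) (Win p)"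
      unfolding p s_def Win_def prod.case by (rule pair_success_bound[OF p(2-4), unfolded sp])
    moreover have "Win p \<subseteq> space N" unfolding space_N \<Omega>_def[symmetric] by (auto simp: p Win_def)
    then have "prob (space N - Win p) = 1 - prob (Win p)" by (intro prob_compl mem_sets)
    then have "measure (sample_space n m) (\<Omega> - Win p) = 1 - measure (sample_space n m) (Win p)"
      by (simp only: N_def sp)
    ultimately show ?thesis by linarith
  qed
  define F1 where "F1 = (\<Union>k\<in>{..<t * B}. F {k} Bad)"
  define F2 where "F2 = (\<Union>p\<in>J. F {..<t} (\<Omega> - Win p))"
  \<comment> \<open>Success of a block is bounded below through the samples containing 1 and 2; any
    fixed pair would do.\<close>
  define F3 where "F3 = (\<Union>b\<in>{..<t}. F {b * B..<(b + 1) * B} (\<Omega> - Win (1, 2)))"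
  have mem: "F1 \<in> sets draw_space" "F2 \<in> sets draw_space" "F3 \<in> sets draw_space"
    unfolding F1_def F2_def F3_def using mF finJ by (auto intro!: sets.finite_UN)
  have sub: "{x \<in> space draw_space. \<not> main_succeeds n \<alpha> m t \<zeta> kernel D (U, W, x)} \<subseteq> F1 \<union> F2 \<union> F3"
  proof
    fix x assume "x \<in> {x \<in> space draw_space. \<not> main_succeeds n \<alpha> m t \<zeta> kernel D (U, W, x)}"
    then have x: "x \<in> space draw_space" and fail: "\<not> main_succeeds n \<alpha> m t \<zeta> kernel D (U, W, x)" by auto
    have x\<Omega>: "x k \<in> \<Omega>" for k
    proof -
      have "x k \<in> space (sample_space n m)" using x by (simp add: space_PiM PiE_iff)
      then show ?thesis by (simp only: sp)
    qed
    show "x \<in> F1 \<union> F2 \<union> F3"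
    proof (rule ccontr)
      assume no: "x \<notin> F1 \<union> F2 \<union> F3"
      have succ: "\<And>k u v. x k \<in> Win (u, v) \<Longrightarrow> k \<in> successes H x \<and> u \<in> x k \<and> v \<in> x k"
        by (auto simp: Win_def successes_def)
      have "main_succeeds n \<alpha> m t \<zeta> kernel D (U, W, x)"
      proof (rule E.main_succeeds_if[OF H_def refl _ okS okV])
        show "dense_points \<eta>\<^sub>V {1..n} U"
          using profile.scale_okD[OF okV] by (intro dense_vertices[OF gv n0 \<epsilon>_pos \<eta>V]) auto
        show "2 \<le> n" using n3 by simp
        show "real (card {k \<in> {1..n}. \<bar>U k - U i\<bar> < \<theta>}) \<le> M" if "i \<in> {1..n}" for i
          using few_near_vertices[OF gv n0 \<epsilon>_pos _ U that, of \<theta>] M(1) profile.scale_okD[OF okV] by auto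
        show "4 * M \<le> D" by (rule M(2))
        show "good_sample n m \<zeta> (2 / real K) \<eta> U (x k)" if "k < t * B" for k
          using no x x\<Omega>[of k] that by (auto simp: F1_def F_def Bad_def)
        show "\<exists>k\<in>successes H x. b * B \<le> k \<and> k < (b + 1) * B" if bt: "b < t" for b
        proof -
          have "x \<notin> F {b * B..<(b + 1) * B} (\<Omega> - Win (1, 2))" using no bt unfolding F3_def by blast
          then have "\<exists>k\<in>{b * B..<(b + 1) * B}. x k \<notin> \<Omega> - Win (1, 2)" using x unfolding F_def by blast
          then obtain k where "k \<in> {b * B..<(b + 1) * B}" "x k \<in> Win (1, 2)" using x\<Omega> by blast
          then show ?thesis using succ[of k 1 2] by auto
        qed
        show "\<exists>k\<in>successes H x. k < t \<and> u \<in> x k \<and> v \<in> x k" if uv: "u \<in> {1..n}" "v \<in> {1..n}" "u \<noteq> v" for u v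
        proof -
          have "(u, v) \<in> J" using uv by (simp add: J_def)
          then have "x \<notin> F {..<t} (\<Omega> - Win (u, v))" using no unfolding F2_def by blast
          then have "\<exists>k\<in>{..<t}. x k \<notin> \<Omega> - Win (u, v)" using x unfolding F_def by blast
          then obtain k where "k \<in> {..<t}" "x k \<in> Win (u, v)" using x\<Omega> by blast
          then show ?thesis using succ[of k u v] by auto
        qed
      qed
      then show False using fail by simp
    qed
  qed
  have p1: "PD.prob F1 \<le> real (t * B) * sample_defect K k \<beta>"
  proof -
    have "PD.prob F1 \<le> (\<Sum>k\<in>{..<t * B}. PD.prob (F {k} Bad))"
      unfolding F1_def using mF by (intro PD.finite_measure_subadditive_finite) auto
    also have "\<dots> \<le> (\<Sum>k'\<in>{..<t * B}. sample_defect K k \<beta>)"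
    proof (rule sum_mono)
      fix i
      have "PD.prob (F {i} Bad) = measure (sample_space n m) Bad"
        using pF[of "{i}" Bad] by (simp add: Bad_def)
      also have "\<dots> \<le> sample_defect K k \<beta>"
        unfolding Bad_def by (rule not_good_sample_bound[unfolded sp])
      finally show "PD.prob (F {i} Bad) \<le> sample_defect K k \<beta>" .
    qed
    finally show ?thesis by simp
  qed
  have p2: "PD.prob F2 \<le> (real n)\<^sup>2 * (1 - s) ^ t"
  proof -
    have "PD.prob F2 \<le> (\<Sum>p\<in>J. PD.prob (F {..<t} (\<Omega> - Win p)))"
      unfolding F2_def using mF finJ by (intro PD.finite_measure_subadditive_finite) auto
    also have "\<dots> \<le> (\<Sum>p\<in>J. (1 - s) ^ t)"
    proof (rule sum_mono)
      fix p assume "p \<in> J"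
      have "PD.prob (F {..<t} (\<Omega> - Win p)) = measure (sample_space n m) (\<Omega> - Win p) ^ t"
        using pF[of "{..<t}" "\<Omega> - Win p"] by simp
      also have "\<dots> \<le> (1 - s) ^ t" using pfail[OF \<open>p \<in> J\<close>] by (intro power_mono) auto
      finally show "PD.prob (F {..<t} (\<Omega> - Win p)) \<le> (1 - s) ^ t" .
    qed
    also have "\<dots> = real (card J) * (1 - s) ^ t" by simp
    also have "\<dots> \<le> (real n)\<^sup>2 * (1 - s) ^ t" using cardJ s01 by (intro mult_right_mono) auto
    finally show ?thesis .
  qed
  have J12: "(1, 2) \<in> J" using n3 by (simp add: J_def)
  have p3: "PD.prob F3 \<le> real t * (1 - s) ^ B"
  proof -
    have "PD.prob F3 \<le> (\<Sum>b\<in>{..<t}. PD.prob (F {b * B..<(b + 1) * B} (\<Omega> - Win (1, 2))))"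
      unfolding F3_def using mF by (intro PD.finite_measure_subadditive_finite) auto
    also have "\<dots> \<le> (\<Sum>b\<in>{..<t}. (1 - s) ^ B)"
    proof (rule sum_mono)
      fix b
      have "PD.prob (F {b * B..<(b + 1) * B} (\<Omega> - Win (1, 2))) = measure (sample_space n m) (\<Omega> - Win (1, 2)) ^ B"
        using pF[of "{b * B..<(b + 1) * B}" "\<Omega> - Win (1, 2)"] by simp
      also have "\<dots> \<le> (1 - s) ^ B" using pfail[OF J12] by (intro power_mono) auto
      finally show "PD.prob (F {b * B..<(b + 1) * B} (\<Omega> - Win (1, 2))) \<le> (1 - s) ^ B" .
    qed
    finally show ?thesis by simp
  qed
  have "PD.prob (F1 \<union> F2 \<union> F3) \<le> PD.prob F1 + PD.prob F2 + PD.prob F3"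
    using mem by (intro order_trans[OF measure_Un_le] add_right_mono measure_Un_le) auto
  also have "\<dots> \<le> draw_bound" using p1 p2 p3 by (simp add: draw_bound_def s_def)
  finally have "emeasure draw_space (F1 \<union> F2 \<union> F3) \<le> ennreal draw_bound"
    unfolding PD.emeasure_eq_measure by (rule ennreal_leI)
  then show ?thesis using emeasure_mono[OF sub] mem by (meson order_trans sets.Un)
qed

end

definition total_bound :: real where
  "total_bound = 12 * (real n)\<^sup>2 * exp (- 2 * \<epsilon>\<^sup>2 / real n) + draw_bound"

lemma success_probability:
  "1 - total_bound \<le> measure (run_space n m) {\<omega> \<in> space (run_space n m). main_succeeds n \<alpha> m t \<zeta> kernel D \<omega>}"
proof -
  let ?\<Omega> = "run_space n m"
  have PV: "prob_space (vertex_space n)" and PE: "prob_space (edge_space n)"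
    by (intro prob_space_PiM prob_space_unif01)+
  have PED: "prob_space (edge_space n \<Otimes>\<^sub>M draw_space)"
    by (intro prob_space_pair PE prob_space_draws)
  have run: "?\<Omega> = vertex_space n \<Otimes>\<^sub>M (edge_space n \<Otimes>\<^sub>M draw_space)" by (simp add: run_space_def)
  interpret PR: prob_space ?\<Omega> unfolding run by (intro prob_space_pair PV PED)
  define E where "E = exp (- 2 * \<epsilon>\<^sup>2 / real n)"
  have ker: "(\<lambda>(x, y). kernel x y) \<in> borel_measurable (borel \<Otimes>\<^sub>M borel)"
    unfolding case_prod_beta by (intro measurable_compose[OF _ phi_measurable] borel_measurable_diff) measurable
  define G where "G = {\<omega> \<in> space ?\<Omega>. main_succeeds n \<alpha> m t \<zeta> kernel D \<omega>}"
  have G: "G \<in> sets ?\<Omega>" unfolding G_def by (rule sets_main_succeeds[OF ker])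
  define X where "X = space ?\<Omega> - G"
  have X: "X \<in> sets ?\<Omega>" unfolding X_def using G by auto
  have X_iff: "(U, W, x) \<in> X \<longleftrightarrow> U \<in> space (vertex_space n) \<and> W \<in> space (edge_space n) \<and> x \<in> space draw_space \<and>
      \<not> main_succeeds n \<alpha> m t \<zeta> kernel D (U, W, x)" for U W x
    by (auto simp: X_def G_def run space_pair_measure)
  \<comment> \<open>Needed to merge the \<open>ennreal\<close> bounds into one, since negative
    numbers are mapped to 0.\<close>
  have db0: "0 \<le> draw_bound"
  proof -
    have "1 \<le> (real n)\<^sup>2" using n0 by (simp add: one_le_power)
    then have "0 < 2 * (real n)\<^sup>2" "1 \<le> 2 * (real n)\<^sup>2" by linarith+
    then have "1 / (2 * (real n)\<^sup>2) \<le> 1" by (simp only: divide_le_eq_1_pos)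
    then have "0 \<le> 1 - 1 / (2 * (real n)\<^sup>2)" by simp
    moreover have "0 \<le> sample_defect K k \<beta>"
    proof -
      have "2 + \<epsilon> \<le> real n * 1" "0 \<le> 2 / real K + \<eta>" using \<eta>V profile.scale_okD[OF okV] profile.scale_okD[OF okS(1)] 
        using mult_left_mono[of "\<eta>\<^sub>V" 1 "real n"] by auto
      then have "0 \<le> real n * (2 / real K + \<eta>)" by simp
      then have "0 \<le> \<beta> * real n" using \<beta> \<epsilon>_pos by linarith
      then have "0 \<le> \<beta>" using n0 by (simp add: zero_le_mult_iff)
      moreover have "0 \<le> 1 - 1 / (2 * real K)" using K_pos by (simp add: field_simps)
      ultimately show ?thesis by (auto simp: sample_defect_def intro!: add_nonneg_nonneg mult_nonneg_nonneg divide_nonneg_nonneg)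
    qed
    ultimately show ?thesis by (auto simp: draw_bound_def intro!: add_nonneg_nonneg mult_nonneg_nonneg)
  qed
  have "emeasure ?\<Omega> X \<le> ennreal (10 * (real n)\<^sup>2 * E) + (ennreal (2 * (real n)\<^sup>2 * E) + ennreal draw_bound)"
    unfolding run
  proof (rule pair_slice_bound[OF PV PED X[unfolded run] bad_vertices_bound[OF n3 \<epsilon>_pos, folded E_def]])
    fix U assume Us: "U \<in> space (vertex_space n)" "U \<notin> {U \<in> space (vertex_space n). \<not> good_vertices n \<epsilon> U}"
    then have gv: "good_vertices n \<epsilon> U" and U: "\<And>v. v \<in> {1..n} \<Longrightarrow> U v \<in> {0..1}"
      by (auto simp: space_PiM PiE_def Pi_def)
    show "emeasure (edge_space n \<Otimes>\<^sub>M draw_space) (Pair U -` X) \<le> ennreal (2 * (real n)\<^sup>2 * E) + ennreal draw_bound"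
    proof (rule pair_slice_bound[OF PE prob_space_draws sets_Pair1[OF X[unfolded run]] bad_edges_bound[OF n3 \<epsilon>_pos, folded E_def]])
      fix W assume Ws: "W \<in> space (edge_space n)" "W \<notin> {W \<in> space (edge_space n). \<not> good_edges n \<epsilon> U W}"
      then have ge: "good_edges n \<epsilon> U W" by simp
      have "Pair W -` (Pair U -` X) = {x \<in> space draw_space. \<not> main_succeeds n \<alpha> m t \<zeta> kernel D (U, W, x)}"
        using Us Ws X_iff by auto
      then show "emeasure draw_space (Pair W -` (Pair U -` X)) \<le> ennreal draw_bound"
        using draws_bound[OF U gv ge] by simp
    qed
  qed
  also have "\<dots> = ennreal (10 * (real n)\<^sup>2 * E + (2 * (real n)\<^sup>2 * E + draw_bound))"
    using db0 by (simp add: ennreal_plus[symmetric] E_def del: ennreal_plus)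
  also have "10 * (real n)\<^sup>2 * E + (2 * (real n)\<^sup>2 * E + draw_bound) = total_bound"
    by (simp add: total_bound_def E_def)
  finally have "ennreal (PR.prob X) \<le> ennreal total_bound" by (simp only: PR.emeasure_eq_measure)
  moreover have "0 \<le> total_bound" using db0 by (simp add: total_bound_def)
  ultimately have "PR.prob X \<le> total_bound" by (simp only: ennreal_le_iff)
  moreover have "PR.prob X = 1 - PR.prob G" unfolding X_def by (rule PR.prob_compl[OF G])
  ultimately show ?thesis by (simp add: G_def)
qed

end

section \<open>Asymptotics\<close>

text \<open>The left side is one term of the exponential series at \<open>k\<close>; it acts as the
  Stirling bound for \<open>fact k\<close>.\<close>

lemma power_div_fact_le_exp: "real k ^ k / fact k \<le> exp (real k)"
proof -
  have "(\<Sum>i\<in>{k}. real k ^ i /\<^sub>R fact i) \<le> (\<Sum>i. real k ^ i /\<^sub>R fact i)"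
    by (intro sum_le_suminf summable_exp_generic) auto
  then show ?thesis by (simp add: exp_def field_simps)
qed

lemma one_minus_power_le_exp:
  assumes "0 \<le> x" "x \<le> (1::real)"
  shows "(1 - x) ^ k \<le> exp (- (x * real k))"
proof -
  have "1 - x \<le> exp (- x)" using exp_ge_add_one_self[of "-x"] by simp
  then have "(1 - x) ^ k \<le> exp (- x) ^ k" using assms by (intro power_mono) auto
  also have "\<dots> = exp (- (x * real k))" by (simp add: exp_of_nat_mult[symmetric] mult.commute)
  finally show ?thesis .
qed

text \<open>With L^3 bins a sample of size about L^5 is expected to hit each bin of a typical vertex
  set about L^2 times, so a bin is missed with probability at most about exp (-L^2 / 2).\<close>

definition K_of :: "nat \<Rightarrow> nat" where "K_of n = nat \<lceil>ln (real n) ^ 3\<rceil>"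
definition k_of :: "nat \<Rightarrow> nat" where "k_of n = nat \<lceil>zeta_param n\<rceil>"

lemma K_of_bounds:
  assumes "0 \<le> ln (real n)"
  shows "ln (real n) ^ 3 \<le> real (K_of n)" "real (K_of n) \<le> ln (real n) ^ 3 + 1"
proof -
  have "real (K_of n) = real_of_int \<lceil>ln (real n) ^ 3\<rceil>" using assms by (simp add: K_of_def)
  then show "ln (real n) ^ 3 \<le> real (K_of n)" "real (K_of n) \<le> ln (real n) ^ 3 + 1" by linarith+
qed

lemma k_of_bounds:
  assumes "0 \<le> ln (real n)"
  shows "zeta_param n \<le> real (k_of n)" "real (k_of n) < zeta_param n + 1"
proof -
  have "0 \<le> zeta_param n" using assms by (simp add: zeta_param_def)
  then have "real (k_of n) = real_of_int \<lceil>zeta_param n\<rceil>" by (simp add: k_of_def)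
  then show "zeta_param n \<le> real (k_of n)" "real (k_of n) < zeta_param n + 1" by linarith+
qed

lemma nat_round_bounds:
  fixes x :: real
  assumes "0 \<le> x"
  shows "x - 1 \<le> real (nat (round x))" "real (nat (round x)) \<le> x + 1"
proof -
  have "0 \<le> round x" using round_mono[OF assms] by simp
  then have "real (nat (round x)) = real_of_int (round x)" by simp
  then show "x - 1 \<le> real (nat (round x))" "real (nat (round x)) \<le> x + 1"
    using of_int_round_abs_le[of x] by linarith+
qed

lemmas m_param_bounds = nat_round_bounds[of "ln (real n) ^ 5" for n, folded m_param_def]
lemmas t_param_bounds = nat_round_bounds[of "(real n * ln (real n))\<^sup>2" for n, folded t_param_def]

text \<open>A bound for \<open>sample_defect\<close> in which all roundings are gone, as an
  expression in the single real variable ln n.\<close>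

definition log_defect :: "real \<Rightarrow> real" where
  "log_defect L = (L ^ 3 + 1) * exp (- ((L ^ 5 - 1) / (2 * (L ^ 3 + 1))))
     + 2 * ((L ^ 5 + 1) powr (4 * L ^ 4 + 1) * (7 / 8) powr (L ^ 5 - 4 * L ^ 4 - 2)) + exp (- (4 * L ^ 4))"

lemma sample_defect_le:
  assumes s: "samples n (m_param n)" and L: "L = ln (real n)" "1 \<le> L"
    and k: "k_of n \<le> m_param n"
    and r: "(L ^ 5 + 1) * (4 / L\<^sup>2) * exp 1 / (4 * L ^ 4) \<le> exp (- 1)"
  shows "samples.sample_defect (m_param n) (K_of n) (k_of n) (4 / L\<^sup>2) \<le> log_defect L"
proof -
  interpret samples n "m_param n" by fact
  define m where "m = m_param n"
  define k where "k = k_of n"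
  define K where "K = K_of n"
  have L0: "0 \<le> ln (real n)" using L by simp
  have m: "L ^ 5 - 1 \<le> real m" "real m \<le> L ^ 5 + 1"
    using m_param_bounds[of n] L by (auto simp: m_def)
  have K: "L ^ 3 \<le> real K" "real K \<le> L ^ 3 + 1" using K_of_bounds[OF L0] L by (auto simp: K_def)
  have kk: "4 * L ^ 4 \<le> real k" "real k \<le> 4 * L ^ 4 + 1"
    using k_of_bounds[OF L0] L by (auto simp: k_def zeta_param_def)
  have L3: "1 \<le> L ^ 3" "1 \<le> L ^ 4" "1 \<le> L ^ 5" using L(2) by (auto intro: one_le_power)
  have K1: "1 \<le> real K" using K L3 by linarith
  have 1: "real K * (1 - 1 / (2 * real K)) ^ m \<le> (L ^ 3 + 1) * exp (- ((L ^ 5 - 1) / (2 * (L ^ 3 + 1))))"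
  proof (intro mult_mono)
    have "(1 - 1 / (2 * real K)) ^ m \<le> exp (- (1 / (2 * real K) * real m))"
      using K1 by (intro one_minus_power_le_exp) (auto simp: divide_le_eq)
    also have "\<dots> \<le> exp (- ((L ^ 5 - 1) / (2 * (L ^ 3 + 1))))"
    proof -
      have "(L ^ 5 - 1) / (2 * (L ^ 3 + 1)) \<le> real m / (2 * real K)"
        using m K K1 L3 by (intro frac_le) auto
      then show ?thesis by simp
    qed
    finally show "(1 - 1 / (2 * real K)) ^ m \<le> exp (- ((L ^ 5 - 1) / (2 * (L ^ 3 + 1))))" .
  qed (use K K1 L3 in \<open>auto intro!: zero_le_power simp: divide_le_eq\<close>)
  have km: "k \<le> m" using assms(4) by (simp add: k_def m_def)
  have m0: "1 \<le> real m" using m4 by (simp add: m_def)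
  have 2: "real m ^ k * (7 / 8) ^ (m - k) \<le> (L ^ 5 + 1) powr (4 * L ^ 4 + 1) * (7 / 8) powr (L ^ 5 - 4 * L ^ 4 - 2)"
  proof (intro mult_mono)
    have "real m ^ k = real m powr real k" using m0 by (simp add: powr_realpow)
    also have "\<dots> \<le> (L ^ 5 + 1) powr real k" using m m0 by (intro powr_mono2) auto
    also have "\<dots> \<le> (L ^ 5 + 1) powr (4 * L ^ 4 + 1)" using kk L3 L(2) by (intro powr_mono) auto
    finally show "real m ^ k \<le> (L ^ 5 + 1) powr (4 * L ^ 4 + 1)" .
    have "(7 / 8 :: real) ^ (m - k) = (7 / 8) powr (real m - real k)"
      using km by (simp add: powr_realpow[symmetric] of_nat_diff)
    also have "\<dots> \<le> (7 / 8) powr (L ^ 5 - 4 * L ^ 4 - 2)"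
      using m kk by (intro powr_mono') auto
    finally show "(7 / 8 :: real) ^ (m - k) \<le> (7 / 8) powr (L ^ 5 - 4 * L ^ 4 - 2)" .
  qed auto
  have 3: "(real m * (4 / L\<^sup>2)) ^ k / fact k \<le> exp (- (4 * L ^ 4))"
  proof -
    have k0: "0 < real k" using kk L3 by linarith
    have L2: "0 < L\<^sup>2" using L(2) by simp
    \<comment> \<open>By the Stirling bound the third term is at most \<open>x ^ k\<close>, and
      \<open>x\<close> is of order 1 / L, which eventually lies below exp (-1).\<close>
    define x where "x = real m * (4 / L\<^sup>2) * exp 1 / real k"
    have x0: "0 \<le> x" using L2 k0 by (simp add: x_def)
    have "x \<le> (L ^ 5 + 1) * (4 / L\<^sup>2) * exp 1 / (4 * L ^ 4)"
      unfolding x_def using m kk L3 L2 by (intro frac_le mult_right_mono mult_nonneg_nonneg) auto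
    then have xe: "x \<le> exp (- 1)" using r by simp
    have "(real m * (4 / L\<^sup>2)) ^ k / fact k = (real m * (4 / L\<^sup>2)) ^ k / real k ^ k * (real k ^ k / fact k)"
      using k0 by simp
    also have "\<dots> \<le> (real m * (4 / L\<^sup>2)) ^ k / real k ^ k * exp (real k)"
      using L2 by (intro mult_left_mono power_div_fact_le_exp) auto
    also have "exp (real k) = exp 1 ^ k" by (simp add: exp_of_nat_mult[symmetric])
    also have "(real m * (4 / L\<^sup>2)) ^ k / real k ^ k * exp 1 ^ k = x ^ k"
      by (simp add: x_def power_mult_distrib power_divide)
    also have "\<dots> \<le> exp (- 1) ^ k" using x0 xe by (intro power_mono)
    also have "\<dots> = exp (- real k)" by (simp add: exp_of_nat_mult[symmetric])
    also have "\<dots> \<le> exp (- (4 * L ^ 4))" using kk by simp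
    finally show ?thesis .
  qed
  show ?thesis
    unfolding sample_defect_def log_defect_def using 1 2 3
    unfolding m_def k_def K_def by linarith
qed

context interval_graphon
begin

text \<open>The deviation sqrt n ln n makes the Hoeffding bound exp (-2 (ln n)^2). It forces
  \<open>e\<close> to be slightly above 2 ln n / sqrt n, and the factor 4 leaves room. The fraction
  4 / (ln n)^2 exceeds the length of the end interval, which is about 1 / (ln n)^2.\<close>

lemma eventually_finite_run:
  "\<forall>\<^sub>F n in sequentially. finite_run \<phi> c d \<alpha> \<mu> \<kappa> n (m_param n) (K_of n) (k_of n)
      (sqrt (real n) * ln (real n)) (4 * ln (real n) / sqrt (real n)) (1 / (ln (real n))\<^sup>2)
      (4 * ln (real n) / sqrt (real n)) ((ln (real n))\<^sup>2 / sqrt (real n)) (zeta_param n)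
      (4 / (ln (real n))\<^sup>2)
      (real n * (2 * ((ln (real n))\<^sup>2 / sqrt (real n))) + 2 + sqrt (real n) * ln (real n))
      (2 * (real n * (2 * (4 * ln (real n) / sqrt (real n)) / \<kappa>) + 2 + sqrt (real n) * ln (real n)))
      (sqrt (real n) * ln (real n) ^ 5)"
proof -
  note pos = profile.d_pos profile.\<mu>_pos profile.\<kappa>_pos
  have half: "(0::real) < 1/2" "(0::real) < 1/4" "(0::real) < 1/8" by simp_all
  have l1: "((\<lambda>n. 3 * (2 / ln (real n) ^ 3)) \<longlongrightarrow> 0) sequentially" by real_asymp
  have l2: "((\<lambda>n. 2 / ln (real n) ^ 3) \<longlongrightarrow> 0) sequentially" by real_asymp
  have l3: "((\<lambda>n. 2 * (4 * ln (real n) / sqrt (real n)) + 3 * (2 / ln (real n) ^ 3)) \<longlongrightarrow> 0) sequentially" by real_asymp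
  \<comment> \<open>The resolution condition of the samples, multiplied by (ln n)^2.\<close>
  have l4: "((\<lambda>n. (3 * (4 * ln (real n) / sqrt (real n)) + 3 * (2 / ln (real n) ^ 3)) * (ln (real n))\<^sup>2) \<longlongrightarrow> 0) sequentially" by real_asymp
  have l5: "((\<lambda>n. 1 / (ln (real n))\<^sup>2) \<longlongrightarrow> 0) sequentially" by real_asymp
  have l6: "((\<lambda>n. 3 * (4 * ln (real n) / sqrt (real n))) \<longlongrightarrow> 0) sequentially" by real_asymp
  have l7: "((\<lambda>n. 2 * (4 * ln (real n) / sqrt (real n)) + 3 * (4 * ln (real n) / sqrt (real n))) \<longlongrightarrow> 0) sequentially" by real_asymp
  \<comment> \<open>The resolution condition of the refinement: here spacing and uncertainty are
    both 4 ln n / sqrt n, and six times this divided by (ln n)^2 / sqrt n is 24 / ln n.\<close>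
  have l8: "((\<lambda>n. 24 / ln (real n)) \<longlongrightarrow> 0) sequentially" by real_asymp
  have s1: "((\<lambda>n. sqrt (real n) * ln (real n) * (2 * (ln (real n) ^ 5 + 1) + (ln (real n) ^ 5 + 1)\<^sup>2) / real n) \<longlongrightarrow> 0) sequentially" by real_asymp
  have s2: "((\<lambda>n. (4 + 2 * sqrt (real n) * ln (real n)) * (2 * (ln (real n) ^ 5 + 1) + (ln (real n) ^ 5 + 1)\<^sup>2) / real n) \<longlongrightarrow> 0) sequentially" by real_asymp
  have s3: "((\<lambda>n. 16 / \<kappa> * (sqrt (real n) * ln (real n) * (2 * (ln (real n) ^ 5 + 1) + (ln (real n) ^ 5 + 1)\<^sup>2) / real n)
     + (4 + 2 * sqrt (real n) * ln (real n)) * (2 * (ln (real n) ^ 5 + 1) + (ln (real n) ^ 5 + 1)\<^sup>2) / real n) \<longlongrightarrow> 16 / \<kappa> * 0 + 0) sequentially"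
    by (intro tendsto_add tendsto_mult tendsto_const s1 s2)
  then have s3': "((\<lambda>n. 16 / \<kappa> * (sqrt (real n) * ln (real n) * (2 * (ln (real n) ^ 5 + 1) + (ln (real n) ^ 5 + 1)\<^sup>2) / real n)
     + (4 + 2 * sqrt (real n) * ln (real n)) * (2 * (ln (real n) ^ 5 + 1) + (ln (real n) ^ 5 + 1)\<^sup>2) / real n) \<longlongrightarrow> 0) sequentially"
    by simp
  have a1: "\<forall>\<^sub>F n in sequentially. 4 \<le> n \<and> 2 \<le> ln (real n)" 
    by (intro eventually_conj eventually_ge_at_top) real_asymp
  have a2: "\<forall>\<^sub>F n in sequentially. 4 + 1 \<le> ln (real n) ^ 5 \<and> ln (real n) ^ 5 + 1 \<le> real n"
    by (intro eventually_conj; real_asymp)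
  have a3: "\<forall>\<^sub>F n in sequentially. 4 * (real n * (2 * ((ln (real n))\<^sup>2 / sqrt (real n))) + 2 + sqrt (real n) * ln (real n)) \<le> sqrt (real n) * ln (real n) ^ 5"
    by real_asymp
  have a4: "\<forall>\<^sub>F n in sequentially. 2 + sqrt (real n) * ln (real n) \<le> real n / (2 * (ln (real n) ^ 3 + 1))"
    by real_asymp
  have a5: "\<forall>\<^sub>F n in sequentially. 2 + sqrt (real n) * ln (real n) \<le> real n / 8"
    by real_asymp
  have a6: "\<forall>\<^sub>F n in sequentially. real n * (2 / ln (real n) ^ 3 + 1 / (ln (real n))\<^sup>2) + 2 + sqrt (real n) * ln (real n) \<le> 4 / (ln (real n))\<^sup>2 * real n"
    by real_asymp
  have a7: "\<forall>\<^sub>F n in sequentially. 4 * ln (real n) ^ 4 + 1 \<le> ln (real n) ^ 5 - 1"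
    by real_asymp
  have a8: "\<forall>\<^sub>F n in sequentially. log_defect (ln (real n)) \<le> 1 / (4 * (real n)\<^sup>2)"
    unfolding log_defect_def by real_asymp
  have a9: "\<forall>\<^sub>F n in sequentially. (ln (real n) ^ 5 + 1) * (4 / (ln (real n))\<^sup>2) * exp 1 / (4 * ln (real n) ^ 4) \<le> exp (- 1)"
    by real_asymp
  have a10: "\<forall>\<^sub>F n in sequentially. 2 * (sqrt (real n) * ln (real n)) \<le> (real n - 2) * (4 * ln (real n) / sqrt (real n))"
    by real_asymp
  have a11: "\<forall>\<^sub>F n in sequentially. 2 + sqrt (real n) * ln (real n) < real n * (4 * ln (real n) / sqrt (real n))"
    by real_asymp
  show ?thesis
    using order_tendstoD(2)[OF l1 pos(1)] order_tendstoD(2)[OF l2 half(1)] order_tendstoD(2)[OF l3 pos(2)]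
      order_tendstoD(2)[OF l4 pos(3)] order_tendstoD(2)[OF l5 half(2)] order_tendstoD(2)[OF l5 pos(1)]
      order_tendstoD(2)[OF l6 pos(1)] order_tendstoD(2)[OF l6 half(1)] order_tendstoD(2)[OF l7 pos(2)] order_tendstoD(2)[OF l8 pos(3)]
      order_tendstoD(2)[OF s3' half(2)] a1 a2 a3 a4 a5 a6 a7 a8 a9 a10 a11
  proof eventually_elim
    case (elim n)
    define L where "L = ln (real n)"
    define s where "s = sqrt (real n)"
    note el = elim[folded L_def s_def]
    have n4: "4 \<le> n" and L2: "2 \<le> L" using el by auto
    have s0: "0 < s" and ss: "s * s = real n" using n4 by (auto simp: s_def)
    have L0: "0 \<le> ln (real n)" using L2 by (simp add: L_def)
    have K: "L ^ 3 \<le> real (K_of n)" "real (K_of n) \<le> L ^ 3 + 1" using K_of_bounds[OF L0] by (auto simp: L_def)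
    have L3: "0 < L ^ 3" "0 < L\<^sup>2" using L2 by auto
    have K0: "0 < K_of n" using K L3 by (metis gr0I linorder_not_less of_nat_0)
    have K2: "2 / real (K_of n) \<le> 2 / L ^ 3" using K L3 K0 by (intro divide_left_mono mult_pos_pos) auto
    have m: "L ^ 5 - 1 \<le> real (m_param n)" "real (m_param n) \<le> L ^ 5 + 1"
      using m_param_bounds[of n] L2 by (auto simp: L_def)
    have kk: "zeta_param n \<le> real (k_of n)" "real (k_of n) < zeta_param n + 1"
      using k_of_bounds[OF L0] by auto
    have samples: "samples n (m_param n)"
    proof
      have "real 4 \<le> real (m_param n)" using m el by linarith
      then show "4 \<le> m_param n" by (simp only: of_nat_le_iff)
      have "real (m_param n) \<le> real n" using m el by linarith
      then show "m_param n \<le> n" by (simp only: of_nat_le_iff)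
    qed
    have km: "k_of n \<le> m_param n"
    proof -
      have "real (k_of n) \<le> real (m_param n)" using kk m el unfolding zeta_param_def L_def[symmetric] by linarith
      then show ?thesis by (simp only: of_nat_le_iff)
    qed
    interpret samples n "m_param n" by (rule samples)
    show ?case
      unfolding L_def[symmetric] s_def[symmetric]
    proof unfold_locales
      show "0 < s * L" using s0 L2 by simp
      show "2 * (s * L) \<le> (real n - 2) * (4 * L / s)" using el by simp
      show "0 < K_of n" by (rule K0)
      show "profile.scale_ok (4 * L / s) (2 / real (K_of n)) (1 / L\<^sup>2)"
        unfolding profile.scale_ok_def
      proof (intro conjI)
        have "3 * (4 * L / s) + 3 * (2 / L ^ 3) < \<kappa> * (1 / L\<^sup>2)"
          using el L3 by (simp add: pos_less_divide_eq)
        then show "3 * (4 * L / s) + 3 * (2 / real (K_of n)) < \<kappa> * (1 / L\<^sup>2)" using K2 by linarith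
        show "0 \<le> 4 * L / s" using L2 s0 by simp
        show "0 < 2 / real (K_of n)" using K0 by simp
        show "3 * (2 / real (K_of n)) \<le> d" "2 / real (K_of n) < 1/2"
          "2 * (4 * L / s) + 3 * (2 / real (K_of n)) < \<mu>" using el K2 by linarith+
      qed
      show "1 / L\<^sup>2 \<le> 1/4" "1 / L\<^sup>2 \<le> d" using el by linarith+
      show "profile.scale_ok (4 * L / s) (4 * L / s) (L\<^sup>2 / s)"
        unfolding profile.scale_ok_def
      proof (intro conjI)
        show "0 \<le> 4 * L / s" "0 < 4 * L / s" using L2 s0 by simp_all
        show "3 * (4 * L / s) \<le> d" "4 * L / s < 1/2" "2 * (4 * L / s) + 3 * (4 * L / s) < \<mu>" 
          using el \<open>0 \<le> 4 * L / s\<close> by linarith+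
        have "24 < \<kappa> * L" using el L2 by (simp add: pos_divide_less_eq)
        then have "24 * (L / s) < \<kappa> * L * (L / s)" using L2 s0 by (intro mult_strict_right_mono) auto
        then show "3 * (4 * L / s) + 3 * (4 * L / s) < \<kappa> * (L\<^sup>2 / s)" by (simp add: power2_eq_square)
      qed
      show "2 + s * L < real n * (4 * L / s)" using el by simp
      show "real n * (2 * (L\<^sup>2 / s)) + 2 + s * L \<le> real n * (2 * (L\<^sup>2 / s)) + 2 + s * L" by simp
      show "4 * (real n * (2 * (L\<^sup>2 / s)) + 2 + s * L) \<le> s * L ^ 5" using el by simp
      show "2 * (real n * (2 * (4 * L / s) / \<kappa>) + 2 + s * L) \<le> 2 * (real n * (2 * (4 * L / s) / \<kappa>) + 2 + s * L)" by simp
      have "real n / (2 * (L ^ 3 + 1)) \<le> real n / (2 * real (K_of n))"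
      proof (rule divide_left_mono)
        have p: "0 < 2 * (L ^ 3 + 1)" using L3(1) by (simp add: add_pos_pos)
        have "0 < 2 * real (K_of n)" using K0 by simp
        then show "0 < 2 * (L ^ 3 + 1) * (2 * real (K_of n))" by (rule mult_pos_pos[OF p])
      qed (use K in auto)
      then show "2 + s * L \<le> real n / (2 * real (K_of n))" using el by linarith
      show "2 + s * L \<le> real n / 8" using el by simp
      have "real n * (2 / real (K_of n) + 1 / L\<^sup>2) \<le> real n * (2 / L ^ 3 + 1 / L\<^sup>2)"
        using K2 by (intro mult_left_mono) auto
      then show "real n * (2 / real (K_of n) + 1 / L\<^sup>2) + 2 + s * L \<le> 4 / L\<^sup>2 * real n" using el by linarith
      show "zeta_param n \<le> real (k_of n)" "real (k_of n) < zeta_param n + 1" by (rule kk)+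
      show "k_of n \<le> m_param n" by (rule km)
      define R where "R = 2 * (real n * (2 * (4 * L / s) / \<kappa>) + 2 + s * L)"
      have Req: "R = 16 / \<kappa> * (s * L) + (4 + 2 * s * L)"
        using s0 profile.\<kappa>_pos by (simp add: R_def ss[symmetric] field_simps)
      have R0: "0 \<le> R" using s0 L2 profile.\<kappa>_pos by (simp add: Req)
      have "2 * R * (real (m_param n) / real n) + R * (real (m_param n))\<^sup>2 / real n
          = R * (2 * real (m_param n) + (real (m_param n))\<^sup>2) / real n"
        by (simp add: add_divide_distrib distrib_left)
      also have "\<dots> \<le> R * (2 * (L ^ 5 + 1) + (L ^ 5 + 1)\<^sup>2) / real n"
        using m R0 by (intro divide_right_mono mult_left_mono add_mono power_mono) auto
      also have "\<dots> = 16 / \<kappa> * (s * L * (2 * (L ^ 5 + 1) + (L ^ 5 + 1)\<^sup>2) / real n)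
          + (4 + 2 * s * L) * (2 * (L ^ 5 + 1) + (L ^ 5 + 1)\<^sup>2) / real n"
        unfolding Req by (simp only: distrib_right add_divide_distrib times_divide_eq_right mult.assoc)
      also have "\<dots> \<le> 1/4" using el by linarith
      finally show "2 * (2 * (real n * (2 * (4 * L / s) / \<kappa>) + 2 + s * L)) * (real (m_param n) / real n)
         + 2 * (real n * (2 * (4 * L / s) / \<kappa>) + 2 + s * L) * (real (m_param n))\<^sup>2 / real n \<le> 1/4"
        unfolding R_def .
      have "sample_defect (K_of n) (k_of n) (4 / L\<^sup>2) \<le> log_defect L"
        using el L2 km by (intro sample_defect_le[OF samples]) (auto simp: L_def)
      then show "sample_defect (K_of n) (k_of n) (4 / L\<^sup>2) \<le> 1 / (4 * (real n)\<^sup>2)" using el by linarith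
    qed
  qed
qed

text \<open>With L = ln n the target probability of failure is exp (-L powr (3/2)). The slowest
  error terms are of order exp (-L^2 / 2) times powers of n, that is exp (-L^2 / 2 + O(L)) up to
  lower order factors, so the exponent \<open>1/2\<close> suffices.\<close>

lemma eventually_success:
  "\<forall>\<^sub>F n in sequentially. 1 - real n powr (- 1 * ln (real n) powr (1/2)) \<le>
     measure (run_space n (m_param n)) {\<omega> \<in> space (run_space n (m_param n)).
       main_succeeds n \<alpha> (m_param n) (t_param n) (zeta_param n) kernel (sqrt (real n) * ln (real n) ^ 5) \<omega>}"
proof -
  have b1: "\<forall>\<^sub>F n in sequentially. 12 * (real n)\<^sup>2 * exp (- 2 * (ln (real n))\<^sup>2) \<le> 1/4 * real n powr (- 1 * ln (real n) powr (1/2))"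
    by real_asymp
  have b2: "\<forall>\<^sub>F n in sequentially. ((real n * ln (real n))\<^sup>2 + 1) * (real n) ^ 3 * log_defect (ln (real n)) \<le> 1/4 * real n powr (- 1 * ln (real n) powr (1/2))"
    unfolding log_defect_def by real_asymp
  have b3: "\<forall>\<^sub>F n in sequentially. (real n)\<^sup>2 * exp (- (((real n * ln (real n))\<^sup>2 - 1) / (2 * (real n)\<^sup>2))) \<le> 1/4 * real n powr (- 1 * ln (real n) powr (1/2))"
    by real_asymp
  have b4: "\<forall>\<^sub>F n in sequentially. ((real n * ln (real n))\<^sup>2 + 1) * exp (- (real n ^ 3 / (2 * (real n)\<^sup>2))) \<le> 1/4 * real n powr (- 1 * ln (real n) powr (1/2))"
    by real_asymp
  have a1: "\<forall>\<^sub>F n in sequentially. 1 \<le> ln (real n)" by real_asymp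
  have a9: "\<forall>\<^sub>F n in sequentially. (ln (real n) ^ 5 + 1) * (4 / (ln (real n))\<^sup>2) * exp 1 / (4 * ln (real n) ^ 4) \<le> exp (- 1)"
    by real_asymp
  show ?thesis
    using eventually_finite_run b1 b2 b3 b4 a1 a9
  proof eventually_elim
    case (elim n)
    \<comment> \<open>Blocks of \<open>n ^ 3\<close> draws contain at least n / 2 successes on
      average, so that a block without success has probability at most exp (-n / 2).\<close>
    interpret finite_run \<phi> c d \<alpha> \<mu> \<kappa> n "m_param n" "t_param n" "n ^ 3" "K_of n" "k_of n"
      "sqrt (real n) * ln (real n)" "4 * ln (real n) / sqrt (real n)" "1 / (ln (real n))\<^sup>2"
      "4 * ln (real n) / sqrt (real n)" "(ln (real n))\<^sup>2 / sqrt (real n)" "zeta_param n" "4 / (ln (real n))\<^sup>2"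
      "real n * (2 * ((ln (real n))\<^sup>2 / sqrt (real n))) + 2 + sqrt (real n) * ln (real n)"
      "2 * (real n * (2 * (4 * ln (real n) / sqrt (real n)) / \<kappa>) + 2 + sqrt (real n) * ln (real n))"
      "sqrt (real n) * ln (real n) ^ 5"
      by (rule elim(1))
    have t: "(real n * ln (real n))\<^sup>2 - 1 \<le> real (t_param n)" "real (t_param n) \<le> (real n * ln (real n))\<^sup>2 + 1"
      using t_param_bounds[of n] by auto
    have x: "0 \<le> 1 / (2 * (real n)\<^sup>2)" "1 / (2 * (real n)\<^sup>2) \<le> 1"
    proof -
      have "1 \<le> (real n)\<^sup>2" using n0 by (simp add: one_le_power)
      then have "0 < 2 * (real n)\<^sup>2" "1 \<le> 2 * (real n)\<^sup>2" by linarith+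
      then show "0 \<le> 1 / (2 * (real n)\<^sup>2)" "1 / (2 * (real n)\<^sup>2) \<le> 1" by (simp_all only: divide_le_eq_1_pos) simp
    qed
    have d: "sample_defect (K_of n) (k_of n) (4 / (ln (real n))\<^sup>2) \<le> log_defect (ln (real n))"
      using elim(6,7) k(3) by (intro sample_defect_le[OF samples_axioms refl]) auto
    have ld0: "0 \<le> log_defect (ln (real n))"
      using elim(6) by (auto simp: log_defect_def intro!: add_nonneg_nonneg mult_nonneg_nonneg)
    have 1: "- 2 * (sqrt (real n) * ln (real n))\<^sup>2 / real n = - 2 * (ln (real n))\<^sup>2"
      using n0 by (simp add: power_mult_distrib)
    have 2: "real (t_param n * n ^ 3) * sample_defect (K_of n) (k_of n) (4 / (ln (real n))\<^sup>2)
       \<le> ((real n * ln (real n))\<^sup>2 + 1) * (real n) ^ 3 * log_defect (ln (real n))"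
    proof -
      have "real (t_param n * n ^ 3) * sample_defect (K_of n) (k_of n) (4 / (ln (real n))\<^sup>2)
          \<le> real (t_param n * n ^ 3) * log_defect (ln (real n))"
        by (rule mult_left_mono[OF d]) simp
      also have "\<dots> = real (t_param n) * (real n) ^ 3 * log_defect (ln (real n))" by simp
      also have "\<dots> \<le> ((real n * ln (real n))\<^sup>2 + 1) * (real n) ^ 3 * log_defect (ln (real n))"
        using t ld0 by (intro mult_right_mono) auto
      finally show ?thesis .
    qed
    have 3: "(real n)\<^sup>2 * (1 - 1 / (2 * (real n)\<^sup>2)) ^ t_param n \<le> (real n)\<^sup>2 * exp (- (((real n * ln (real n))\<^sup>2 - 1) / (2 * (real n)\<^sup>2)))"
    proof (rule mult_left_mono)
      have "(1 - 1 / (2 * (real n)\<^sup>2)) ^ t_param n \<le> exp (- (1 / (2 * (real n)\<^sup>2) * real (t_param n)))"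
        by (rule one_minus_power_le_exp[OF x])
      also have "\<dots> \<le> exp (- (((real n * ln (real n))\<^sup>2 - 1) / (2 * (real n)\<^sup>2)))"
      proof -
        have "((real n * ln (real n))\<^sup>2 - 1) / (2 * (real n)\<^sup>2) \<le> real (t_param n) / (2 * (real n)\<^sup>2)"
          using t by (intro divide_right_mono) auto
        then show ?thesis by simp
      qed
      finally show "(1 - 1 / (2 * (real n)\<^sup>2)) ^ t_param n \<le> exp (- (((real n * ln (real n))\<^sup>2 - 1) / (2 * (real n)\<^sup>2)))" .
    qed simp
    have 4: "real (t_param n) * (1 - 1 / (2 * (real n)\<^sup>2)) ^ (n ^ 3) \<le> ((real n * ln (real n))\<^sup>2 + 1) * exp (- (real n ^ 3 / (2 * (real n)\<^sup>2)))"
    proof (rule mult_mono)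
      show "(1 - 1 / (2 * (real n)\<^sup>2)) ^ (n ^ 3) \<le> exp (- (real n ^ 3 / (2 * (real n)\<^sup>2)))"
        using one_minus_power_le_exp[OF x, of "n ^ 3"] by simp
      show "0 \<le> (1 - 1 / (2 * (real n)\<^sup>2)) ^ (n ^ 3)" using x by (intro zero_le_power) linarith
    qed (use t in auto)
    have "total_bound \<le> real n powr (- 1 * ln (real n) powr (1/2))"
      unfolding total_bound_def draw_bound_def 1 using 2 3 4 elim(2-5) by linarith
    then show ?case using success_probability by linarith
  qed
qed

end

lemma main_succeeds_cong_kernel:
  assumes "\<And>i j. i \<in> {1..n} \<Longrightarrow> j \<in> {1..n} \<Longrightarrow> w (U i) (U j) = w' (U i) (U j)"
  shows "main_succeeds n \<alpha> m t \<zeta> w D (U, W, x) \<longleftrightarrow> main_succeeds n \<alpha> m t \<zeta> w' D (U, W, x)"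
proof -
  have "random_graph n w U W = random_graph n w' U W"
    using assms by (auto simp: random_graph_def fun_eq_iff)
  then show ?thesis by (simp add: main_succeeds_def)
qed

theorem theorem1:
  fixes w :: "real \<Rightarrow> real \<Rightarrow> real" and f :: "real \<Rightarrow> real" and \<alpha> d c d' :: real
  assumes "graphon w"
    and "0 < \<alpha>" and "\<alpha> < 1"
    and "f \<in> {0..1} \<rightarrow> {0..1}" and "antimono_on {0..1} f"
    and "\<forall>x\<in>{0..1}. \<forall>y\<in>{0..1}. w x y = f \<bar>x - y\<bar>"
    and "0 < d" and "d < 1/2"
    and "0 \<le> c" and "c < f 0"
    and "\<forall>z\<in>{d..1}. f z = c"
    and "d' = min (1/2) (2 * d)"
    and "(INF s\<in>{0..d}. LBINT z:{0..1}. f z * f \<bar>s - z\<bar>) > \<alpha>"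
    and "\<alpha> > (LBINT z:{0..1}. f \<bar>z - (1 - d') / 2\<bar> * f \<bar>z - (1 + d') / 2\<bar>)"
  shows "with_extreme_probability
           (\<lambda>n. run_space n (m_param n))
           (\<lambda>n. main_succeeds n \<alpha> (m_param n) (t_param n) (zeta_param n) w
                  (sqrt (real n) * ln (real n) ^ 5))"
proof -
  \<comment> \<open>Truncating at 1 continues \<open>f\<close> by its final value, which is c
    because \<open>d < 1/2\<close>.\<close>
  define \<phi> where "\<phi> = (\<lambda>z. f (min 1 \<bar>z\<bar>))"
  have f01: "f z \<in> {0..1}" if "z \<in> {0..1}" for z using assms(4) that by blast
  have anti: "f y \<le> f x" if "0 \<le> x" "x \<le> y" "y \<le> 1" for x y
    using assms(5) that by (auto simp: monotone_on_def)
  interpret link_profile \<phi> c d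
  proof
    fix z z' :: real
    show "\<phi> (- z) = \<phi> z" by (simp add: \<phi>_def)
    show "0 \<le> \<phi> z" "\<phi> z \<le> 1" using f01[of "min 1 \<bar>z\<bar>"] by (auto simp: \<phi>_def)
    show "0 \<le> z \<Longrightarrow> z \<le> z' \<Longrightarrow> \<phi> z' \<le> \<phi> z" unfolding \<phi>_def by (intro anti) auto
    show "d \<le> z \<Longrightarrow> \<phi> z = c" using assms(7,8,11) by (auto simp: \<phi>_def)
  qed (use assms in auto)
  have \<phi>_f: "\<phi> z = f \<bar>z\<bar>" if "\<bar>z\<bar> \<le> 1" for z using that by (simp add: \<phi>_def min_def)
  have sq_LBINT: "sq x y = (LBINT z:{0..1}. f \<bar>z - x\<bar> * f \<bar>z - y\<bar>)" if "x \<in> {0..1}" "y \<in> {0..1}" for x y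
  proof -
    have "sq x y = (LBINT z:{0..1}. \<phi> (z - x) * \<phi> (z - y))"
      unfolding sq_def
      by (rule set_borel_integral_eq_integral(2)[symmetric], rule set_integrable_bounded_borel[where B=1])
         (auto simp: phi_mult_abs_le)
    also have "\<dots> = (LBINT z:{0..1}. f \<bar>z - x\<bar> * f \<bar>z - y\<bar>)"
      using that by (intro set_lebesgue_integral_cong) (auto simp: \<phi>_f)
    finally show ?thesis .
  qed
  define I where "I = (INF s\<in>{0..d}. LBINT z:{0..1}. f z * f \<bar>s - z\<bar>)"
  have sq0: "sq 0 s = (LBINT z:{0..1}. f z * f \<bar>s - z\<bar>)" if "s \<in> {0..d}" for s
  proof -
    have "sq 0 s = (LBINT z:{0..1}. f \<bar>z - 0\<bar> * f \<bar>z - s\<bar>)"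
      using that d_half by (intro sq_LBINT) auto
    also have "\<dots> = (LBINT z:{0..1}. f z * f \<bar>s - z\<bar>)"
      by (intro set_lebesgue_integral_cong) (auto simp: abs_minus_commute)
    finally show ?thesis .
  qed
  \<comment> \<open>The infimum of a set of reals is a lower bound only if the set is bounded
    below.\<close>
  have bdd: "bdd_below ((\<lambda>s. LBINT z:{0..1}. f z * f \<bar>s - z\<bar>) ` {0..d})"
  proof (rule bdd_belowI2)
    fix s assume "s \<in> {0..d}"
    then show "0 \<le> (LBINT z:{0..1}. f z * f \<bar>s - z\<bar>)" using sq0[of s] sq_nonneg[of 0 s] by simp
  qed
  have near: "\<alpha> + (I - \<alpha>) \<le> sq 0 s" if "s \<in> {0..d}" for s
    using cINF_lower[OF bdd that] sq0[OF that] by (simp add: I_def)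
  have "0 < I - \<alpha>" using assms(13) by (simp add: I_def)
  moreover have "c < \<phi> 0" using assms(10) by (simp add: \<phi>_def)
  moreover have "sq ((1 - d') / 2) ((1 + d') / 2) < \<alpha>"
    using assms(7,8,12,14) by (subst sq_LBINT) auto
  ultimately obtain \<mu> \<kappa> where "square_profile sq \<alpha> d \<mu> \<kappa>"
    using ex_square_profile[OF _ assms(12) _ _ near] by blast
  then interpret profile: square_profile sq \<alpha> d \<mu> \<kappa> .
  interpret interval_graphon \<phi> c d \<alpha> \<mu> \<kappa> ..
  \<comment> \<open>The graphon and the extended kernel agree only on the unit square, but every
    outcome has its positions there.\<close>
  have eq: "{\<omega> \<in> space (run_space n m). main_succeeds n \<alpha> m t \<zeta> w D \<omega>} =
      {\<omega> \<in> space (run_space n m). main_succeeds n \<alpha> m t \<zeta> kernel D \<omega>}" for n m t \<zeta> D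
  proof -
    have "main_succeeds n \<alpha> m t \<zeta> w D \<omega> \<longleftrightarrow> main_succeeds n \<alpha> m t \<zeta> kernel D \<omega>"
      if "\<omega> \<in> space (run_space n m)" for \<omega>
    proof (cases \<omega>)
      case (fields U W x)
      have U: "U i \<in> {0..1}" if "i \<in> {1..n}" for i
        using \<open>\<omega> \<in> _\<close> that fields by (auto simp: run_space_def space_pair_measure space_PiM PiE_def Pi_def)
      have "w (U i) (U j) = \<phi> (U i - U j)" if "i \<in> {1..n}" "j \<in> {1..n}" for i j
        using assms(6) U[OF that(1)] U[OF that(2)] by (auto simp: \<phi>_f)
      then show ?thesis unfolding fields by (intro main_succeeds_cong_kernel)
    qed
    then show ?thesis by blast
  qed
  obtain N\<^sub>0 where N: "\<And>n. N\<^sub>0 \<le> n \<Longrightarrow> 1 - real n powr (- 1 * ln (real n) powr (1/2)) \<le>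
     measure (run_space n (m_param n)) {\<omega> \<in> space (run_space n (m_param n)).
       main_succeeds n \<alpha> (m_param n) (t_param n) (zeta_param n) kernel (sqrt (real n) * ln (real n) ^ 5) \<omega>}"
    using eventually_success unfolding eventually_sequentially by blast
  show ?thesis
    unfolding with_extreme_probability_def eq
  proof (rule exI[of _ 1], rule conjI, simp, rule exI[of _ "1/2"], rule conjI, simp, rule exI[of _ N\<^sub>0], intro allI impI)
    fix n assume "n > N\<^sub>0"
    then show "1 - real n powr (- 1 * ln (real n) powr (1/2)) \<le>
     measure (run_space n (m_param n)) {\<omega> \<in> space (run_space n (m_param n)).
       main_succeeds n \<alpha> (m_param n) (t_param n) (zeta_param n) kernel (sqrt (real n) * ln (real n) ^ 5) \<omega>}"
      by (intro N) simp
  qed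
qed

end
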